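(* Let $X,Y,V$ be separable Hilbert spaces, let $A:D(A)\to X$ and $B:D(B)\to Y$ be generators of strongly continuous semigroups of bounded operators on $X$ and $Y$, and let $C\in\mathcal{L}(X_1,V)$ be an admissible observation operator for $A$. Let $Z=X\overline{\otimes}Y$, $\mathcal{V}=V\overline{\otimes}Y$, $\mathcal{A}=A+B$ (the closure of $A\otimes I+I\otimes B$) and $\mathcal{C}=C\otimes I$. If $B$ is a non-positive self-adjoint operator, then for all $T>0$ the null-controllability cost $\kappa_T$ in time $T$ of the control system $$\dot\zeta(t)=\mathcal{A}'\zeta(t)+\mathcal{C}'u(t),\qquad \zeta(0)=\zeta_0\in Z',\qquad u\in L^2_{\mathrm{loc}}(\mathbb{R};\mathcal{V}'),$$ and the null-controllability cost $k_T$ in the same time $T$ of the control system $$\dot\xi(t)=A'\xi(t)+C'u(t),\qquad \xi(0)=\xi_0\in X',\qquad u\in L^2_{\mathrm{loc}}(\mathbb{R};V'),$$ satisfy $\kappa_T\le k_T$.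
   Context: Abstract control systems. Let $Z,\mathcal{V}$ be Hilbert spaces and $\mathcal{A}:D(\mathcal{A})\to Z$ the generator of a strongly continuous semigroup $(e^{t\mathcal{A}})_{t\ge0}$ of bounded operators on $Z$. $Z_1$ denotes $D(\mathcal{A})$ with the norm $\|z\|_1=\|(\mathcal{A}-\beta)z\|$ for some $\beta\notin\sigma(\mathcal{A})$ (the spectrum of $\mathcal A$). $Z'$ is the dual of $Z$, $\mathcal{A}'$ the dual operator of $\mathcal{A}$ on $Z'$, and $Z'_{-1}$, the dual of $Z_1$, is the completion of $Z'$ for the norm $\|\zeta\|_{-1}=\|(\mathcal{A}'-\bar\beta)^{-1}\zeta\|$. Let $\mathcal{C}\in\mathcal{L}(Z_1,\mathcal{V})$ with dual $\mathcal{C}'\in\mathcal{L}(\mathcal{V}',Z'_{-1})$. The same theory applies to any $\mathcal{A}$-bounded operator $\mathcal{C}$ with a domain invariant under $(e^{t\mathcal{A}})_{t\ge0}$, since it can be represented by an operator in $\mathcal{L}(Z_1,\mathcal{V})$. Admissibility. $\mathcal{C}$ is admissible if for all $T>0$ there is $K_T>0$ such that $\int_0^T\|\mathcal{C}e^{t\mathcal{A}}z_0\|^2dt\le K_T\|z_0\|^2$ for all $z_0\in D(\mathcal{A})$; equivalently, $\|\int_0^Te^{t\mathcal{A}'}\mathcal{C}'u(t)dt\|^2\le K_T\int_0^T\|u(t)\|^2dt$ for all $u\in L^2(\mathbb{R};\mathcal{V}')$. Under admissibility the output map $z_0\mapsto v$, $v(t)=\mathcal{C}e^{t\mathcal{A}}z_0$,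 extends continuously from $D(\mathcal{A})$ to $Z$ (with values in $L^2_{\mathrm{loc}}$ in time with values in $\mathcal{V}$), and the solution of $\dot\zeta=\mathcal{A}'\zeta+\mathcal{C}'u$ is $\zeta(t)=e^{t\mathcal{A}'}\zeta(0)+\int_0^te^{(t-s)\mathcal{A}'}\mathcal{C}'u(s)\,ds$. Null-controllability and cost. The control system $\dot\zeta=\mathcal{A}'\zeta+\mathcal{C}'u$ is null-controllable in time $T>0$ at cost $\kappa_T>0$ if for all $\zeta_0\in Z'$ there is $u\in L^2(\mathbb{R};\mathcal{V}')$ such that $\zeta(T)=0$ and $\int_0^T\|u(t)\|^2dt\le\kappa_T^2\|\zeta_0\|^2$. The null-controllability cost in time $T$ is the smallest constant $\kappa_T$ in this inequality; equivalently (by duality) it is the smallest $\kappa_T$ such that $\|e^{T\mathcal{A}}z_0\|^2\le\kappa_T^2\int_0^T\|v(t)\|^2dt$ for all $z_0\in Z$, with $v$ the (extended) output of $z_0$. If the system is not null-controllable in time $T$, the cost is $+\infty$. The same definitions are used for $(X,V,A,C)$ in place of $(Z,\mathcal{V},\mathcal{A},\mathcal{C})$; in particular $X_1$ is $D(A)$ with norm $\|(A-\beta)x\|$, $\beta\notin\sigma(A)$. Tensor products. $I$ denotes the identity operator. $X\otimes Y$ is the algebraic tensor product and $X\overline{\otimes}Y$ its closure (completion) for the natural Hilbert norm; similarly for $V\overline{\otimes}Y$. The operator $C\otimes I:D(C)\otimes Y\to V\overline{\otimes}Y$ is densely defined on $X\overline{\otimes}Y$, where $D(C)=D(A)$. The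 operator $A\otimes I+I\otimes B$ defined on the algebraic tensor product $D(A)\otimes D(B)$ is closable, and its closure, denoted $A+B$, generates a strongly continuous semigroup of bounded operators on $X\overline{\otimes}Y$. *)

theory Defs
  imports "HOL-Analysis.Analysis"
begin

section \<open>Complex Hilbert spaces\<close>

text \<open>A complex inner product space is a real inner product space (with the norm of
  \<^class>\<open>real_inner\<close>) carrying a complex scalar multiplication and a sesquilinear form, linear in
  the first argument, whose real part is the given real inner product.\<close>

class complex_inner = real_inner +
  fixes scaleC :: "complex \<Rightarrow> 'a \<Rightarrow> 'a" (infixr \<open>*\<^sub>C\<close> 75)
    and cinner :: "'a \<Rightarrow> 'a \<Rightarrow> complex"
  assumes scaleC_add_right: "c *\<^sub>C (x + y) = c *\<^sub>C x + c *\<^sub>C y"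
    and scaleC_add_left: "(c + d) *\<^sub>C x = c *\<^sub>C x + d *\<^sub>C x"
    and scaleC_scaleC: "c *\<^sub>C d *\<^sub>C x = (c * d) *\<^sub>C x"
    and scaleC_of_real: "of_real r *\<^sub>C x = r *\<^sub>R x"
    and cinner_commute: "cinner x y = cnj (cinner y x)"
    and cinner_add_left: "cinner (x + y) z = cinner x z + cinner y z"
    and cinner_scaleC_left: "cinner (c *\<^sub>C x) y = c * cinner x y"
    and Re_cinner: "Re (cinner x y) = inner x y"

class chilbert_space = complex_inner + banach

instantiation complex :: chilbert_space
begin

definition scaleC_complex :: "complex \<Rightarrow> complex \<Rightarrow> complex"
  where "scaleC_complex c x = c * x"

definition cinner_complex :: "complex \<Rightarrow> complex \<Rightarrow> complex"
  where "cinner_complex x y = x * cnj y"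

instance
  by standard
    (simp_all add: scaleC_complex_def cinner_complex_def algebra_simps scaleR_conv_of_real
      inner_complex_def)

end

text \<open>The dual space: the complex-linear ones among the bounded real-linear maps into the complex
  numbers; the norm of \<^typ>\<open>'a \<Rightarrow>\<^sub>L complex\<close> restricts to the dual norm.\<close>

definition cdual :: "('a::complex_inner \<Rightarrow>\<^sub>L complex) set"
  where "cdual = {f. \<forall>c x. blinfun_apply f (c *\<^sub>C x) = c * blinfun_apply f x}"


section \<open>Unbounded operators\<close>

text \<open>An unbounded operator is represented by its graph, so that \<^const>\<open>Domain\<close> is its domain and
  the closure of a closable operator is the topological closure of its graph.\<close>

definition linear_op :: "('a::complex_inner \<times> 'b::complex_inner) set \<Rightarrow> bool"
  where "linear_op A \<longleftrightarrow> single_valued A \<and> (0, 0) \<in> A \<and>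
    (\<forall>x y x' y'. (x, y) \<in> A \<longrightarrow> (x', y') \<in> A \<longrightarrow> (x + x', y + y') \<in> A) \<and>
    (\<forall>c x y. (x, y) \<in> A \<longrightarrow> (c *\<^sub>C x, c *\<^sub>C y) \<in> A)"

definition op_apply :: "('a \<times> 'b) set \<Rightarrow> 'a \<Rightarrow> 'b" (infixl \<open>\<bullet>\<^sub>o\<close> 90)
  where "A \<bullet>\<^sub>o x = (THE y. (x, y) \<in> A)"

definition spectrum :: "('a::chilbert_space \<times> 'a) set \<Rightarrow> complex set"
  where "spectrum A = {\<beta>. \<not> (\<exists>R :: 'a \<Rightarrow>\<^sub>L 'a.
    (\<forall>x y. (x, y) \<in> A \<longrightarrow> blinfun_apply R (y - \<beta> *\<^sub>C x) = x) \<and>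
    (\<forall>w. (blinfun_apply R w, w + \<beta> *\<^sub>C blinfun_apply R w) \<in> A))}"

definition adjoint_op :: "('a::complex_inner \<times> 'a) set \<Rightarrow> ('a \<times> 'a) set"
  where "adjoint_op B = {(u, v). \<forall>x y. (x, y) \<in> B \<longrightarrow> cinner y u = cinner x v}"

definition selfadjoint :: "('a::complex_inner \<times> 'a) set \<Rightarrow> bool"
  where "selfadjoint B \<longleftrightarrow> linear_op B \<and> closure (Domain B) = UNIV \<and> adjoint_op B = B"

definition nonpositive :: "('a::complex_inner \<times> 'a) set \<Rightarrow> bool"
  where "nonpositive B \<longleftrightarrow> (\<forall>x y. (x, y) \<in> B \<longrightarrow> Re (cinner y x) \<le> 0)"


section \<open>Strongly continuous semigroups\<close>

definition c0_semigroup :: "(real \<Rightarrow> 'a::chilbert_space \<Rightarrow>\<^sub>L 'a) \<Rightarrow> bool"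
  where "c0_semigroup S \<longleftrightarrow>
    (\<forall>t\<ge>0. \<forall>c x. blinfun_apply (S t) (c *\<^sub>C x) = c *\<^sub>C blinfun_apply (S t) x) \<and>
    S 0 = id_blinfun \<and>
    (\<forall>s\<ge>0. \<forall>t\<ge>0. S (s + t) = S s o\<^sub>L S t) \<and>
    (\<forall>x. ((\<lambda>t. blinfun_apply (S t) x) \<longlongrightarrow> x) (at_right 0))"

definition generator :: "(real \<Rightarrow> 'a::chilbert_space \<Rightarrow>\<^sub>L 'a) \<Rightarrow> ('a \<times> 'a) set"
  where "generator S = {(x, y). ((\<lambda>t. (blinfun_apply (S t) x - x) /\<^sub>R t) \<longlongrightarrow> y) (at_right 0)}"

definition generates_semigroup :: "('a::chilbert_space \<times> 'a) set \<Rightarrow> bool"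
  where "generates_semigroup A \<longleftrightarrow> (\<exists>S. c0_semigroup S \<and> generator S = A)"

text \<open>A generator determines its semigroup at the times \<open>t \<ge> 0\<close>; the values at negative times,
  which the choice below leaves open, are never used.\<close>

definition exp_op :: "('a::chilbert_space \<times> 'a) set \<Rightarrow> real \<Rightarrow> 'a \<Rightarrow>\<^sub>L 'a"
  where "exp_op A = (SOME S. c0_semigroup S \<and> generator S = A)"


section \<open>Observation operators\<close>

text \<open>\<open>C\<close> is a bounded operator from \<open>D(A)\<close>, with the norm of \<open>(A - \<beta>) x\<close>, to the output space.\<close>

definition bounded_on_Z1 ::
  "complex \<Rightarrow> ('a::chilbert_space \<times> 'a) set \<Rightarrow> ('a \<times> 'b::chilbert_space) set \<Rightarrow> bool"
  where "bounded_on_Z1 \<beta> A C \<longleftrightarrow> linear_op C \<and> Domain C = Domain A \<and>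
    (\<exists>K. \<forall>x\<in>Domain A. norm (C \<bullet>\<^sub>o x) \<le> K * norm (A \<bullet>\<^sub>o x - \<beta> *\<^sub>C x))"

definition admissible ::
  "('a::chilbert_space \<times> 'a) set \<Rightarrow> ('a \<times> 'b::chilbert_space) set \<Rightarrow> bool"
  where "admissible A C \<longleftrightarrow> (\<forall>T>0. \<exists>K>0. \<forall>x\<in>Domain A.
    (\<integral>\<^sup>+t\<in>{0..T}. ennreal ((norm (C \<bullet>\<^sub>o (blinfun_apply (exp_op A t) x)))\<^sup>2) \<partial>lborel)
      \<le> ennreal (K * (norm x)\<^sup>2))"

text \<open>The operator on \<open>D(A)\<close> that represents an operator \<open>C\<close> whose domain need not be \<open>D(A)\<close>
  (such as \<open>C \<otimes> I\<close>, whose domain is an algebraic tensor product): the extension of \<open>C\<close>,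
  restricted to \<open>D(A) \<inter> D(C)\<close>, by continuity for the graph norm of \<open>A\<close>. For an operator that is
  already bounded from \<open>D(A)\<close> with the graph norm it is \<open>C\<close> itself.\<close>

definition Z1_extension ::
  "('a::chilbert_space \<times> 'a) set \<Rightarrow> ('a \<times> 'b::chilbert_space) set \<Rightarrow> ('a \<times> 'b) set"
  where "Z1_extension A C =
    {(z, w). \<exists>y. ((z, y), w) \<in> closure {((x, y'), v). (x, y') \<in> A \<and> (x, v) \<in> C}}"


section \<open>Null-controllability cost\<close>

text \<open>Square integrable controls with values in the dual of the output space. As that space is
  separable, so is its dual, and Borel measurability is strong measurability.\<close>

definition L2_control :: "(real \<Rightarrow> 'b::chilbert_space \<Rightarrow>\<^sub>L complex) \<Rightarrow> bool"
  where "L2_control u \<longleftrightarrow> u \<in> borel_measurable lborel \<and> (\<forall>t. u t \<in> cdual) \<and>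
    (\<integral>\<^sup>+t. ennreal ((norm (u t))\<^sup>2) \<partial>lborel) < \<infinity>"

text \<open>The solution \<open>\<zeta>(t) = e\<^bsup>tA'\<^esup> \<zeta>\<^sub>0 + \<integral>\<^sub>0\<^sup>t e\<^bsup>(t-s)A'\<^esup> C' u(s) ds\<close> of
  \<open>\<zeta>' = A' \<zeta> + C' u\<close>, as an element of the dual of \<open>Z\<^sub>1\<close>: only its values at \<open>z \<in> D(A)\<close>
  are meaningful. The dual operators act by composition, \<open>C' v = v \<circ> C\<close> and
  \<open>e\<^bsup>tA'\<^esup> \<phi> = \<phi> \<circ> e\<^bsup>tA\<^esup>\<close>, and the integral in the dual of \<open>Z\<^sub>1\<close> is evaluated at \<open>z\<close>.\<close>

definition control_state ::
  "('a::chilbert_space \<times> 'a) set \<Rightarrow> ('a \<times> 'b::chilbert_space) set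
    \<Rightarrow> (real \<Rightarrow> 'b \<Rightarrow>\<^sub>L complex) \<Rightarrow> ('a \<Rightarrow>\<^sub>L complex) \<Rightarrow> real \<Rightarrow> 'a \<Rightarrow> complex"
  where "control_state A C u \<zeta>0 t z =
    blinfun_apply \<zeta>0 (blinfun_apply (exp_op A t) z) +
    (LBINT s:{0..t}. blinfun_apply (u s) (C \<bullet>\<^sub>o (blinfun_apply (exp_op A (t - s)) z)))"

definition null_controllable ::
  "('a::chilbert_space \<times> 'a) set \<Rightarrow> ('a \<times> 'b::chilbert_space) set \<Rightarrow> real \<Rightarrow> real \<Rightarrow> bool"
  where "null_controllable A C T \<kappa> \<longleftrightarrow> (\<forall>\<zeta>0\<in>cdual. \<exists>u. L2_control u \<and>
    (\<forall>z\<in>Domain A. control_state A C u \<zeta>0 T z = 0) \<and>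
    (\<integral>\<^sup>+t\<in>{0..T}. ennreal ((norm (u t))\<^sup>2) \<partial>lborel) \<le> ennreal (\<kappa>\<^sup>2 * (norm \<zeta>0)\<^sup>2))"

text \<open>The infimum of the empty set is \<open>\<infinity>\<close>.\<close>

definition null_control_cost ::
  "('a::chilbert_space \<times> 'a) set \<Rightarrow> ('a \<times> 'b::chilbert_space) set \<Rightarrow> real \<Rightarrow> ennreal"
  where "null_control_cost A C T = Inf (ennreal ` {\<kappa>. \<kappa> > 0 \<and> null_controllable A C T \<kappa>})"


section \<open>Tensor products\<close>

text \<open>\<open>\<tau> x y = x \<otimes> y\<close> makes the Hilbert space \<open>'h\<close> the completion of the algebraic tensor product
  for the natural Hilbert norm; this determines \<open>'h\<close> up to a unique compatible unitary map. That
  distinct algebraic tensors have distinct images in \<open>'h\<close> follows from the condition on the inner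
  products. Here and below the real \<^const>\<open>span\<close> is also the complex one, because the spanning
  sets are invariant under complex scalars.\<close>

definition hilbert_tensor ::
  "('x::chilbert_space \<Rightarrow> 'y::chilbert_space \<Rightarrow> 'h::chilbert_space) \<Rightarrow> bool"
  where "hilbert_tensor \<tau> \<longleftrightarrow>
    (\<forall>x x' y. \<tau> (x + x') y = \<tau> x y + \<tau> x' y) \<and>
    (\<forall>x y y'. \<tau> x (y + y') = \<tau> x y + \<tau> x y') \<and>
    (\<forall>c x y. \<tau> (c *\<^sub>C x) y = c *\<^sub>C \<tau> x y) \<and>
    (\<forall>c x y. \<tau> x (c *\<^sub>C y) = c *\<^sub>C \<tau> x y) \<and>
    (\<forall>x x' y y'. cinner (\<tau> x y) (\<tau> x' y') = cinner x x' * cinner y y') \<and>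
    closure (span {\<tau> x y |x y. True}) = UNIV"

text \<open>\<open>A \<otimes> I + I \<otimes> B\<close> on the algebraic tensor product of \<open>D(A)\<close> and \<open>D(B)\<close>.\<close>

definition tensor_sum ::
  "('x::chilbert_space \<Rightarrow> 'y::chilbert_space \<Rightarrow> 'h::chilbert_space)
    \<Rightarrow> ('x \<times> 'x) set \<Rightarrow> ('y \<times> 'y) set \<Rightarrow> ('h \<times> 'h) set"
  where "tensor_sum \<tau> A B =
    span {(\<tau> x y, \<tau> x' y + \<tau> x y') |x x' y y'. (x, x') \<in> A \<and> (y, y') \<in> B}"

text \<open>\<open>C \<otimes> I\<close> on the algebraic tensor product of \<open>D(C)\<close> and the second factor.\<close>

definition tensor_id ::
  "('x::chilbert_space \<Rightarrow> 'y::chilbert_space \<Rightarrow> 'h::chilbert_space)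
    \<Rightarrow> ('v::chilbert_space \<Rightarrow> 'y \<Rightarrow> 'w::chilbert_space)
    \<Rightarrow> ('x \<times> 'v) set \<Rightarrow> ('h \<times> 'w) set"
  where "tensor_id \<tau> \<tau>' C = span {(\<tau> x y, \<tau>' v y) |x v y. (x, v) \<in> C}"

end

theory Submission
  imports Defs
begin

text \<open>The control for the tensor product system is built from controls for the given one. Let \<open>f\<^sub>j\<close>
  be an orthonormal basis of \<open>Y\<close>. A functional \<open>\<zeta>\<close> on \<open>X \<otimes> Y\<close> splits into the functionals
  \<open>\<xi>\<^sub>j = \<zeta> (\<cdot> \<otimes> f\<^sub>j)\<close> on \<open>X\<close>, with \<open>\<Sum> \<parallel>\<xi>\<^sub>j\<parallel>\<^sup>2 \<le> \<parallel>\<zeta>\<parallel>\<^sup>2\<close>. Each \<open>\<xi>\<^sub>j\<close> is steered to zero by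
  a control with Riesz vectors \<open>g\<^sub>j(s) \<in> V\<close>, at cost \<open>\<kappa>\<close>. The function \<open>G(s) = \<Sum> g\<^sub>j(s) \<otimes> f\<^sub>j\<close>
  then steers \<open>\<zeta>\<close> to zero at cost \<open>\<kappa>\<close>, for the generator \<open>A \<otimes> I\<close>. For \<open>A + B\<close> the control
  is \<open>k(s) = (I \<otimes> e\<^bsup>sB\<^esup>) G(s)\<close>: since \<open>e\<^bsup>sB\<^esup>\<close> is self-adjoint,
  \<open>\<langle>C e\<^bsup>(T-s)A\<^esup> x \<otimes> e\<^bsup>(T-s)B\<^esup> y, k(s)\<rangle> = \<langle>C e\<^bsup>(T-s)A\<^esup> x \<otimes> e\<^bsup>TB\<^esup> y, G(s)\<rangle>\<close>, so that
  the second factor no longer depends on time. The cost does not grow, because \<open>e\<^bsup>sB\<^esup>\<close> is a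
  contraction. No spectral theorem is involved; of \<open>B\<close> only the symmetry and the contraction
  property of its semigroup are used (\<open>selfadjoint_semigroup\<close>, \<open>nonpositive_semigroup_contraction\<close>).

  Two facts make this computation meaningful. Firstly, the closure of \<open>A \<otimes> I + I \<otimes> B\<close> generates
  \<open>e\<^bsup>tA\<^esup> \<otimes> e\<^bsup>tB\<^esup>\<close> (\<open>generator_tensor_semigroup\<close>), because the algebraic tensor product of the
  domains is dense and invariant, hence a core (\<open>closure_core_eq_generator\<close>). Secondly, the
  extension of \<open>C \<otimes> I\<close> is single valued and defined on all of \<open>D(\<A>)\<close> (\<open>observation_graph_unique\<close>,
  \<open>CC_bounded\<close>). Boundedness relative to \<open>\<A>\<close> does not follow from boundedness relative to \<open>A\<close>
  directly; it comes from admissibility, applied to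
  \<open>z = \<integral>\<^sub>0\<^sup>1 e\<^bsup>s\<A>\<^esup> z ds - \<integral>\<^sub>0\<^sup>1 (1 - s) e\<^bsup>s\<A>\<^esup> \<A> z ds\<close>.\<close>

section \<open>Complex inner product spaces\<close>

lemma scaleR_eq_scaleC: "r *\<^sub>R x = of_real r *\<^sub>C (x::'a::complex_inner)"
  by (simp add: scaleC_of_real)

lemma scaleC_one [simp]: "1 *\<^sub>C (x::'a::complex_inner) = x"
  using scaleC_of_real[of 1 x] by simp

lemma scaleC_zero_left [simp]: "0 *\<^sub>C (x::'a::complex_inner) = 0"
  using scaleC_of_real[of 0 x] by simp

lemma scaleC_zero_right [simp]: "c *\<^sub>C (0::'a::complex_inner) = 0"
  using scaleC_add_right[of c 0 "0::'a"] by simp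

lemma scaleC_scaleR: "c *\<^sub>C r *\<^sub>R (x::'a::complex_inner) = r *\<^sub>R c *\<^sub>C x"
  by (simp add: scaleR_eq_scaleC scaleC_scaleC mult.commute)

lemma cinner_scaleC_right: "cinner x (c *\<^sub>C y) = cnj c * cinner x y"
  by (metis cinner_commute cinner_scaleC_left complex_cnj_mult)

lemma cinner_add_right: "cinner x (y + z) = cinner x y + cinner x z"
  by (metis cinner_add_left cinner_commute complex_cnj_add)

lemma cinner_self: "cinner x x = of_real ((norm x)\<^sup>2)"
proof -
  have "Im (cinner x x) = 0"
    using cinner_commute[of x x] by (metis add.inverse_inverse cnj.simps(2) neg_equal_zero)
  then show ?thesis
    by (simp add: complex_eq_iff Re_cinner power2_norm_eq_inner)
qed

lemma norm_scaleC: "norm (c *\<^sub>C x) = cmod c * norm (x::'a::complex_inner)"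
proof -
  have "of_real ((norm (c *\<^sub>C x))\<^sup>2) = c * cnj c * cinner x x"
    by (simp only: cinner_self[symmetric] cinner_scaleC_left cinner_scaleC_right mult_ac)
  also have "\<dots> = of_real ((cmod c * norm x)\<^sup>2)"
    by (simp add: cinner_self complex_norm_square[symmetric] power_mult_distrib)
  finally have "(norm (c *\<^sub>C x))\<^sup>2 = (cmod c * norm x)\<^sup>2"
    by (simp only: of_real_eq_iff)
  then show ?thesis
    by (simp add: power2_eq_iff_nonneg)
qed

lemma norm_cinner_le: "cmod (cinner x y) \<le> norm x * norm y"
proof (cases "cinner x y = 0")
  case False
  define c where "c = cnj (sgn (cinner x y))"
  have c: "cmod c = 1"
    using False by (simp add: c_def norm_sgn)
  have "c * cinner x y = of_real (cmod (cinner x y))"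
    using False complex_norm_square[of "cinner x y"]
    by (simp add: c_def sgn_eq power2_eq_square field_simps)
  then have "cmod (cinner x y) = Re (cinner (c *\<^sub>C x) y)"
    by (simp add: cinner_scaleC_left)
  also have "\<dots> \<le> norm (c *\<^sub>C x) * norm y"
    by (simp add: Re_cinner norm_cauchy_schwarz)
  finally show ?thesis
    by (simp add: norm_scaleC c)
qed simp

lemma bounded_bilinear_cinner: "bounded_bilinear cinner"
proof
  show "cinner (r *\<^sub>R a) b = r *\<^sub>R cinner a b" for r and a b :: 'a
    by (simp add: scaleR_eq_scaleC cinner_scaleC_left scaleC_complex_def)
  show "cinner a (r *\<^sub>R b) = r *\<^sub>R cinner a b" for r and a b :: 'a
    by (simp add: scaleR_eq_scaleC cinner_scaleC_right scaleC_complex_def)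
  show "\<exists>K. \<forall>a b::'a. cmod (cinner a b) \<le> norm a * norm b * K"
    by (intro exI[of _ 1]) (simp add: norm_cinner_le)
qed (simp_all add: cinner_add_left cinner_add_right)

lemma bounded_linear_scaleC: "bounded_linear ((*\<^sub>C) c :: 'a \<Rightarrow> 'a::complex_inner)"
  by (rule bounded_linear_intro[of _ "cmod c"])
    (simp_all add: scaleC_add_right scaleC_scaleR norm_scaleC mult.commute)

lemmas cinner_zero_left [simp] = bounded_bilinear.zero_left[OF bounded_bilinear_cinner]
lemmas cinner_zero_right [simp] = bounded_bilinear.zero_right[OF bounded_bilinear_cinner]
lemmas cinner_diff_left = bounded_bilinear.diff_left[OF bounded_bilinear_cinner]

lemmas cinner_sum_left = bounded_bilinear.sum_left[OF bounded_bilinear_cinner]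

lemmas scaleC_sum_right = linear_sum[OF bounded_linear.linear[OF bounded_linear_scaleC]]
lemmas scaleC_diff_right = linear_diff[OF bounded_linear.linear[OF bounded_linear_scaleC]]

text \<open>The functional \<open>\<langle>\<cdot>, r\<rangle>\<close>; by the Riesz theorem every element of the dual has this form.\<close>

definition cinner_dual :: "'a::complex_inner \<Rightarrow> 'a \<Rightarrow>\<^sub>L complex"
  where "cinner_dual r = Blinfun (\<lambda>x. cinner x r)"

lemma cinner_dual_apply [simp]: "blinfun_apply (cinner_dual r) x = cinner x r"
  unfolding cinner_dual_def
  by (simp add: bounded_linear_Blinfun_apply bounded_bilinear.bounded_linear_left[OF bounded_bilinear_cinner])

lemma cinner_dual_in_cdual: "cinner_dual r \<in> cdual"
  by (simp add: cdual_def cinner_scaleC_left)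

lemma norm_cinner_dual_le: "norm (cinner_dual r) \<le> norm r"
  by (rule norm_blinfun_bound) (simp_all add: mult.commute norm_cinner_le)

lemma norm_cinner_dual: "norm (cinner_dual r) = norm r"
proof (rule antisym[OF norm_cinner_dual_le])
  have "norm r * norm r \<le> norm (cinner_dual r) * norm r"
    using norm_blinfun[of "cinner_dual r" r] by (simp add: cinner_self norm_power power2_eq_square norm_mult)
  then show "norm r \<le> norm (cinner_dual r)"
    by (cases "r = 0") (simp_all add: mult_le_cancel_right)
qed

lemma bounded_linear_cinner_dual: "bounded_linear cinner_dual"
  by (rule bounded_linear_intro[of _ 1])
    (auto intro!: blinfun_eqI simp: cinner_add_right norm_cinner_dual_le blinfun.bilinear_simps
        bounded_bilinear.scaleR_right[OF bounded_bilinear_cinner])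


section \<open>Subspaces, closures and integrals\<close>

lemma closed_subspace_UNIV:
  assumes "subspace S" "closed S" "closure (span D) = UNIV" "D \<subseteq> S"
  shows "S = UNIV"
  using assms by (metis closure_minimal span_minimal top.extremum_uniqueI)

lemma in_closureI:
  fixes x :: "'a::first_countable_topology"
  assumes "\<And>n. s n \<in> S" "s \<longlonglongrightarrow> x"
  shows "x \<in> closure S"
  using assms by (auto simp: closure_sequential)

lemma subspace_closure:
  fixes S :: "'a::real_normed_vector set"
  assumes "subspace S"
  shows "subspace (closure S)"
  unfolding subspace_def
proof (intro conjI ballI allI)
  show "0 \<in> closure S"
    using assms closure_subset subspace_0 by blast
  show "x + y \<in> closure S" if "x \<in> closure S" "y \<in> closure S" for x y
  proof -
    obtain s t where "\<And>n. s n \<in> S" "s \<longlonglongrightarrow> x" "\<And>n. t n \<in> S" "t \<longlonglongrightarrow> y"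
      using \<open>x \<in> closure S\<close> \<open>y \<in> closure S\<close> unfolding closure_sequential by blast
    then have "(\<lambda>n. s n + t n) \<longlonglongrightarrow> x + y" "\<And>n. s n + t n \<in> S"
      using assms by (auto intro: tendsto_add subspace_add)
    then show ?thesis
      by (intro in_closureI)
  qed
  show "r *\<^sub>R x \<in> closure S" if "x \<in> closure S" for r x
  proof -
    obtain s where "\<And>n. s n \<in> S" "s \<longlonglongrightarrow> x"
      using \<open>x \<in> closure S\<close> unfolding closure_sequential by blast
    then have "(\<lambda>n. r *\<^sub>R s n) \<longlonglongrightarrow> r *\<^sub>R x" "\<And>n. r *\<^sub>R s n \<in> S"
      using assms by (auto intro: tendsto_intros subspace_scale)
    then show ?thesis
      by (intro in_closureI)
  qed
qed

lemma blinfun_eq_on_dense_span: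
  fixes F G :: "'a::real_normed_vector \<Rightarrow>\<^sub>L 'b::real_normed_vector"
  assumes "closure (span D) = UNIV" "\<And>x. x \<in> D \<Longrightarrow> blinfun_apply F x = blinfun_apply G x"
  shows "F = G"
proof -
  have "closed {x. blinfun_apply F x = blinfun_apply G x}"
    by (intro closed_Collect_eq continuous_intros)
  moreover have "subspace {x. blinfun_apply F x = blinfun_apply G x}"
    by (auto simp: subspace_def blinfun.bilinear_simps)
  ultimately have "{x. blinfun_apply F x = blinfun_apply G x} = UNIV"
    using assms(2) by (intro closed_subspace_UNIV[OF _ _ assms(1)] subsetI) simp_all
  then show ?thesis
    by (intro blinfun_eqI) blast
qed

lemma integral_in_closed_subspace:
  fixes f :: "real \<Rightarrow> 'a::banach"
  assumes "subspace S" "closed S" "continuous_on {a..b} f" "\<And>t. t \<in> {a..b} \<Longrightarrow> f t \<in> S"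
  shows "integral {a..b} f \<in> S"
proof -
  have "(f has_integral integral {a..b} f) (cbox a b)"
    using assms(3) by (simp add: integrable_continuous_real integrable_integral)
  note int = this[unfolded has_integral, rule_format]
  have appr: "\<exists>y\<in>S. dist y (integral {a..b} f) < e" if e: "e > 0" for e
  proof -
    obtain \<gamma> where \<gamma>: "gauge \<gamma> \<and> (\<forall>\<D>. \<D> tagged_division_of (cbox a b) \<and> \<gamma> fine \<D> \<longrightarrow>
        norm ((\<Sum>(x,k)\<in>\<D>. measure lborel k *\<^sub>R f x) - integral {a..b} f) < e)"
      using int[OF e] by (rule exE)
    obtain p where p: "p tagged_division_of (cbox a b)" "\<gamma> fine p"
      using fine_division_exists[of \<gamma> a b] \<gamma> by blast
    have "(\<Sum>(x,k)\<in>p. measure lborel k *\<^sub>R f x) \<in> S"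
    proof (rule subspace_sum[OF assms(1)], clarify)
      fix x k assume "(x, k) \<in> p"
      then have "x \<in> {a..b}"
        using tagged_division_ofD(2,3)[OF p(1) \<open>(x, k) \<in> p\<close>] by auto
      then show "measure lborel k *\<^sub>R f x \<in> S"
        using assms by (simp add: subspace_scale)
    qed
    then show ?thesis
      using \<gamma> p by (auto simp: dist_norm)
  qed
  then have "integral {a..b} f \<in> closure S"
    by (simp add: closure_approachable)
  then show ?thesis
    using assms(2) by simp
qed

text \<open>A linear relation that is bounded on a dense domain is contained in the graph of a bounded
  operator.\<close>

lemma bounded_relation_extension:
  fixes R :: "('a::real_normed_vector \<times> 'b::banach) set"
  assumes sub: "subspace R" and bd: "\<And>a b. (a, b) \<in> R \<Longrightarrow> norm b \<le> K * norm a"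
    and dense: "closure (Domain R) = UNIV" and K: "K \<ge> 0"
  obtains F where "\<And>a b. (a, b) \<in> R \<Longrightarrow> blinfun_apply F a = b" "norm F \<le> K"
proof -
  define G where "G = closure R"
  have subG: "subspace G"
    unfolding G_def using sub by (rule subspace_closure)
  have closedG: "closed G"
    by (simp add: G_def)
  have bdG: "norm b \<le> K * norm a" if "(a, b) \<in> G" for a b
  proof -
    have "closed {p::'a \<times> 'b. norm (snd p) \<le> K * norm (fst p)}"
      by (intro closed_Collect_le continuous_intros)
    then have "G \<subseteq> {p. norm (snd p) \<le> K * norm (fst p)}"
      unfolding G_def by (intro closure_minimal) (auto simp: bd)
    then show ?thesis
      using that by auto
  qed
  have ex: "\<exists>b. (a, b) \<in> G" for a
  proof -
    have "a \<in> closure (Domain R)"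
      using dense by simp
    then obtain s where s: "\<And>n. s n \<in> Domain R" "s \<longlonglongrightarrow> a"
      unfolding closure_sequential by blast
    then obtain t where t: "\<And>n. (s n, t n) \<in> R"
      by (meson Domain.cases)
    have d: "norm (t m - t n) \<le> K * norm (s m - s n)" for m n
      using bd subspace_diff[OF sub t t, of m n] by simp
    have "Cauchy t"
    proof (rule metric_CauchyI)
      fix e :: real assume "e > 0"
      moreover have "Cauchy s"
        using s(2) by (simp add: LIMSEQ_imp_Cauchy)
      ultimately obtain M where M: "\<And>m n. m \<ge> M \<Longrightarrow> n \<ge> M \<Longrightarrow> dist (s m) (s n) < e / (K + 1)"
        using K by (metis metric_CauchyD add_nonneg_pos divide_pos_pos zero_less_one)
      have "dist (t m) (t n) < e" if "m \<ge> M" "n \<ge> M" for m n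
      proof -
        have "dist (t m) (t n) \<le> (K + 1) * dist (s m) (s n)"
          using d[of m n] by (simp add: dist_norm algebra_simps add.commute add_increasing)
        also have "\<dots> < (K + 1) * (e / (K + 1))"
          using M[OF that] K by (intro mult_strict_left_mono) auto
        finally show ?thesis
          using K by simp
      qed
      then show "\<exists>M. \<forall>m\<ge>M. \<forall>n\<ge>M. dist (t m) (t n) < e"
        by blast
    qed
    then obtain b where "t \<longlonglongrightarrow> b"
      using Cauchy_convergent convergent_def by blast
    then have "(\<lambda>n. (s n, t n)) \<longlonglongrightarrow> (a, b)"
      using s by (intro tendsto_Pair)
    then show ?thesis
      unfolding G_def using in_closureI[of "\<lambda>n. (s n, t n)" R, OF t] by blast
  qed
  have uniq: "b = b'" if "(a, b) \<in> G" "(a, b') \<in> G" for a b b'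
    using bdG[of 0 "b - b'"] subspace_diff[OF subG that] by simp
  define f where "f a = (THE b. (a, b) \<in> G)" for a
  have f: "(a, f a) \<in> G" for a
    unfolding f_def using ex[of a] uniq by (metis (mono_tags) theI)
  have bl: "bounded_linear f"
  proof (rule bounded_linear_intro[of _ K])
    show "f (x + y) = f x + f y" for x y
      using uniq[OF f] subspace_add[OF subG f f, of x y] by simp
    show "f (r *\<^sub>R x) = r *\<^sub>R f x" for r x
      using uniq[OF f] subspace_scale[OF subG f, of r x] by simp
    show "norm (f x) \<le> norm x * K" for x
      using bdG[OF f] by (simp add: mult.commute)
  qed
  show ?thesis
  proof (rule that)
    show "blinfun_apply (Blinfun f) a = b" if "(a, b) \<in> R" for a b
      using that closure_subset[of R] uniq[OF f, of a b]
      by (auto simp: bounded_linear_Blinfun_apply[OF bl] G_def)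
    show "norm (Blinfun f) \<le> K"
      using bdG[OF f] K by (intro norm_blinfun_bound) (simp_all add: bounded_linear_Blinfun_apply[OF bl])
  qed
qed

text \<open>The uniform boundedness principle for a sequence of operators.\<close>

lemma pointwise_bounded_blinfuns:
  fixes F :: "nat \<Rightarrow> 'a::banach \<Rightarrow>\<^sub>L 'b::real_normed_vector"
  assumes "\<And>x. bounded (range (\<lambda>n. blinfun_apply (F n) x))"
  obtains K where "\<And>n. norm (F n) \<le> K"
proof -
  \<comment> \<open>By the Baire category theorem one of the closed sets \<open>U k\<close> contains a ball.\<close>
  define U where "U k = {x. \<forall>n. norm (blinfun_apply (F n) x) \<le> real k}" for k
  have closedU: "closed (U k)" for k
  proof -
    have "U k = (\<Inter>n. {x. norm (blinfun_apply (F n) x) \<le> real k})"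
      by (auto simp: U_def)
    then show ?thesis
      by (auto intro!: closed_INT closed_Collect_le continuous_intros)
  qed
  have "(\<Union>k. U k) = UNIV"
  proof -
    have "\<exists>k. x \<in> U k" for x
    proof -
      obtain B where "\<And>n. norm (blinfun_apply (F n) x) \<le> B"
        using assms[of x] unfolding bounded_iff by auto
      then show ?thesis
        using real_arch_simple[of B] unfolding U_def by (blast intro: order_trans)
    qed
    then show ?thesis
      by blast
  qed
  moreover have "interior (\<Union>(range U)) = {}" if "\<And>k. interior (U k) = {}"
  proof -
    have "Met_TC.mtopology interior_of \<Union>(range U) = ({} :: 'a set)"
    proof (rule Met_TC.metric_Baire_category_alt)
      show "Met_TC.mcomplete TYPE('a)"
        by (simp add: complete_UNIV)
    qed (use that closedU in auto)
    then show ?thesis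
      by simp
  qed
  ultimately have "\<exists>k. interior (U k) \<noteq> {}"
    by auto
  then obtain k x0 where "x0 \<in> interior (U k)"
    by blast
  then obtain e where e: "e > 0" "cball x0 e \<subseteq> U k"
    by (meson mem_interior_cball)
  have "norm (F n) \<le> 2 * real k / e" for n
  proof (rule norm_blinfun_bound)
    show "norm (blinfun_apply (F n) y) \<le> 2 * real k / e * norm y" for y
    proof (cases "y = 0")
      case False
      define z where "z = (e / norm y) *\<^sub>R y"
      have "x0 \<in> U k" "x0 + z \<in> U k"
        using e False by (auto simp: z_def dist_norm intro!: subsetD[OF e(2)])
      then have "norm (blinfun_apply (F n) x0) \<le> k" "norm (blinfun_apply (F n) (x0 + z)) \<le> k"
        by (auto simp: U_def)
      then have "norm (blinfun_apply (F n) z) \<le> 2 * k"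
        using norm_triangle_ineq4[of "blinfun_apply (F n) (x0 + z)" "blinfun_apply (F n) x0"]
        by (simp add: blinfun.bilinear_simps)
      then show ?thesis
        using e False by (simp add: z_def blinfun.bilinear_simps field_simps)
    qed simp
  qed (use e in simp)
  then show ?thesis
    by (rule that)
qed


section \<open>Strongly continuous semigroups and their generators\<close>

lemma has_vector_derivative_iff_quotient:
  fixes f :: "real \<Rightarrow> 'a::real_normed_vector"
  shows "(f has_vector_derivative D) (at x within S) \<longleftrightarrow>
    ((\<lambda>y. (f y - f x) /\<^sub>R (y - x)) \<longlongrightarrow> D) (at x within S)"
proof -
  have "norm ((f y - f x) - (y - x) *\<^sub>R D) / norm (y - x) = norm ((f y - f x) /\<^sub>R (y - x) - D)"
    if "y \<noteq> x" for y
  proof -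
    have "(f y - f x) /\<^sub>R (y - x) - D = ((f y - f x) - (y - x) *\<^sub>R D) /\<^sub>R (y - x)"
      using that by (simp add: scaleR_diff_right)
    then show ?thesis
      by (simp add: divide_inverse mult.commute)
  qed
  then have "eventually (\<lambda>y. norm ((f y - f x) - (y - x) *\<^sub>R D) / norm (y - x)
      = norm ((f y - f x) /\<^sub>R (y - x) - D)) (at x within S)"
    by (auto simp: eventually_at_filter)
  then have "(f has_vector_derivative D) (at x within S) \<longleftrightarrow>
      ((\<lambda>y. norm ((f y - f x) /\<^sub>R (y - x) - D)) \<longlongrightarrow> 0) (at x within S)"
    unfolding has_vector_derivative_def has_derivative_iff_norm
    by (simp add: bounded_linear_scaleR_left tendsto_cong)
  then show ?thesis
    by (simp add: tendsto_norm_zero_iff LIM_zero_iff)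
qed

lemma filterlim_add_at_right:
  fixes t b :: real
  assumes "t < b"
  shows "filterlim (\<lambda>h. t + h) (at t within {t..b}) (at_right 0)"
proof -
  have "eventually (\<lambda>h::real. 0 < h \<and> h < b - t) (at_right 0)"
    using assms eventually_at_right[of 0 "b - t"] by (auto intro!: exI[of _ "b - t"])
  then have "eventually (\<lambda>h. t + h \<in> {t..b} \<and> t + h \<noteq> t) (at_right 0)"
    by eventually_elim auto
  moreover have "((\<lambda>h. t + h) \<longlongrightarrow> t) (at_right 0)"
    by (auto intro!: tendsto_eq_intros)
  ultimately show ?thesis
    unfolding filterlim_at by (auto elim: eventually_mono)
qed

lemma has_vector_derivative_imp_right_quotient:
  fixes f :: "real \<Rightarrow> 'a::real_normed_vector"
  assumes "(f has_vector_derivative D) (at t within {t..b})" "t < b"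
  shows "((\<lambda>h. (f (t + h) - f t) /\<^sub>R h) \<longlongrightarrow> D) (at_right 0)"
  using filterlim_compose[OF assms(1)[unfolded has_vector_derivative_iff_quotient]
      filterlim_add_at_right[OF assms(2)]] by simp

lemma filterlim_inverse_Suc_at_right:
  "filterlim (\<lambda>n. inverse (real (Suc n))) (at_right 0) sequentially"
  using LIMSEQ_inverse_real_of_nat
  by (auto simp: filterlim_at intro!: always_eventually)

context
  fixes S :: "real \<Rightarrow> 'a::chilbert_space \<Rightarrow>\<^sub>L 'a"
  assumes S: "c0_semigroup S"
begin

lemma semigroup_zero: "S 0 = id_blinfun"
  using S by (simp add: c0_semigroup_def)

lemma semigroup_add:
  "0 \<le> s \<Longrightarrow> 0 \<le> t \<Longrightarrow> blinfun_apply (S (s + t)) x = blinfun_apply (S s) (blinfun_apply (S t) x)"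
  using S by (simp add: c0_semigroup_def)

lemma semigroup_scaleC: "0 \<le> t \<Longrightarrow> blinfun_apply (S t) (c *\<^sub>C x) = c *\<^sub>C blinfun_apply (S t) x"
  using S by (simp add: c0_semigroup_def)

lemma semigroup_at_right: "((\<lambda>t. blinfun_apply (S t) x) \<longlongrightarrow> x) (at_right 0)"
  using S by (simp add: c0_semigroup_def)

lemma semigroup_commute:
  "0 \<le> s \<Longrightarrow> 0 \<le> t \<Longrightarrow>
    blinfun_apply (S s) (blinfun_apply (S t) x) = blinfun_apply (S t) (blinfun_apply (S s) x)"
  by (metis add.commute semigroup_add)

lemma semigroup_bounded_near_zero:
  obtains d M where "d > 0" "\<And>t. t \<in> {0..d} \<Longrightarrow> norm (S t) \<le> M"
proof (rule ccontr)
  assume "\<not> thesis"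
  then have "\<exists>t\<in>{0..inverse (real (Suc n))}. \<not> norm (S t) \<le> real (Suc n)" for n
    using that[of "inverse (real (Suc n))" "real (Suc n)"]
    by (metis inverse_positive_iff_positive of_nat_0_less_iff zero_less_Suc)
  then obtain t where t: "\<And>n. t n \<in> {0..inverse (real (Suc n))}" "\<And>n. norm (S (t n)) > real (Suc n)"
    by (metis not_le)
  have "t n > 0 \<and> t n \<noteq> 0" for n
  proof -
    have "norm (id_blinfun :: 'a \<Rightarrow>\<^sub>L 'a) \<le> 1"
      by (rule norm_blinfun_bound) auto
    then have "t n \<noteq> 0"
      using t(2)[of n] by (auto simp: semigroup_zero)
    then show ?thesis
      using t(1)[of n] by auto
  qed
  moreover have "t \<longlonglongrightarrow> 0"
    by (rule real_tendsto_sandwich[OF _ _ tendsto_const LIMSEQ_inverse_real_of_nat])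
      (use t(1) in \<open>auto intro!: always_eventually\<close>)
  ultimately have "filterlim t (at_right 0) sequentially"
    by (auto simp: filterlim_at intro!: always_eventually)
  then have "(\<lambda>n. blinfun_apply (S (t n)) x) \<longlonglongrightarrow> x" for x
    by (rule filterlim_compose[OF semigroup_at_right])
  then have "bounded (range (\<lambda>n. blinfun_apply (S (t n)) x))" for x
    using convergent_imp_bounded by blast
  then obtain K where K: "\<And>n. norm (S (t n)) \<le> K"
    using pointwise_bounded_blinfuns[of "\<lambda>n. S (t n)"] by blast
  obtain n where "K \<le> real n"
    using real_arch_simple by blast
  then show False
    using K[of n] t(2)[of n] by simp
qed

lemma semigroup_bounded:
  obtains M where "M \<ge> 1" "\<And>t. t \<in> {0..T} \<Longrightarrow> norm (S t) \<le> M"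
proof -
  obtain d M0 where d: "d > 0" "\<And>t. t \<in> {0..d} \<Longrightarrow> norm (S t) \<le> M0"
    using semigroup_bounded_near_zero by blast
  define M1 where "M1 = max M0 1"
  have M1: "M1 \<ge> 1" "\<And>t. t \<in> {0..d} \<Longrightarrow> norm (S t) \<le> M1"
    using d(2) unfolding M1_def by (auto simp: le_max_iff_disj)
  have bd: "norm (S t) \<le> M1 ^ Suc n" if "t \<in> {0..real n * d}" for n t
    using that
  proof (induction n arbitrary: t)
    case 0
    then show ?case
      using M1(2)[of t] d(1) by simp
  next
    case (Suc n)
    show ?case
    proof (cases "t \<le> d")
      case True
      then have "norm (S t) \<le> M1"
        using Suc.prems by (intro M1(2)) auto
      also have "M1 \<le> M1 ^ Suc (Suc n)"
        using M1(1) by (rule self_le_power) simp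
      finally show ?thesis .
    next
      case False
      then have "S t = S d o\<^sub>L S (t - d)"
        using semigroup_add[of d "t - d"] d(1) by (intro blinfun_eqI) simp
      then have "norm (S t) \<le> norm (S d) * norm (S (t - d))"
        by (simp add: norm_blinfun_compose)
      also have "\<dots> \<le> M1 * M1 ^ Suc n"
      proof (rule mult_mono)
        show "norm (S (t - d)) \<le> M1 ^ Suc n"
          using Suc.prems False by (intro Suc.IH) (auto simp: algebra_simps)
      qed (use M1 d(1) in auto)
      finally show ?thesis
        by simp
    qed
  qed
  obtain n where n: "T \<le> real n * d"
    using reals_Archimedean3[OF d(1)] less_imp_le by (metis mult.commute)
  show ?thesis
  proof (rule that)
    show "M1 ^ Suc n \<ge> 1"
      using M1(1) by (rule one_le_power)
    show "norm (S t) \<le> M1 ^ Suc n" if "t \<in> {0..T}" for t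
      using that n by (intro bd) auto
  qed
qed

lemma semigroup_continuous_on: "continuous_on {0..} (\<lambda>t. blinfun_apply (S t) x)"
  unfolding continuous_on_iff
proof (intro ballI allI impI)
  fix t0 e :: real assume t0: "t0 \<in> {0..}" and e: "e > 0"
  obtain M where M: "M \<ge> 1" "\<And>t. t \<in> {0..t0 + 1} \<Longrightarrow> norm (S t) \<le> M"
    using semigroup_bounded[of "t0 + 1"] by blast
  have "e / M > 0"
    using e M by simp
  then have "eventually (\<lambda>t. dist (blinfun_apply (S t) x) x < e / M) (at_right 0)"
    using semigroup_at_right tendstoD by blast
  then obtain b where b: "b > 0" "\<And>t. 0 < t \<Longrightarrow> t < b \<Longrightarrow> dist (blinfun_apply (S t) x) x < e / M"
    unfolding eventually_at_right_field by blast
  have small: "norm (blinfun_apply (S t) x - x) < e / M" if "0 \<le> t" "t < b" for t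
    using that b \<open>e / M > 0\<close> by (cases "t = 0") (auto simp: semigroup_zero dist_norm)
  have est: "norm (blinfun_apply (S (r + h)) x - blinfun_apply (S r) x) < e"
    if "r \<in> {0..t0 + 1}" "0 \<le> h" "h < b" for r h
  proof -
    have "blinfun_apply (S (r + h)) x - blinfun_apply (S r) x
        = blinfun_apply (S r) (blinfun_apply (S h) x - x)"
      using that by (simp add: semigroup_add blinfun.diff_right)
    then have "norm (blinfun_apply (S (r + h)) x - blinfun_apply (S r) x)
        \<le> norm (S r) * norm (blinfun_apply (S h) x - x)"
      by (simp add: norm_blinfun)
    also have "\<dots> \<le> M * norm (blinfun_apply (S h) x - x)"
      using M that by (intro mult_right_mono) auto
    also have "\<dots> < M * (e / M)"
      using small[OF that(2,3)] M(1) by (intro mult_strict_left_mono) auto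
    finally show ?thesis
      using M(1) by simp
  qed
  show "\<exists>d>0. \<forall>t\<in>{0..}. dist t t0 < d \<longrightarrow> dist (blinfun_apply (S t) x) (blinfun_apply (S t0) x) < e"
  proof (intro exI[of _ "min b 1"] conjI ballI impI)
    fix t :: real assume t: "t \<in> {0..}" "dist t t0 < min b 1"
    show "dist (blinfun_apply (S t) x) (blinfun_apply (S t0) x) < e"
    proof (cases "t0 \<le> t")
      case True
      then show ?thesis
        using est[of t0 "t - t0"] t t0 by (auto simp: dist_norm)
    next
      case False
      then show ?thesis
        using est[of t "t0 - t"] t t0 by (auto simp: dist_norm norm_minus_commute)
    qed
  qed (use b in auto)
qed

lemma semigroup_tendsto:
  assumes f: "(f \<longlongrightarrow> t0) F" and v: "(v \<longlongrightarrow> v0) F" and pos: "eventually (\<lambda>r. f r \<ge> 0) F" and t0: "t0 \<ge> 0"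
  shows "((\<lambda>r. blinfun_apply (S (f r)) (v r)) \<longlongrightarrow> blinfun_apply (S t0) v0) F"
proof -
  obtain M where M: "M \<ge> 1" "\<And>t. t \<in> {0..t0 + 1} \<Longrightarrow> norm (S t) \<le> M"
    using semigroup_bounded[of "t0 + 1"] by blast
  have "((\<lambda>r. blinfun_apply (S (f r)) v0) \<longlongrightarrow> blinfun_apply (S t0) v0) F"
    using continuous_on_tendsto_compose[OF semigroup_continuous_on f] t0 pos by simp
  moreover have "((\<lambda>r. blinfun_apply (S (f r)) (v r - v0)) \<longlongrightarrow> 0) F"
  proof (rule Lim_null_comparison)
    have "eventually (\<lambda>r. f r < t0 + 1) F"
      using f by (rule order_tendstoD) simp
    with pos show "eventually (\<lambda>r. norm (blinfun_apply (S (f r)) (v r - v0)) \<le> M * norm (v r - v0)) F"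
    proof eventually_elim
      case (elim r)
      have "norm (blinfun_apply (S (f r)) (v r - v0)) \<le> norm (S (f r)) * norm (v r - v0)"
        by (rule norm_blinfun)
      also have "\<dots> \<le> M * norm (v r - v0)"
        using elim M(2)[of "f r"] by (intro mult_right_mono) auto
      finally show ?case .
    qed
    show "((\<lambda>r. M * norm (v r - v0)) \<longlongrightarrow> 0) F"
      using v by (auto intro!: tendsto_eq_intros)
  qed
  ultimately show ?thesis
    using tendsto_add by (fastforce simp: blinfun.diff_right)
qed

lemma semigroup_continuous_on_compose:
  assumes "continuous_on I f" "continuous_on I v" "\<And>r. r \<in> I \<Longrightarrow> f r \<ge> 0"
  shows "continuous_on I (\<lambda>r. blinfun_apply (S (f r)) (v r))"
  unfolding continuous_on_def
proof (intro ballI semigroup_tendsto)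
  fix r assume "r \<in> I"
  then show "(f \<longlongrightarrow> f r) (at r within I)" "(v \<longlongrightarrow> v r) (at r within I)" "f r \<ge> 0"
    using assms by (auto simp: continuous_on_def)
  show "eventually (\<lambda>r. f r \<ge> 0) (at r within I)"
    using assms(3) by (auto simp: eventually_at_filter)
qed

lemma semigroup_orbit_continuous: "0 \<le> a \<Longrightarrow> continuous_on {a..b} (\<lambda>t. blinfun_apply (S t) x)"
  by (rule continuous_on_subset[OF semigroup_continuous_on]) auto

lemma semigroup_orbit_integrable: "0 \<le> a \<Longrightarrow> (\<lambda>t. blinfun_apply (S t) x) integrable_on {a..b}"
  by (intro integrable_continuous_real semigroup_orbit_continuous)

lemma semigroup_integral_deriv:
  assumes "t \<in> {0..T}"
  shows "((\<lambda>t. integral {0..t} (\<lambda>s. blinfun_apply (S s) x)) has_vector_derivative blinfun_apply (S t) x)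
    (at t within {0..T})"
  using assms by (intro integral_has_vector_derivative semigroup_orbit_continuous) auto

lemma semigroup_integral_right_quotient:
  assumes "t \<ge> 0"
  shows "((\<lambda>h. (integral {0..t + h} (\<lambda>s. blinfun_apply (S s) x)
      - integral {0..t} (\<lambda>s. blinfun_apply (S s) x)) /\<^sub>R h) \<longlongrightarrow> blinfun_apply (S t) x) (at_right 0)"
proof (rule has_vector_derivative_imp_right_quotient)
  show "((\<lambda>t. integral {0..t} (\<lambda>s. blinfun_apply (S s) x)) has_vector_derivative blinfun_apply (S t) x)
    (at t within {t..t + 1})"
    by (rule has_vector_derivative_within_subset[OF semigroup_integral_deriv[of t "t + 1"]])
      (use assms in auto)
qed simp

lemma semigroup_average_tendsto:
  "((\<lambda>h. integral {0..h} (\<lambda>s. blinfun_apply (S s) x) /\<^sub>R h) \<longlongrightarrow> x) (at_right 0)"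
  using semigroup_integral_right_quotient[of 0 x] by (simp add: semigroup_zero)

lemma bounded_linear_semigroup_weighted_integral:
  assumes \<phi>: "continuous_on {0..t} \<phi>"
  shows "bounded_linear (\<lambda>x. integral {0..t} (\<lambda>s. \<phi> s *\<^sub>R blinfun_apply (S s) x))"
proof -
  obtain M where M: "M \<ge> 1" "\<And>s. s \<in> {0..t} \<Longrightarrow> norm (S s) \<le> M"
    using semigroup_bounded[of t] by blast
  obtain N where N: "N > 0" "\<And>s. s \<in> {0..t} \<Longrightarrow> \<bar>\<phi> s\<bar> \<le> N"
    using compact_imp_bounded[OF compact_continuous_image[OF \<phi> compact_Icc]]
    unfolding bounded_pos by auto
  have cont: "continuous_on {0..t} (\<lambda>s. \<phi> s *\<^sub>R blinfun_apply (S s) x)" for x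
    by (intro continuous_on_scaleR \<phi> semigroup_orbit_continuous) simp
  note int = integrable_continuous_real[OF cont]
  show ?thesis
  proof (rule bounded_linear_intro[of _ "N * M * \<bar>t\<bar>"])
    fix x :: 'a
    show "norm (integral {0..t} (\<lambda>s. \<phi> s *\<^sub>R blinfun_apply (S s) x)) \<le> norm x * (N * M * \<bar>t\<bar>)"
    proof (cases "t \<ge> 0")
      case True
      have "norm (integral {0..t} (\<lambda>s. \<phi> s *\<^sub>R blinfun_apply (S s) x)) \<le> (N * (M * norm x)) * (t - 0)"
      proof (rule integral_bound[OF True cont])
        fix s assume s: "s \<in> {0..t}"
        have "norm (blinfun_apply (S s) x) \<le> M * norm x"
          using norm_blinfun[of "S s" x] M(2)[OF s] by (meson mult_right_mono norm_ge_zero order_trans)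
        then show "norm (\<phi> s *\<^sub>R blinfun_apply (S s) x) \<le> N * (M * norm x)"
          using N(2)[OF s] N(1) by (simp add: mult_mono)
      qed
      then show ?thesis
        using True by (simp add: mult_ac)
    next
      case False
      moreover have "0 \<le> norm x * (N * M * \<bar>t\<bar>)"
        using M(1) N(1) by (intro mult_nonneg_nonneg) auto
      ultimately show ?thesis
        by simp
    qed
  next
    show "integral {0..t} (\<lambda>s. \<phi> s *\<^sub>R blinfun_apply (S s) (x + y)) =
        integral {0..t} (\<lambda>s. \<phi> s *\<^sub>R blinfun_apply (S s) x) + integral {0..t} (\<lambda>s. \<phi> s *\<^sub>R blinfun_apply (S s) y)" for x y
      using int by (simp add: blinfun.add_right scaleR_add_right integral_add)
    show "integral {0..t} (\<lambda>s. \<phi> s *\<^sub>R blinfun_apply (S s) (r *\<^sub>R x)) =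
        r *\<^sub>R integral {0..t} (\<lambda>s. \<phi> s *\<^sub>R blinfun_apply (S s) x)" for r x
      by (simp only: integral_cmul[symmetric]) (simp add: blinfun.scaleR_right mult.commute)
  qed
qed

lemma bounded_linear_semigroup_integral:
  "bounded_linear (\<lambda>x. integral {0..t} (\<lambda>s. blinfun_apply (S s) x))"
  using bounded_linear_semigroup_weighted_integral[of t "\<lambda>_. 1"] by simp

lemma semigroup_apply_integral:
  "blinfun_apply F (integral {0..t} (\<lambda>s. blinfun_apply (S s) x)) =
    integral {0..t} (\<lambda>s. blinfun_apply F (blinfun_apply (S s) x))"
  using integral_linear[OF semigroup_orbit_integrable[of 0 x t] blinfun.bounded_linear_right[of F]]
  by (simp add: o_def)

lemma generator_integral:
  assumes "t \<ge> 0"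
  shows "(integral {0..t} (\<lambda>s. blinfun_apply (S s) x), blinfun_apply (S t) x - x) \<in> generator S"
proof -
  let ?I = "\<lambda>t. integral {0..t} (\<lambda>s. blinfun_apply (S s) x)"
  have eq: "blinfun_apply (S h) (?I t) - ?I t = (?I (t + h) - ?I t) - ?I h" if "h > 0" for h
  proof -
    have "blinfun_apply (S h) (?I t) = integral {0..t} ((\<lambda>s. blinfun_apply (S s) x) \<circ> ((+) h))"
      unfolding semigroup_apply_integral using that
      by (intro integral_cong) (simp add: semigroup_add)
    also have "\<dots> = integral {h..t + h} (\<lambda>s. blinfun_apply (S s) x)"
      by (simp add: integral_shift_Icc_real)
    also have "\<dots> = ?I (t + h) - ?I h"
      using Henstock_Kurzweil_Integration.integral_combine[of 0 h "t + h" "\<lambda>s. blinfun_apply (S s) x"] that assms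
      by (simp add: semigroup_orbit_integrable algebra_simps)
    finally show ?thesis
      by simp
  qed
  have "((\<lambda>h. (?I (t + h) - ?I t) /\<^sub>R h - ?I h /\<^sub>R h) \<longlongrightarrow> blinfun_apply (S t) x - x) (at_right 0)"
    by (intro tendsto_diff semigroup_integral_right_quotient semigroup_average_tendsto assms)
  moreover have "eventually (\<lambda>h. (?I (t + h) - ?I t) /\<^sub>R h - ?I h /\<^sub>R h
      = (blinfun_apply (S h) (?I t) - ?I t) /\<^sub>R h) (at_right 0)"
    using eq by (auto simp: eventually_at_filter scaleR_diff_right)
  ultimately show ?thesis
    unfolding generator_def by (simp add: tendsto_cong)
qed

lemma generator_single_valued: "(x, y) \<in> generator S \<Longrightarrow> (x, y') \<in> generator S \<Longrightarrow> y = y'"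
  by (auto simp: generator_def intro: tendsto_unique[OF trivial_limit_at_right_real])

text \<open>The integrated form of membership in the generator; linearity and closedness of the
  generator are immediate from it.\<close>

lemma generator_iff:
  "(x, y) \<in> generator S \<longleftrightarrow>
    (\<forall>t\<ge>0. blinfun_apply (S t) x - x = integral {0..t} (\<lambda>s. blinfun_apply (S s) y))"
proof
  assume xy: "(x, y) \<in> generator S"
  show "\<forall>t\<ge>0. blinfun_apply (S t) x - x = integral {0..t} (\<lambda>s. blinfun_apply (S s) y)"
  proof (intro allI impI)
    fix t :: real assume t: "t \<ge> 0"
    let ?I = "\<lambda>x. integral {0..t} (\<lambda>s. blinfun_apply (S s) x)"
    note lin = bounded_linear.linear[OF bounded_linear_semigroup_integral, of t]
    have "((\<lambda>h. ?I ((blinfun_apply (S h) x - x) /\<^sub>R h)) \<longlongrightarrow> ?I y) (at_right 0)"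
      using xy bounded_linear.tendsto[OF bounded_linear_semigroup_integral] unfolding generator_def by blast
    moreover have "eventually (\<lambda>h. ?I ((blinfun_apply (S h) x - x) /\<^sub>R h)
        = (blinfun_apply (S h) (?I x) - ?I x) /\<^sub>R h) (at_right 0)"
    proof -
      have "?I ((blinfun_apply (S h) x - x) /\<^sub>R h) = (blinfun_apply (S h) (?I x) - ?I x) /\<^sub>R h"
        if "h > 0" for h
      proof -
        have "?I (blinfun_apply (S h) x) = blinfun_apply (S h) (?I x)"
          unfolding semigroup_apply_integral using that
          by (intro integral_cong) (simp add: semigroup_commute)
        then show ?thesis
          using linear_cmul[OF lin, of "inverse h" "blinfun_apply (S h) x - x"]
            linear_diff[OF lin, of "blinfun_apply (S h) x" x] by simp
      qed
      then show ?thesis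
        by (auto simp: eventually_at_filter)
    qed
    ultimately have "(?I x, ?I y) \<in> generator S"
      unfolding generator_def by (simp add: tendsto_cong)
    then show "blinfun_apply (S t) x - x = ?I y"
      using generator_integral[OF t] generator_single_valued by blast
  qed
next
  assume "\<forall>t\<ge>0. blinfun_apply (S t) x - x = integral {0..t} (\<lambda>s. blinfun_apply (S s) y)"
  then have "eventually (\<lambda>t. integral {0..t} (\<lambda>s. blinfun_apply (S s) y) /\<^sub>R t
      = (blinfun_apply (S t) x - x) /\<^sub>R t) (at_right 0)"
    by (auto simp: eventually_at_filter)
  then show "(x, y) \<in> generator S"
    using Lim_transform_eventually[OF semigroup_average_tendsto[of y]] by (simp add: generator_def)
qed

lemma closed_generator: "closed (generator S)"
proof -
  have eq: "generator S = (\<Inter>t\<in>{0..}. {p. blinfun_apply (S t) (fst p) - fst p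
      = integral {0..t} (\<lambda>s. blinfun_apply (S s) (snd p))})"
    by (auto simp: generator_iff)
  have "continuous_on UNIV (\<lambda>p::'a \<times> 'a. integral {0..t} (\<lambda>s. blinfun_apply (S s) (snd p)))" for t
    by (intro bounded_linear.continuous_on[OF bounded_linear_semigroup_integral] continuous_intros)
  then show ?thesis
    unfolding eq by (intro closed_INT ballI closed_Collect_eq) (auto intro!: continuous_intros)
qed

lemma subspace_generator: "subspace (generator S)"
  unfolding subspace_def
proof (intro conjI ballI allI)
  note lin = bounded_linear.linear[OF bounded_linear_semigroup_integral]
  show "0 \<in> generator S"
    by (simp add: zero_prod_def generator_iff blinfun.bilinear_simps)
  show "p + q \<in> generator S" if "p \<in> generator S" "q \<in> generator S" for p q
    using that by (cases p; cases q) (simp add: generator_iff blinfun.bilinear_simps algebra_simps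
        integral_add semigroup_orbit_integrable)
  show "c *\<^sub>R p \<in> generator S" if "p \<in> generator S" for c p
    using that by (cases p) (simp add: generator_iff linear_cmul[OF lin] blinfun.bilinear_simps flip: scaleR_diff_right)
qed

lemma generator_scaleC:
  assumes "(x, y) \<in> generator S"
  shows "(c *\<^sub>C x, c *\<^sub>C y) \<in> generator S"
proof -
  have "((\<lambda>t. c *\<^sub>C ((blinfun_apply (S t) x - x) /\<^sub>R t)) \<longlongrightarrow> c *\<^sub>C y) (at_right 0)"
    using assms bounded_linear.tendsto[OF bounded_linear_scaleC] unfolding generator_def by blast
  moreover have "eventually (\<lambda>t. c *\<^sub>C ((blinfun_apply (S t) x - x) /\<^sub>R t) =
      (blinfun_apply (S t) (c *\<^sub>C x) - c *\<^sub>C x) /\<^sub>R t) (at_right 0)"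
    by (auto simp: eventually_at_filter semigroup_scaleC scaleC_scaleR scaleC_diff_right)
  ultimately show ?thesis
    unfolding generator_def by (simp add: tendsto_cong)
qed

lemma generator_invariant:
  assumes "(x, y) \<in> generator S" "t \<ge> 0"
  shows "(blinfun_apply (S t) x, blinfun_apply (S t) y) \<in> generator S"
proof -
  have "((\<lambda>h. blinfun_apply (S t) ((blinfun_apply (S h) x - x) /\<^sub>R h)) \<longlongrightarrow> blinfun_apply (S t) y) (at_right 0)"
    using assms(1) unfolding generator_def by (auto intro: blinfun.tendsto)
  moreover have "eventually (\<lambda>h. blinfun_apply (S t) ((blinfun_apply (S h) x - x) /\<^sub>R h) =
      (blinfun_apply (S h) (blinfun_apply (S t) x) - blinfun_apply (S t) x) /\<^sub>R h) (at_right 0)"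
    using assms(2) by (auto simp: eventually_at_filter blinfun.bilinear_simps semigroup_commute)
  ultimately show ?thesis
    unfolding generator_def by (simp add: tendsto_cong)
qed

lemma generator_deriv:
  assumes "(x, y) \<in> generator S" "t \<in> {0..T}"
  shows "((\<lambda>t. blinfun_apply (S t) x) has_vector_derivative blinfun_apply (S t) y) (at t within {0..T})"
proof -
  have "((\<lambda>t. x + integral {0..t} (\<lambda>s. blinfun_apply (S s) y)) has_vector_derivative
      0 + blinfun_apply (S t) y) (at t within {0..T})"
    by (intro has_vector_derivative_add has_vector_derivative_const semigroup_integral_deriv assms)
  moreover have "x + integral {0..t} (\<lambda>s. blinfun_apply (S s) y) = blinfun_apply (S t) x"
    if "t \<in> {0..T}" for t
    using assms(1) that unfolding generator_iff
    by (metis add_diff_cancel_left' atLeastAtMost_iff diff_add_cancel add.commute)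
  ultimately show ?thesis
    using has_vector_derivative_transform[OF assms(2)] by (metis (no_types, lifting) add_0)
qed

lemma generator_dense: "closure (Domain (generator S)) = UNIV"
proof -
  have "x \<in> closure (Domain (generator S))" for x
  proof (rule in_closureI)
    let ?h = "\<lambda>n. inverse (real (Suc n))"
    show "integral {0..?h n} (\<lambda>s. blinfun_apply (S s) x) /\<^sub>R ?h n \<in> Domain (generator S)" for n
      using subspace_scale[OF subspace_generator generator_integral[of "?h n" x], of "inverse (?h n)"]
      by (auto intro!: Domain.intros)
    show "(\<lambda>n. integral {0..?h n} (\<lambda>s. blinfun_apply (S s) x) /\<^sub>R ?h n) \<longlonglongrightarrow> x"
      by (rule filterlim_compose[OF semigroup_average_tendsto filterlim_inverse_Suc_at_right])
  qed
  then show ?thesis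
    by blast
qed

lemma generator_integral_by_parts:
  assumes "(x, y) \<in> generator S"
  shows "integral {0..1} (\<lambda>s. (a - b * s) *\<^sub>R blinfun_apply (S s) y) =
    (a - b) *\<^sub>R blinfun_apply (S 1) x - a *\<^sub>R x + b *\<^sub>R integral {0..1} (\<lambda>s. blinfun_apply (S s) x)"
proof -
  let ?f = "\<lambda>s. (a - b * s) *\<^sub>R blinfun_apply (S s) x"
  have "((\<lambda>s. (a - b * s) *\<^sub>R blinfun_apply (S s) y + (- b) *\<^sub>R blinfun_apply (S s) x) has_integral ?f 1 - ?f 0) {0..1}"
  proof (rule fundamental_theorem_of_calculus)
    fix s :: real assume s: "s \<in> {0..1}"
    show "(?f has_vector_derivative (a - b * s) *\<^sub>R blinfun_apply (S s) y + (- b) *\<^sub>R blinfun_apply (S s) x)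
        (at s within {0..1})"
      by (intro has_vector_derivative_scaleR generator_deriv[OF assms s]) (auto intro!: derivative_eq_intros)
  qed simp
  moreover have "((\<lambda>s. (- b) *\<^sub>R blinfun_apply (S s) x) has_integral
      (- b) *\<^sub>R integral {0..1} (\<lambda>s. blinfun_apply (S s) x)) {0..1}"
    by (intro has_integral_cmul integrable_integral semigroup_orbit_integrable) simp
  ultimately have "((\<lambda>s. ((a - b * s) *\<^sub>R blinfun_apply (S s) y + (- b) *\<^sub>R blinfun_apply (S s) x)
      - (- b) *\<^sub>R blinfun_apply (S s) x) has_integral
      ?f 1 - ?f 0 - (- b) *\<^sub>R integral {0..1} (\<lambda>s. blinfun_apply (S s) x)) {0..1}"
    by (rule has_integral_diff)
  then have "((\<lambda>s. (a - b * s) *\<^sub>R blinfun_apply (S s) y) has_integral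
      ?f 1 - ?f 0 - (- b) *\<^sub>R integral {0..1} (\<lambda>s. blinfun_apply (S s) x)) {0..1}"
    by (simp only: add_diff_cancel_right')
  from integral_unique[OF this] show ?thesis
    by (simp add: semigroup_zero)
qed

lemma generator_deriv_reversed:
  assumes "(x, y) \<in> generator S" "s \<in> {0..T}"
  shows "((\<lambda>r. blinfun_apply (S (T - r)) x) has_vector_derivative - blinfun_apply (S (T - s)) y)
    (at s within {0..T})"
proof -
  have "filterlim (\<lambda>r. T - r) (at (T - s) within {0..T}) (at s within {0..T})"
    unfolding filterlim_at by (auto simp: eventually_at_filter intro!: tendsto_intros)
  moreover have "T - s \<in> {0..T}"
    using assms(2) by auto
  ultimately have "((\<lambda>r. (blinfun_apply (S (T - r)) x - blinfun_apply (S (T - s)) x)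
      /\<^sub>R ((T - r) - (T - s))) \<longlongrightarrow> blinfun_apply (S (T - s)) y) (at s within {0..T})"
    using generator_deriv[OF assms(1), unfolded has_vector_derivative_iff_quotient] filterlim_compose
    by blast
  then have "((\<lambda>r. - ((blinfun_apply (S (T - r)) x - blinfun_apply (S (T - s)) x)
      /\<^sub>R ((T - r) - (T - s)))) \<longlongrightarrow> - blinfun_apply (S (T - s)) y) (at s within {0..T})"
    by (rule tendsto_minus)
  moreover have "- inverse ((T - r) - (T - s)) = inverse (r - s)" for r
    using inverse_minus_eq[of "r - s"] by simp
  ultimately show ?thesis
    unfolding has_vector_derivative_iff_quotient by (simp flip: scaleR_minus_left)
qed

text \<open>A dense subspace of the domain that is invariant under the semigroup is a core. The reason
  is that \<open>\<integral>\<^sub>0\<^sup>t S(s) x ds\<close>, for \<open>x\<close> in such a subspace, is a limit of Riemann sums in the graph norm.\<close>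

lemma closure_core_eq_generator:
  assumes R: "R \<subseteq> generator S" "subspace R"
    and inv: "\<And>x y t. (x, y) \<in> R \<Longrightarrow> t \<ge> 0 \<Longrightarrow> (blinfun_apply (S t) x, blinfun_apply (S t) y) \<in> R"
    and dense: "closure (Domain R) = UNIV"
  shows "closure R = generator S"
proof
  show "closure R \<subseteq> generator S"
    using R closed_generator by (simp add: closure_minimal)
next
  let ?I = "\<lambda>t x. integral {0..t} (\<lambda>s. blinfun_apply (S s) x)"
  have R_int: "(?I t x, ?I t y) \<in> closure R" if "(x, y) \<in> R" for t x y
  proof -
    let ?f = "\<lambda>s. (blinfun_apply (S s) x, blinfun_apply (S s) y)"
    have cont: "continuous_on {0..t} ?f"
      by (intro continuous_on_Pair semigroup_orbit_continuous) auto
    have "integral {0..t} ?f \<in> closure R"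
      using R(2) inv[OF that] closure_subset[of R] cont
      by (intro integral_in_closed_subspace subspace_closure) auto
    moreover have "integral {0..t} ?f = (?I t x, ?I t y)"
      using integral_linear[OF integrable_continuous_real[OF cont] bounded_linear_fst]
        integral_linear[OF integrable_continuous_real[OF cont] bounded_linear_snd]
      by (simp add: o_def prod_eq_iff)
    ultimately show ?thesis
      by simp
  qed
  have all: "(?I t x, blinfun_apply (S t) x - x) \<in> closure R" if t: "t \<ge> 0" for t x
  proof -
    have "closed ((\<lambda>x. (?I t x, blinfun_apply (S t) x - x)) -` closure R)"
      by (intro closed_vimage continuous_intros
          bounded_linear.continuous_on[OF bounded_linear_semigroup_integral]) auto
    moreover have "Domain R \<subseteq> (\<lambda>x. (?I t x, blinfun_apply (S t) x - x)) -` closure R"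
    proof
      fix x assume "x \<in> Domain R"
      then obtain y where y: "(x, y) \<in> R"
        by blast
      then have "blinfun_apply (S t) x - x = ?I t y"
        using R(1) t generator_iff by blast
      then show "x \<in> (\<lambda>x. (?I t x, blinfun_apply (S t) x - x)) -` closure R"
        using R_int[OF y, of t] by simp
    qed
    ultimately have "closure (Domain R) \<subseteq> (\<lambda>x. (?I t x, blinfun_apply (S t) x - x)) -` closure R"
      by (simp add: closure_minimal)
    then show ?thesis
      using dense by blast
  qed
  show "generator S \<subseteq> closure R"
  proof clarify
    fix x y assume xy: "(x, y) \<in> generator S"
    let ?h = "\<lambda>n. inverse (real (Suc n))"
    have "(?I (?h n) x /\<^sub>R ?h n, (blinfun_apply (S (?h n)) x - x) /\<^sub>R ?h n) \<in> closure R" for n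
      using subspace_scale[OF subspace_closure[OF R(2)] all[of "?h n" x], of "inverse (?h n)"] by simp
    moreover have "(\<lambda>n. (?I (?h n) x /\<^sub>R ?h n, (blinfun_apply (S (?h n)) x - x) /\<^sub>R ?h n)) \<longlonglongrightarrow> (x, y)"
      using xy unfolding generator_def
      by (intro tendsto_Pair filterlim_compose[OF _ filterlim_inverse_Suc_at_right])
        (use semigroup_average_tendsto in auto)
    ultimately have "(x, y) \<in> closure (closure R)"
      by (rule in_closureI)
    then show "(x, y) \<in> closure R"
      by simp
  qed
qed

end

text \<open>Two semigroups with the same generator agree, because \<open>s \<mapsto> S(t - s) S'(s) x\<close> is constant
  for \<open>x\<close> in the domain of the generator.\<close>

lemma generator_determines_semigroup:
  assumes S: "c0_semigroup S" and S': "c0_semigroup S'" and eq: "generator S = generator S'"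
    and t: "t \<ge> 0"
  shows "S t = S' t"
proof -
  have "blinfun_apply (S t) x = blinfun_apply (S' t) x" if "(x, y) \<in> generator S'" for x y
  proof -
    let ?\<phi> = "\<lambda>s. blinfun_apply (S (t - s)) (blinfun_apply (S' s) x)"
    have "(?\<phi> has_vector_derivative 0) (at s within {0..t})" if s: "s \<in> {0..t}" for s
      unfolding has_vector_derivative_iff_quotient
    proof -
      let ?F = "at s within {0..t}"
      let ?w = "blinfun_apply (S' s) x" and ?w' = "blinfun_apply (S' s) y"
      have w: "(?w, ?w') \<in> generator S"
        unfolding eq using S' \<open>(x, y) \<in> generator S'\<close> s by (simp add: generator_invariant)
      have "((\<lambda>r. blinfun_apply (S (t - r)) ((blinfun_apply (S' r) x - ?w) /\<^sub>R (r - s)))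
          \<longlongrightarrow> blinfun_apply (S (t - s)) ?w') ?F"
      proof (rule semigroup_tendsto[OF S])
        show "((\<lambda>r. t - r) \<longlongrightarrow> t - s) ?F"
          by (intro tendsto_intros)
        show "((\<lambda>r. (blinfun_apply (S' r) x - ?w) /\<^sub>R (r - s)) \<longlongrightarrow> ?w') ?F"
          using generator_deriv[OF S' \<open>(x, y) \<in> generator S'\<close> s]
          unfolding has_vector_derivative_iff_quotient .
        show "eventually (\<lambda>r. 0 \<le> t - r) ?F"
          by (auto simp: eventually_at_filter)
      qed (use s in auto)
      moreover have "((\<lambda>r. (blinfun_apply (S (t - r)) ?w - blinfun_apply (S (t - s)) ?w) /\<^sub>R (r - s))
          \<longlongrightarrow> - blinfun_apply (S (t - s)) ?w') ?F"
        using generator_deriv_reversed[OF S w s] unfolding has_vector_derivative_iff_quotient .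
      ultimately have "((\<lambda>r. blinfun_apply (S (t - r)) ((blinfun_apply (S' r) x - ?w) /\<^sub>R (r - s))
          + (blinfun_apply (S (t - r)) ?w - blinfun_apply (S (t - s)) ?w) /\<^sub>R (r - s)) \<longlongrightarrow>
          blinfun_apply (S (t - s)) ?w' + - blinfun_apply (S (t - s)) ?w') ?F"
        by (rule tendsto_add)
      moreover have "(?\<phi> r - ?\<phi> s) /\<^sub>R (r - s) = blinfun_apply (S (t - r)) ((blinfun_apply (S' r) x - ?w) /\<^sub>R (r - s))
          + (blinfun_apply (S (t - r)) ?w - blinfun_apply (S (t - s)) ?w) /\<^sub>R (r - s)" for r
        by (simp add: blinfun.bilinear_simps algebra_simps)
      ultimately show "((\<lambda>r. (?\<phi> r - ?\<phi> s) /\<^sub>R (r - s)) \<longlongrightarrow> 0) ?F"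
        by simp
    qed
    then obtain c where c: "\<And>s. s \<in> {0..t} \<Longrightarrow> ?\<phi> s = c"
      using has_vector_derivative_zero_constant[of "{0..t}" ?\<phi>, OF convex_real_interval(5)] by blast
    then have "?\<phi> 0 = ?\<phi> t"
      using c[of 0] c[of t] t by simp
    then show ?thesis
      by (simp add: semigroup_zero[OF S] semigroup_zero[OF S'])
  qed
  moreover have "closure (span (Domain (generator S'))) = UNIV"
    using generator_dense[OF S'] closure_mono[OF span_superset] by blast
  ultimately show ?thesis
    by (intro blinfun_eq_on_dense_span[of "Domain (generator S')"]) auto
qed

lemma exp_op_semigroup:
  assumes "generates_semigroup A"
  shows "c0_semigroup (exp_op A)" "generator (exp_op A) = A"
  using assms someI_ex[of "\<lambda>S. c0_semigroup S \<and> generator S = A"]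
  unfolding exp_op_def generates_semigroup_def by auto


section \<open>The semigroup of a non-positive self-adjoint operator\<close>

lemma closed_norm_le_blinfun: "closed {x. norm (blinfun_apply F x) \<le> K * norm x}"
  by (intro closed_Collect_le continuous_intros)

lemma nonpositive_semigroup_contraction:
  assumes S: "c0_semigroup S" and np: "nonpositive (generator S)" and t: "t \<ge> 0"
  shows "norm (S t) \<le> 1"
proof -
  have "norm (blinfun_apply (S t) x) \<le> 1 * norm x" if xy: "(x, y) \<in> generator S" for x y
  proof -
    let ?\<phi> = "\<lambda>r. inner (blinfun_apply (S r) x) (blinfun_apply (S r) x)"
    have d: "(?\<phi> has_vector_derivative 2 * inner (blinfun_apply (S r) y) (blinfun_apply (S r) x))
        (at r within {0..t})" if "r \<in> {0..t}" for r
      using bounded_bilinear.has_vector_derivative[OF bounded_bilinear_inner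
          generator_deriv[OF S xy that] generator_deriv[OF S xy that]]
      by (simp add: inner_commute)
    have "?\<phi> 0 \<ge> ?\<phi> t"
    proof (rule DERIV_nonpos_imp_decreasing_open[OF t])
      show "continuous_on {0..t} ?\<phi>"
        by (intro continuous_on_inner semigroup_orbit_continuous[OF S]) auto
      fix r assume r: "0 < r" "r < t"
      have "(blinfun_apply (S r) x, blinfun_apply (S r) y) \<in> generator S"
        using generator_invariant[OF S xy] r by simp
      then have "inner (blinfun_apply (S r) y) (blinfun_apply (S r) x) \<le> 0"
        using np by (auto simp: nonpositive_def Re_cinner)
      moreover have "(?\<phi> has_real_derivative 2 * inner (blinfun_apply (S r) y) (blinfun_apply (S r) x)) (at r)"
        using d[of r] r by (simp add: has_real_derivative_iff_has_vector_derivative at_within_Icc_at)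
      ultimately show "\<exists>y. (?\<phi> has_real_derivative y) (at r) \<and> y \<le> 0"
        by force
    qed
    then show ?thesis
      by (simp add: semigroup_zero[OF S] norm_le)
  qed
  then have "Domain (generator S) \<subseteq> {x. norm (blinfun_apply (S t) x) \<le> 1 * norm x}"
    by blast
  then have "closure (Domain (generator S)) \<subseteq> {x. norm (blinfun_apply (S t) x) \<le> 1 * norm x}"
    by (intro closure_minimal closed_norm_le_blinfun)
  then show ?thesis
    unfolding generator_dense[OF S] by (intro norm_blinfun_bound) auto
qed

lemma selfadjoint_symmetric:
  assumes "selfadjoint B" "(x, x') \<in> B" "(y, y') \<in> B"
  shows "cinner x' y = cinner x y'"
  using assms unfolding selfadjoint_def adjoint_op_def by blast

text \<open>The semigroup is symmetric because \<open>r \<mapsto> \<langle>S(r) x, S(t - r) y\<rangle>\<close> is constant on \<open>[0, t]\<close> for \<open>x\<close> and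
  \<open>y\<close> in the domain of the generator.\<close>

lemma selfadjoint_semigroup:
  assumes S: "c0_semigroup S" and sa: "selfadjoint (generator S)" and t: "t \<ge> 0"
  shows "cinner (blinfun_apply (S t) x) y = cinner x (blinfun_apply (S t) y)"
proof -
  let ?D = "Domain (generator S)"
  have core: "cinner (blinfun_apply (S t) x) y = cinner x (blinfun_apply (S t) y)"
    if xx': "(x, x') \<in> generator S" and yy': "(y, y') \<in> generator S" for x x' y y'
  proof -
    let ?\<phi> = "\<lambda>r. cinner (blinfun_apply (S r) x) (blinfun_apply (S (t - r)) y)"
    have "(?\<phi> has_vector_derivative 0) (at r within {0..t})" if r: "r \<in> {0..t}" for r
    proof -
      have "cinner (blinfun_apply (S r) x') (blinfun_apply (S (t - r)) y)
          = cinner (blinfun_apply (S r) x) (blinfun_apply (S (t - r)) y')"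
        using r by (intro selfadjoint_symmetric[OF sa] generator_invariant[OF S] xx' yy') auto
      then show ?thesis
        using bounded_bilinear.has_vector_derivative[OF bounded_bilinear_cinner
            generator_deriv[OF S xx' r] generator_deriv_reversed[OF S yy' r]]
        by (simp add: bounded_bilinear.minus_right[OF bounded_bilinear_cinner])
    qed
    then obtain c where c: "\<And>s. s \<in> {0..t} \<Longrightarrow> ?\<phi> s = c"
      using has_vector_derivative_zero_constant[of "{0..t}" ?\<phi>, OF convex_real_interval(5)] by blast
    then have "?\<phi> 0 = ?\<phi> t"
      using c[of 0] c[of t] t by simp
    then show ?thesis
      by (simp add: semigroup_zero[OF S])
  qed
  note cont = bounded_bilinear.continuous_on[OF bounded_bilinear_cinner]
  have "closure ?D \<subseteq> {x. cinner (blinfun_apply (S t) x) y = cinner x (blinfun_apply (S t) y)}"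
    if "y \<in> ?D" for y
    using that core by (intro closure_minimal closed_Collect_eq cont continuous_intros) blast
  then have "?D \<subseteq> {y. cinner (blinfun_apply (S t) x) y = cinner x (blinfun_apply (S t) y)}"
    unfolding generator_dense[OF S] by blast
  then have "closure ?D \<subseteq> {y. cinner (blinfun_apply (S t) x) y = cinner x (blinfun_apply (S t) y)}"
    by (intro closure_minimal closed_Collect_eq cont continuous_intros)
  then show ?thesis
    unfolding generator_dense[OF S] by blast
qed


section \<open>Orthonormal systems\<close>

text \<open>A set is orthonormal if its elements are pairwise orthogonal unit vectors.\<close>

definition orthonormal :: "'a::complex_inner set \<Rightarrow> bool"
  where "orthonormal F \<longleftrightarrow> (\<forall>e\<in>F. norm e = 1) \<and> (\<forall>e\<in>F. \<forall>e'\<in>F. e \<noteq> e' \<longrightarrow> cinner e e' = 0)"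

text \<open>A real subspace that is closed under complex scalars.\<close>

definition complex_subspace :: "'a::complex_inner set \<Rightarrow> bool"
  where "complex_subspace E \<longleftrightarrow> subspace E \<and> (\<forall>c. \<forall>x\<in>E. c *\<^sub>C x \<in> E)"

lemma norm_sum_orthogonal:
  fixes v :: "'i \<Rightarrow> 'a::complex_inner"
  assumes "finite I" "\<And>i j. i \<in> I \<Longrightarrow> j \<in> I \<Longrightarrow> i \<noteq> j \<Longrightarrow> cinner (v i) (v j) = 0"
  shows "(norm (sum v I))\<^sup>2 = (\<Sum>i\<in>I. (norm (v i))\<^sup>2)"
proof (rule norm_sum_Pythagorean[OF assms(1)])
  show "pairwise (\<lambda>i j. orthogonal (v i) (v j)) I"
    using assms(2) by (auto simp: pairwise_def orthogonal_def simp flip: Re_cinner)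
qed

text \<open>One step of the Gram-Schmidt process.\<close>

lemma orthonormal_extend:
  assumes F: "finite F" "orthonormal F" "F \<subseteq> E" and E: "complex_subspace E" "y \<in> E"
  obtains F' where "finite F'" "F \<subseteq> F'" "F' \<subseteq> E" "orthonormal F'"
    "y = (\<Sum>e\<in>F'. cinner y e *\<^sub>C e)"
proof -
  define r where "r = y - (\<Sum>e\<in>F. cinner y e *\<^sub>C e)"
  have ee: "cinner e e = 1" if "e \<in> F" for e
    using F(2) that by (simp add: cinner_self orthonormal_def)
  have r: "cinner r e = 0" if "e \<in> F" for e
  proof -
    have "(\<Sum>e'\<in>F. cinner y e' * cinner e' e) = (\<Sum>e'\<in>F. if e' = e then cinner y e else 0)"
      using F(2) that ee by (intro sum.cong) (auto simp: orthonormal_def)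
    then show ?thesis
      using F(1) that by (simp add: r_def cinner_diff_left cinner_sum_left cinner_scaleC_left)
  qed
  show ?thesis
  proof (cases "r = 0")
    case True
    then show ?thesis
      using that[of F] F by (simp add: r_def)
  next
    case False
    define e0 where "e0 = of_real (inverse (norm r)) *\<^sub>C r"
    have e0: "norm e0 = 1"
      using False by (simp add: e0_def norm_scaleC norm_inverse)
    have re0: "cinner r e0 = of_real (norm r)"
      using False by (simp add: e0_def cinner_scaleC_right cinner_self power2_eq_square field_simps)
    have e0F: "cinner e0 e = 0" "cinner e e0 = 0" if "e \<in> F" for e
      using r[OF that] cinner_commute[of e e0] by (simp_all add: e0_def cinner_scaleC_left)
    have "e0 \<notin> F"
      using e0F(1)[of e0] e0 by (auto simp: cinner_self)
    moreover have "e0 \<in> E"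
    proof -
      have "(\<Sum>e\<in>F. cinner y e *\<^sub>C e) \<in> E"
        using E(1) F(3) unfolding complex_subspace_def by (auto intro!: subspace_sum)
      then have "r \<in> E"
        using E unfolding r_def complex_subspace_def by (auto intro: subspace_diff)
      then show ?thesis
        using E(1) unfolding e0_def complex_subspace_def by blast
    qed
    moreover have "cinner y e0 *\<^sub>C e0 = r"
    proof -
      have "cinner y e0 = cinner (r + (\<Sum>e\<in>F. cinner y e *\<^sub>C e)) e0"
        by (simp add: r_def)
      also have "\<dots> = of_real (norm r)"
        by (simp add: cinner_add_left re0 cinner_sum_left cinner_scaleC_left e0F)
      finally show ?thesis
        using False by (simp add: e0_def scaleC_scaleC)
    qed
    moreover have "orthonormal (insert e0 F)"
      using F(2) e0 e0F by (auto simp: orthonormal_def)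
    ultimately show ?thesis
      using that[of "insert e0 F"] F by (simp add: r_def subset_insertI)
  qed
qed

text \<open>An orthonormal sequence whose members may also be zero, so that an orthonormal basis of any
  separable space, of finite dimension included, can be enumerated by the natural numbers.\<close>

definition orthonormal_seq :: "(nat \<Rightarrow> 'a::complex_inner) \<Rightarrow> bool"
  where "orthonormal_seq f \<longleftrightarrow> (\<forall>i. f i = 0 \<or> norm (f i) = 1) \<and> (\<forall>i j. i \<noteq> j \<longrightarrow> cinner (f i) (f j) = 0)"

lemma orthonormal_seqD:
  assumes "orthonormal_seq f"
  shows "i \<noteq> j \<Longrightarrow> cinner (f i) (f j) = 0" "norm (f i) \<le> 1" "f i \<noteq> 0 \<Longrightarrow> cinner (f i) (f i) = 1"
  using assms by (auto simp: orthonormal_seq_def cinner_self) (metis norm_zero zero_le_one order_refl)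

lemma orthonormal_basis_exists:
  obtains f :: "nat \<Rightarrow> 'a::{complex_inner,second_countable_topology}"
  where "orthonormal_seq f" "closure (span {c *\<^sub>C f i |c i. True}) = UNIV"
proof -
  obtain D :: "'a set" where D: "countable D" "\<And>X. open X \<Longrightarrow> X \<noteq> {} \<Longrightarrow> \<exists>d\<in>D. d \<in> X"
    using countable_dense_setE by blast
  have "D \<noteq> {}"
    using D(2)[of UNIV] by auto
  then obtain d :: "nat \<Rightarrow> 'a" where d: "range d = D"
    using range_from_nat_into[OF \<open>D \<noteq> {}\<close> D(1)] by blast
  have "\<exists>G. \<forall>n. (finite (G n) \<and> orthonormal (G n)) \<and>
      (G n \<subseteq> G (Suc n) \<and> d n = (\<Sum>e\<in>G (Suc n). cinner (d n) e *\<^sub>C e))"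
  proof (rule dependent_nat_choice)
    show "\<exists>F :: 'a set. finite F \<and> orthonormal F"
      by (intro exI[of _ "{}"]) (simp add: orthonormal_def)
    fix F :: "'a set" and n assume F: "finite F \<and> orthonormal F"
    have "complex_subspace (UNIV :: 'a set)"
      by (simp add: complex_subspace_def)
    then obtain F' where "finite F'" "F \<subseteq> F'" "F' \<subseteq> UNIV" "orthonormal F'"
        "d n = (\<Sum>e\<in>F'. cinner (d n) e *\<^sub>C e)"
      by (rule orthonormal_extend[OF conjunct1[OF F] conjunct2[OF F] subset_UNIV _ UNIV_I])
    then show "\<exists>F'. (finite F' \<and> orthonormal F') \<and> F \<subseteq> F' \<and> d n = (\<Sum>e\<in>F'. cinner (d n) e *\<^sub>C e)"
      by blast
  qed
  then obtain G where G: "\<And>n. finite (G n)" "\<And>n. orthonormal (G n)" "\<And>n. G n \<subseteq> G (Suc n)"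
      "\<And>n. d n = (\<Sum>e\<in>G (Suc n). cinner (d n) e *\<^sub>C e)"
    by blast
  define H where "H = (\<Union>n. G n)"
  have mono: "G m \<subseteq> G n" if "m \<le> n" for m n
    using that by (rule lift_Suc_mono_le[of G, OF G(3)])
  have H: "orthonormal H"
    unfolding orthonormal_def
  proof (intro conjI ballI impI)
    show "norm e = 1" if "e \<in> H" for e
      using that G(2) by (auto simp: H_def orthonormal_def)
    fix e e' assume "e \<in> H" "e' \<in> H" and ne: "e \<noteq> e'"
    then obtain m n where "e \<in> G m" "e' \<in> G n"
      by (auto simp: H_def)
    then have "e \<in> G (max m n)" "e' \<in> G (max m n)"
      using mono[of m "max m n"] mono[of n "max m n"] by auto
    then show "cinner e e' = 0"
      using G(2) ne unfolding orthonormal_def by blast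
  qed
  have cH: "countable H"
    unfolding H_def using G(1) by (intro countable_UN) (auto simp: countable_finite)
  define f where "f i = (if i \<in> to_nat_on H ` H then from_nat_into H i else 0)" for i
  have fH: "f (to_nat_on H e) = e" if "e \<in> H" for e
    using that cH by (simp add: f_def)
  have f_cases: "f i = 0 \<or> (\<exists>e\<in>H. f i = e \<and> i = to_nat_on H e)" for i
    using cH by (auto simp: f_def)
  show ?thesis
  proof (rule that)
    show "orthonormal_seq f"
      unfolding orthonormal_seq_def
    proof (intro conjI allI impI)
      show "f i = 0 \<or> norm (f i) = 1" for i
        using f_cases[of i] H by (auto simp: orthonormal_def)
      show "cinner (f i) (f j) = 0" if "i \<noteq> j" for i j
        using f_cases[of i] f_cases[of j] H that unfolding orthonormal_def
        by (metis cinner_zero_left cinner_zero_right)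
    qed
    have "d n \<in> span {c *\<^sub>C f i |c i. True}" for n
    proof -
      have "(\<Sum>e\<in>G (Suc n). cinner (d n) e *\<^sub>C e) \<in> span {c *\<^sub>C f i |c i. True}"
      proof (intro span_sum span_base)
        fix e assume "e \<in> G (Suc n)"
        then have "f (to_nat_on H e) = e"
          by (intro fH) (auto simp: H_def)
        then show "cinner (d n) e *\<^sub>C e \<in> {c *\<^sub>C f i |c i. True}"
          by (metis (mono_tags, lifting) mem_Collect_eq)
      qed
      then show ?thesis
        using G(4) by metis
    qed
    then have "D \<subseteq> span {c *\<^sub>C f i |c i. True}"
      using d by blast
    moreover have "closure D = UNIV"
      using D(2)[of "- closure D"] closure_subset[of D] by auto
    ultimately show "closure (span {c *\<^sub>C f i |c i. True}) = UNIV"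
      using closure_mono by blast
  qed
qed

text \<open>Convergence and norm of an orthogonal series with square summable norms.\<close>

lemma orthogonal_series:
  fixes v :: "nat \<Rightarrow> 'a::chilbert_space"
  assumes orth: "\<And>i j. i \<noteq> j \<Longrightarrow> cinner (v i) (v j) = 0" and sm: "summable (\<lambda>i. (norm (v i))\<^sup>2)"
  shows "summable v" "(norm (suminf v))\<^sup>2 = (\<Sum>i. (norm (v i))\<^sup>2)"
proof -
  have eq: "(norm (sum v I))\<^sup>2 = (\<Sum>i\<in>I. (norm (v i))\<^sup>2)" if "finite I" for I
    using that orth by (intro norm_sum_orthogonal) auto
  show "summable v"
    unfolding summable_Cauchy
  proof (intro allI impI)
    fix e :: real assume "e > 0"
    then obtain N where N: "\<And>m n. m \<ge> N \<Longrightarrow> norm (\<Sum>i=m..<n. (norm (v i))\<^sup>2) < e\<^sup>2"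
      using sm unfolding summable_Cauchy by (metis zero_less_power)
    have "norm (sum v {m..<n}) < e" if "m \<ge> N" for m n
    proof -
      have "(norm (sum v {m..<n}))\<^sup>2 < e\<^sup>2"
        using N[OF that, of n] by (simp add: eq sum_nonneg)
      then show ?thesis
        using \<open>e > 0\<close> by (intro power_less_imp_less_base[of _ 2 e]) simp_all
    qed
    then show "\<exists>N. \<forall>m\<ge>N. \<forall>n. norm (sum v {m..<n}) < e"
      by blast
  qed
  then have "(\<lambda>n. (norm (\<Sum>i<n. v i))\<^sup>2) \<longlonglongrightarrow> (norm (suminf v))\<^sup>2"
    by (intro tendsto_intros summable_LIMSEQ)
  moreover have "(\<lambda>n. (norm (\<Sum>i<n. v i))\<^sup>2) \<longlonglongrightarrow> (\<Sum>i. (norm (v i))\<^sup>2)"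
    unfolding eq[OF finite_lessThan] using sm by (rule summable_LIMSEQ)
  ultimately show "(norm (suminf v))\<^sup>2 = (\<Sum>i. (norm (v i))\<^sup>2)"
    by (rule LIMSEQ_unique)
qed

text \<open>If \<open>s \<le> K \<surd>s\<close>, the shape that testing a functional of norm \<open>K\<close> on its own coefficients gives,
  then \<open>s \<le> K\<^sup>2\<close>.\<close>

lemma le_square_of_le_mult_sqrt:
  fixes s K :: real
  assumes "s \<ge> 0" "s \<le> K * sqrt s" "K \<ge> 0"
  shows "s \<le> K\<^sup>2"
proof (cases "s = 0")
  case False
  then have "sqrt s > 0"
    using assms(1) by simp
  moreover have "sqrt s * sqrt s \<le> K * sqrt s"
    using assms(1,2) by simp
  ultimately have "sqrt s \<le> K"
    by (simp only: mult_le_cancel_right_pos)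
  then have "(sqrt s)\<^sup>2 \<le> K\<^sup>2"
    using assms(1) by (intro power_mono) auto
  then show ?thesis
    using assms(1) by simp
qed simp

text \<open>The Riesz vector of a functional. It is defined by its expansion in a fixed orthonormal
  basis, so that it depends measurably on the functional.\<close>

lemma riesz_exists:
  fixes f :: "nat \<Rightarrow> 'a::chilbert_space"
  assumes f: "orthonormal_seq f" "closure (span {c *\<^sub>C f i |c i. True}) = UNIV" and \<xi>: "\<xi> \<in> cdual"
  shows "summable (\<lambda>i. cnj (blinfun_apply \<xi> (f i)) *\<^sub>C f i)" (is "summable ?v")
    and "\<xi> = cinner_dual (\<Sum>i. cnj (blinfun_apply \<xi> (f i)) *\<^sub>C f i)"
proof -
  have lin: "blinfun_apply \<xi> (c *\<^sub>C x) = c * blinfun_apply \<xi> x" for c x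
    using \<xi> by (simp add: cdual_def)
  have orth: "cinner (?v i) (?v j) = 0" if "i \<noteq> j" for i j
    using orthonormal_seqD(1)[OF f(1) that] by (simp add: cinner_scaleC_left cinner_scaleC_right)
  have nv: "(norm (?v i))\<^sup>2 = (cmod (blinfun_apply \<xi> (f i)))\<^sup>2" for i
  proof (cases "f i = 0")
    case False
    then have "norm (f i) = 1"
      using f(1) by (auto simp: orthonormal_seq_def)
    then show ?thesis
      by (simp add: norm_scaleC)
  qed simp
  have bound: "(\<Sum>i<n. (norm (?v i))\<^sup>2) \<le> (norm \<xi>)\<^sup>2" for n
  proof (rule le_square_of_le_mult_sqrt)
    have "of_real (\<Sum>i<n. (norm (?v i))\<^sup>2) = blinfun_apply \<xi> (\<Sum>i<n. ?v i)"
      unfolding nv of_real_sum blinfun.sum_right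
      by (intro sum.cong) (simp_all add: lin mult.commute flip: complex_norm_square)
    from arg_cong[OF this, of norm] have "\<bar>\<Sum>i<n. (norm (?v i))\<^sup>2\<bar> = norm (blinfun_apply \<xi> (\<Sum>i<n. ?v i))"
      by (simp only: norm_of_real)
    then have "\<bar>\<Sum>i<n. (norm (?v i))\<^sup>2\<bar> \<le> norm \<xi> * norm (\<Sum>i<n. ?v i)"
      by (simp only: norm_blinfun)
    moreover have "norm (\<Sum>i<n. ?v i) = sqrt (\<Sum>i<n. (norm (?v i))\<^sup>2)"
      using norm_sum_orthogonal[of "{..<n}" ?v] orth by (intro real_sqrt_unique[symmetric]) auto
    ultimately show "(\<Sum>i<n. (norm (?v i))\<^sup>2) \<le> norm \<xi> * sqrt (\<Sum>i<n. (norm (?v i))\<^sup>2)"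
      by (simp add: sum_nonneg)
  qed (simp_all add: sum_nonneg)
  have "summable (\<lambda>i. (norm (?v i))\<^sup>2)"
    by (rule summableI_nonneg_bounded[OF _ bound]) simp
  then show sv: "summable ?v"
    using orthogonal_series(1)[of ?v] orth by blast
  show "\<xi> = cinner_dual (suminf ?v)"
  proof (rule blinfun_eq_on_dense_span[OF f(2)])
    fix x assume "x \<in> {c *\<^sub>C f i |c i. True}"
    then obtain c j where x: "x = c *\<^sub>C f j"
      by blast
    have "(\<lambda>i. cinner (f j) (?v i)) = (\<lambda>i. if i = j then blinfun_apply \<xi> (f j) else 0)"
    proof
      fix i
      show "cinner (f j) (?v i) = (if i = j then blinfun_apply \<xi> (f j) else 0)"
        using orthonormal_seqD(1)[OF f(1), of j i] orthonormal_seqD(3)[OF f(1), of j]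
        by (cases "f j = 0") (auto simp: cinner_scaleC_right)
    qed
    moreover have "cinner (f j) (suminf ?v) = (\<Sum>i. cinner (f j) (?v i))"
      using bounded_linear.suminf[OF bounded_bilinear.bounded_linear_right[OF bounded_bilinear_cinner] sv]
      by simp
    ultimately have "cinner (f j) (suminf ?v) = blinfun_apply \<xi> (f j)"
      using suminf_finite[of "{j}" "\<lambda>i. if i = j then blinfun_apply \<xi> (f j) else 0"] by simp
    then show "blinfun_apply \<xi> x = blinfun_apply (cinner_dual (suminf ?v)) x"
      by (simp add: x lin cinner_scaleC_left)
  qed
qed


section \<open>Hilbert tensor products\<close>

context
  fixes \<tau> :: "'x::chilbert_space \<Rightarrow> 'y::chilbert_space \<Rightarrow> 'z::chilbert_space"
  assumes \<tau>: "hilbert_tensor \<tau>"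
begin

lemma tensor_scaleC:
  "\<tau> (c *\<^sub>C x) y = c *\<^sub>C \<tau> x y" "\<tau> x (c *\<^sub>C y) = c *\<^sub>C \<tau> x y"
  using \<tau> by (simp_all add: hilbert_tensor_def)

lemma cinner_tensor: "cinner (\<tau> x y) (\<tau> x' y') = cinner x x' * cinner y y'"
  using \<tau> by (simp add: hilbert_tensor_def)

lemma tensor_total: "closure (span {\<tau> x y |x y. True}) = UNIV"
  using \<tau> by (simp add: hilbert_tensor_def)

lemma norm_tensor: "norm (\<tau> x y) = norm x * norm y"
proof -
  have "complex_of_real ((norm (\<tau> x y))\<^sup>2) = of_real ((norm x * norm y)\<^sup>2)"
    unfolding cinner_self[symmetric] cinner_tensor by (simp add: cinner_self power_mult_distrib)
  then have "(norm (\<tau> x y))\<^sup>2 = (norm x * norm y)\<^sup>2"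
    by (simp only: of_real_eq_iff)
  then show ?thesis
    by (simp add: power2_eq_iff_nonneg)
qed

lemma bounded_bilinear_tensor: "bounded_bilinear \<tau>"
proof
  show "\<tau> (a + a') b = \<tau> a b + \<tau> a' b" "\<tau> a (b + b') = \<tau> a b + \<tau> a b'" for a a' b b'
    using \<tau> by (simp_all add: hilbert_tensor_def)
  show "\<tau> (r *\<^sub>R a) b = r *\<^sub>R \<tau> a b" "\<tau> a (r *\<^sub>R b) = r *\<^sub>R \<tau> a b" for r a b
    by (simp_all add: scaleR_eq_scaleC tensor_scaleC)
  show "\<exists>K. \<forall>a b. norm (\<tau> a b) \<le> norm a * norm b * K"
    by (intro exI[of _ 1]) (simp add: norm_tensor)
qed

lemma tensor_total_dense:
  assumes D: "closure D = UNIV" and E: "closure E = UNIV"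
  shows "closure (span {\<tau> x y |x y. x \<in> D \<and> y \<in> E}) = UNIV"
proof -
  let ?S = "closure (span {\<tau> x y |x y. x \<in> D \<and> y \<in> E})"
  note lin = bounded_bilinear.bounded_linear_right[OF bounded_bilinear_tensor]
    bounded_bilinear.bounded_linear_left[OF bounded_bilinear_tensor]
  have step: "\<tau> x y \<in> ?S" if "x \<in> D" for x y
  proof -
    have "E \<subseteq> \<tau> x -` ?S"
      using that closure_subset[of "span {\<tau> x y |x y. x \<in> D \<and> y \<in> E}"] by (auto intro!: span_base)
    then have "closure E \<subseteq> \<tau> x -` ?S"
      by (intro closure_minimal closed_vimage closed_closure bounded_linear.continuous_on[OF lin(1)] continuous_intros)
    then show ?thesis
      using E by auto
  qed
  have "\<tau> x y \<in> ?S" for x y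
  proof -
    have "D \<subseteq> (\<lambda>x. \<tau> x y) -` ?S"
      using step by auto
    then have "closure D \<subseteq> (\<lambda>x. \<tau> x y) -` ?S"
      by (intro closure_minimal closed_vimage closed_closure bounded_linear.continuous_on[OF lin(2)] continuous_intros)
    then show ?thesis
      using D by auto
  qed
  then show ?thesis
    by (intro closed_subspace_UNIV[OF _ _ tensor_total] subspace_closure) auto
qed

lemma hilbert_tensor_swap: "hilbert_tensor (\<lambda>y x. \<tau> x y)"
proof -
  have "{\<tau> x y |x y. True} = {\<tau> x y |y x. True}"
    by blast
  then show ?thesis
    using \<tau> unfolding hilbert_tensor_def by (simp add: mult.commute)
qed

lemma norm_sum_tensor_orthonormal:
  assumes "finite F" "orthonormal F"
  shows "(norm (\<Sum>e\<in>F. \<tau> (x e) e))\<^sup>2 = (\<Sum>e\<in>F. (norm (x e))\<^sup>2)"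
proof -
  have "(norm (\<Sum>e\<in>F. \<tau> (x e) e))\<^sup>2 = (\<Sum>e\<in>F. (norm (\<tau> (x e) e))\<^sup>2)"
    using assms by (intro norm_sum_orthogonal) (auto simp: cinner_tensor orthonormal_def)
  also have "\<dots> = (\<Sum>e\<in>F. (norm (x e))\<^sup>2)"
    using assms(2) by (intro sum.cong) (auto simp: norm_tensor orthonormal_def)
  finally show ?thesis .
qed

end

lemma linear_opD:
  assumes "linear_op R"
  shows "(0, 0) \<in> R" "(x, y) \<in> R \<Longrightarrow> (x', y') \<in> R \<Longrightarrow> (x + x', y + y') \<in> R"
    "(x, y) \<in> R \<Longrightarrow> (c *\<^sub>C x, c *\<^sub>C y) \<in> R" "(x, y) \<in> R \<Longrightarrow> (x, y') \<in> R \<Longrightarrow> y = y'"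
  using assms unfolding linear_op_def single_valued_def by blast+

text \<open>Finite sums of elementary tensors can be written with an orthonormal system in the second
  factor. The two tensors \<open>\<Sum> x \<otimes> y\<close> and \<open>\<Sum> R x \<otimes> y\<close> are rewritten with the same system.\<close>

lemma tensor_orthonormal_form:
  fixes \<tau> :: "'x::chilbert_space \<Rightarrow> 'y::chilbert_space \<Rightarrow> 'z::chilbert_space"
    and \<tau>' :: "'v::chilbert_space \<Rightarrow> 'y \<Rightarrow> 'w::chilbert_space"
  assumes \<tau>: "hilbert_tensor \<tau>" and \<tau>': "hilbert_tensor \<tau>'" and R: "linear_op R" and E: "complex_subspace E"
    and zw: "(z, w) \<in> span {(\<tau> x y, \<tau>' v y) |x v y. (x, v) \<in> R \<and> y \<in> E}"
  shows "\<exists>F x v. finite F \<and> F \<subseteq> E \<and> orthonormal F \<and> (\<forall>e\<in>F. (x e, v e) \<in> R) \<and>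
    z = (\<Sum>e\<in>F. \<tau> (x e) e) \<and> w = (\<Sum>e\<in>F. \<tau>' (v e) e)"
proof -
  let ?P = "\<lambda>p. \<exists>F x v. finite F \<and> F \<subseteq> E \<and> orthonormal F \<and> (\<forall>e\<in>F. (x e, v e) \<in> R) \<and>
    p = ((\<Sum>e\<in>F. \<tau> (x e) e), (\<Sum>e\<in>F. \<tau>' (v e) e))"
  note add = bounded_bilinear.add_left[OF bounded_bilinear_tensor[OF \<tau>]]
    bounded_bilinear.add_left[OF bounded_bilinear_tensor[OF \<tau>']]
  note zero = bounded_bilinear.zero_left[OF bounded_bilinear_tensor[OF \<tau>]]
    bounded_bilinear.zero_left[OF bounded_bilinear_tensor[OF \<tau>']]
  note sumr = bounded_bilinear.sum_right[OF bounded_bilinear_tensor[OF \<tau>]]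
    bounded_bilinear.sum_right[OF bounded_bilinear_tensor[OF \<tau>']]
  have "?P (z, w)"
    using zw
  proof (induction rule: span_induct_alt)
    case base
    show ?case
      by (intro exI[of _ "{}"]) (simp add: orthonormal_def zero_prod_def)
  next
    case (step c p q)
    obtain x v y where p: "p = (\<tau> x y, \<tau>' v y)" "(x, v) \<in> R" "y \<in> E"
      using step(1) by blast
    obtain F xs vs where F: "finite F" "F \<subseteq> E" "orthonormal F" "\<And>e. e \<in> F \<Longrightarrow> (xs e, vs e) \<in> R"
        and q: "q = ((\<Sum>e\<in>F. \<tau> (xs e) e), (\<Sum>e\<in>F. \<tau>' (vs e) e))"
      using step(2) by blast
    obtain F' where F': "finite F'" "F \<subseteq> F'" "F' \<subseteq> E" "orthonormal F'"
        and y: "y = (\<Sum>e\<in>F'. cinner y e *\<^sub>C e)"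
      by (rule orthonormal_extend[OF F(1,3,2) E p(3)])
    define xs' where "xs' e = (of_real c * cinner y e) *\<^sub>C x + (if e \<in> F then xs e else 0)" for e
    define vs' where "vs' e = (of_real c * cinner y e) *\<^sub>C v + (if e \<in> F then vs e else 0)" for e
    have "(xs' e, vs' e) \<in> R" for e
      unfolding xs'_def vs'_def using F(4) linear_opD(1)[OF R]
      by (intro linear_opD(2,3)[OF R] p(2)) auto
    moreover have "c *\<^sub>R \<tau> x y + (\<Sum>e\<in>F. \<tau> (xs e) e) = (\<Sum>e\<in>F'. \<tau> (xs' e) e)"
    proof -
      have "c *\<^sub>R \<tau> x y = (\<Sum>e\<in>F'. \<tau> ((of_real c * cinner y e) *\<^sub>C x) e)"
        by (subst y) (simp add: sumr tensor_scaleC[OF \<tau>] scaleR_eq_scaleC scaleC_sum_right scaleC_scaleC)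
      moreover have "(\<Sum>e\<in>F. \<tau> (xs e) e) = (\<Sum>e\<in>F'. \<tau> (if e \<in> F then xs e else 0) e)"
        using F' by (intro sum.mono_neutral_cong_left) (auto simp: zero)
      ultimately show ?thesis
        by (simp add: xs'_def add sum.distrib)
    qed
    moreover have "c *\<^sub>R \<tau>' v y + (\<Sum>e\<in>F. \<tau>' (vs e) e) = (\<Sum>e\<in>F'. \<tau>' (vs' e) e)"
    proof -
      have "c *\<^sub>R \<tau>' v y = (\<Sum>e\<in>F'. \<tau>' ((of_real c * cinner y e) *\<^sub>C v) e)"
        by (subst y) (simp add: sumr tensor_scaleC[OF \<tau>'] scaleR_eq_scaleC scaleC_sum_right scaleC_scaleC)
      moreover have "(\<Sum>e\<in>F. \<tau>' (vs e) e) = (\<Sum>e\<in>F'. \<tau>' (if e \<in> F then vs e else 0) e)"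
        using F' by (intro sum.mono_neutral_cong_left) (auto simp: zero)
      ultimately show ?thesis
        by (simp add: vs'_def add sum.distrib)
    qed
    ultimately show ?case
      using F' by (intro exI[of _ F'] exI[of _ xs'] exI[of _ vs']) (simp add: p q)
  qed
  then show ?thesis
    by simp
qed

subsection \<open>Operators on tensor products\<close>

text \<open>The operators \<open>M \<otimes> I\<close> and \<open>I \<otimes> N\<close>, for bounded complex linear \<open>M\<close> and \<open>N\<close>.\<close>

definition tensor_left ::
  "('x::chilbert_space \<Rightarrow> 'y::chilbert_space \<Rightarrow> 'z::chilbert_space)
    \<Rightarrow> ('v::chilbert_space \<Rightarrow> 'y \<Rightarrow> 'w::chilbert_space) \<Rightarrow> ('x \<Rightarrow>\<^sub>L 'v) \<Rightarrow> ('z \<Rightarrow>\<^sub>L 'w)"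
  where "tensor_left \<tau> \<tau>' M =
    (SOME F. (\<forall>x y. blinfun_apply F (\<tau> x y) = \<tau>' (blinfun_apply M x) y) \<and> norm F \<le> norm M)"

definition tensor_right ::
  "('x::chilbert_space \<Rightarrow> 'y::chilbert_space \<Rightarrow> 'z::chilbert_space)
    \<Rightarrow> ('x \<Rightarrow> 'v::chilbert_space \<Rightarrow> 'w::chilbert_space) \<Rightarrow> ('y \<Rightarrow>\<^sub>L 'v) \<Rightarrow> ('z \<Rightarrow>\<^sub>L 'w)"
  where "tensor_right \<tau> \<tau>' N = tensor_left (\<lambda>y x. \<tau> x y) (\<lambda>y x. \<tau>' x y) N"

lemma tensor_left:
  fixes \<tau> :: "'x::chilbert_space \<Rightarrow> 'y::chilbert_space \<Rightarrow> 'z::chilbert_space"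
    and \<tau>' :: "'v::chilbert_space \<Rightarrow> 'y \<Rightarrow> 'w::chilbert_space"
  assumes \<tau>: "hilbert_tensor \<tau>" and \<tau>': "hilbert_tensor \<tau>'"
    and M: "\<And>c x. blinfun_apply M (c *\<^sub>C x) = c *\<^sub>C blinfun_apply M x"
  shows "blinfun_apply (tensor_left \<tau> \<tau>' M) (\<tau> x y) = \<tau>' (blinfun_apply M x) y"
    and "norm (tensor_left \<tau> \<tau>' M) \<le> norm M"
proof -
  let ?R = "{(x, blinfun_apply M x) |x. True}"
  let ?S = "span {(\<tau> x y, \<tau>' v y) |x v y. (x, v) \<in> ?R \<and> y \<in> UNIV}"
  have R: "linear_op ?R"
    unfolding linear_op_def single_valued_def
    by (auto simp: M blinfun.bilinear_simps intro!: exI[of _ "_ + _"])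
  have "complex_subspace (UNIV :: 'y set)"
    by (simp add: complex_subspace_def)
  note form = tensor_orthonormal_form[OF \<tau> \<tau>' R this]
  have bd: "norm w \<le> norm M * norm z" if zw: "(z, w) \<in> ?S" for z w
  proof -
    obtain F x v where F: "finite F" "orthonormal F" "\<And>e. e \<in> F \<Longrightarrow> v e = blinfun_apply M (x e)"
        and eq: "z = (\<Sum>e\<in>F. \<tau> (x e) e)" "w = (\<Sum>e\<in>F. \<tau>' (v e) e)"
      using form[OF zw] by blast
    have "(norm w)\<^sup>2 = (\<Sum>e\<in>F. (norm (v e))\<^sup>2)"
      unfolding eq by (rule norm_sum_tensor_orthonormal[OF \<tau>' F(1,2)])
    also have "\<dots> \<le> (\<Sum>e\<in>F. (norm M * norm (x e))\<^sup>2)"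
      using F(3) norm_blinfun[of M] by (intro sum_mono power_mono) auto
    also have "\<dots> = (norm M * norm z)\<^sup>2"
      unfolding power_mult_distrib eq norm_sum_tensor_orthonormal[OF \<tau> F(1,2)] sum_distrib_left ..
    finally show ?thesis
      by (rule power2_le_imp_le) simp
  qed
  have Dom: "{\<tau> x y |x y. True} \<subseteq> Domain ?S"
  proof clarify
    fix x y
    have "(\<tau> x y, \<tau>' (blinfun_apply M x) y) \<in> ?S"
      by (intro span_base) blast
    then show "\<tau> x y \<in> Domain ?S"
      by blast
  qed
  have "subspace (Domain ?S)"
    using linear_subspace_image[OF bounded_linear.linear[OF bounded_linear_fst] subspace_span]
    by (simp add: Domain_fst)
  then have "span {\<tau> x y |x y. True} \<subseteq> Domain ?S"
    using Dom by (intro span_minimal)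
  then have dense: "closure (Domain ?S) = UNIV"
    using tensor_total[OF \<tau>] closure_mono by blast
  obtain F where F: "\<And>z w. (z, w) \<in> ?S \<Longrightarrow> blinfun_apply F z = w" "norm F \<le> norm M"
    by (rule bounded_relation_extension[OF subspace_span bd dense norm_ge_zero]) auto
  have "\<forall>x y. blinfun_apply F (\<tau> x y) = \<tau>' (blinfun_apply M x) y"
    by (intro allI F(1) span_base) auto
  then have ex: "\<exists>F. (\<forall>x y. blinfun_apply F (\<tau> x y) = \<tau>' (blinfun_apply M x) y) \<and> norm F \<le> norm M"
    using F(2) by blast
  show "blinfun_apply (tensor_left \<tau> \<tau>' M) (\<tau> x y) = \<tau>' (blinfun_apply M x) y"
    "norm (tensor_left \<tau> \<tau>' M) \<le> norm M"
    using someI_ex[OF ex] unfolding tensor_left_def by blast+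
qed

lemma tensor_right:
  assumes "hilbert_tensor \<tau>" "hilbert_tensor \<tau>'"
    and "\<And>c x. blinfun_apply N (c *\<^sub>C x) = c *\<^sub>C blinfun_apply N x"
  shows "blinfun_apply (tensor_right \<tau> \<tau>' N) (\<tau> x y) = \<tau>' x (blinfun_apply N y)"
    and "norm (tensor_right \<tau> \<tau>' N) \<le> norm N"
  using tensor_left[OF hilbert_tensor_swap[OF assms(1)] hilbert_tensor_swap[OF assms(2)] assms(3)]
  unfolding tensor_right_def by blast+

text \<open>Scalar multiplication presents a Hilbert space as its own tensor product with the complex
  numbers.\<close>

lemma hilbert_tensor_scaleC: "hilbert_tensor (\<lambda>(x::'x::chilbert_space) c. c *\<^sub>C x)"
proof -
  have "{c *\<^sub>C x |(x::'x) c. True} = UNIV"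
  proof (rule UNIV_eq_I[symmetric])
    fix x :: 'x
    have "x = 1 *\<^sub>C x"
      by simp
    then show "x \<in> {c *\<^sub>C x |(x::'x) c. True}"
      by blast
  qed
  then show ?thesis
    by (auto simp: hilbert_tensor_def scaleC_add_right scaleC_add_left scaleC_scaleC scaleC_complex_def
        cinner_scaleC_left cinner_scaleC_right cinner_complex_def mult_ac)
qed

text \<open>The operator \<open>I \<otimes> \<langle>\<cdot>, f\<rangle>\<close>, which contracts the second factor with \<open>f\<close>. It takes values in the
  first factor, regarded as a tensor product with the complex numbers.\<close>

definition contract :: "('x::chilbert_space \<Rightarrow> 'y::chilbert_space \<Rightarrow> 'z::chilbert_space) \<Rightarrow> 'y \<Rightarrow> 'z \<Rightarrow>\<^sub>L 'x"
  where "contract \<tau> f = tensor_right \<tau> (\<lambda>x c. c *\<^sub>C x) (cinner_dual f)"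

lemma contract_tensor:
  assumes "hilbert_tensor \<tau>"
  shows "blinfun_apply (contract \<tau> f) (\<tau> x y) = cinner y f *\<^sub>C x"
  unfolding contract_def
  by (subst tensor_right[OF assms hilbert_tensor_scaleC]) (simp_all add: cinner_scaleC_left scaleC_complex_def)

lemma cinner_contract:
  assumes \<tau>: "hilbert_tensor \<tau>"
  shows "cinner (blinfun_apply (contract \<tau> f) z) x = cinner z (\<tau> x f)"
proof -
  have "cinner_dual x o\<^sub>L contract \<tau> f = cinner_dual (\<tau> x f)"
    by (rule blinfun_eq_on_dense_span[OF tensor_total[OF \<tau>]])
      (auto simp: contract_tensor[OF \<tau>] cinner_scaleC_left cinner_tensor[OF \<tau>] mult.commute)
  then show ?thesis
    by (metis blinfun_apply_blinfun_compose cinner_dual_apply)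
qed

lemma contract_eq_zero:
  assumes \<tau>: "hilbert_tensor \<tau>" and D: "closure D = UNIV"
    and z: "\<And>f. f \<in> D \<Longrightarrow> blinfun_apply (contract \<tau> f) z = 0"
  shows "z = 0"
proof -
  have "cinner z u = 0" if u: "u \<in> {\<tau> x f |x f. x \<in> UNIV \<and> f \<in> D}" for u
  proof -
    obtain x f where "u = \<tau> x f" "f \<in> D"
      using u by blast
    then show ?thesis
      using cinner_contract[OF \<tau>, of f z x] z by simp
  qed
  then have "cinner u z = 0" if "u \<in> {\<tau> x f |x f. x \<in> UNIV \<and> f \<in> D}" for u
    using that cinner_commute[of u z] by simp
  then have "cinner_dual z = 0"
    by (intro blinfun_eq_on_dense_span[OF tensor_total_dense[OF \<tau> closure_UNIV D]]) simp
  then have "cinner z z = 0"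
    by (metis cinner_dual_apply zero_blinfun.rep_eq)
  then show ?thesis
    by (simp add: cinner_self)
qed

subsection \<open>The tensor product of two semigroups\<close>

text \<open>For bounded families of operators, convergence to the identity need only be checked on a total set.\<close>

lemma tendsto_dense_bounded:
  fixes S :: "real \<Rightarrow> 'a::real_normed_vector \<Rightarrow>\<^sub>L 'a"
  assumes M: "eventually (\<lambda>t. norm (S t) \<le> M) F" "M \<ge> 0" and D: "closure (span D) = UNIV"
    and lim: "\<And>x. x \<in> D \<Longrightarrow> ((\<lambda>t. blinfun_apply (S t) x) \<longlongrightarrow> x) F"
  shows "((\<lambda>t. blinfun_apply (S t) x) \<longlongrightarrow> x) F"
proof -
  let ?L = "{x. ((\<lambda>t. blinfun_apply (S t) x) \<longlongrightarrow> x) F}"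
  have "subspace ?L"
    by (auto simp: subspace_def blinfun.bilinear_simps intro: tendsto_add tendsto_scaleR)
  then have span: "span D \<subseteq> ?L"
    using lim by (intro span_minimal) auto
  show ?thesis
  proof (rule tendstoI)
    fix e :: real assume e: "e > 0"
    have "x \<in> closure (span D)" "e / (M + 2) > 0"
      using D e M(2) by auto
    then obtain x' where x': "x' \<in> span D" "dist x' x < e / (M + 2)"
      unfolding closure_approachable by blast
    have "eventually (\<lambda>t. dist (blinfun_apply (S t) x') x' < e / (M + 2)) F"
      using span x'(1) \<open>e / (M + 2) > 0\<close> tendstoD by blast
    with M(1) show "eventually (\<lambda>t. dist (blinfun_apply (S t) x) x < e) F"
    proof eventually_elim
      case (elim t)
      have "norm (blinfun_apply (S t) (x - x')) \<le> M * norm (x - x')"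
        using norm_blinfun[of "S t" "x - x'"] elim(1) by (meson mult_right_mono norm_ge_zero order_trans)
      also have "\<dots> \<le> M * (e / (M + 2))"
        using x'(2) M(2) by (intro mult_left_mono) (auto simp: dist_norm norm_minus_commute)
      finally have "norm (blinfun_apply (S t) x - blinfun_apply (S t) x') \<le> M * (e / (M + 2))"
        by (simp add: blinfun.diff_right)
      then have "dist (blinfun_apply (S t) x) x < M * (e / (M + 2)) + e / (M + 2) + e / (M + 2)"
        using elim(2) x'(2) dist_triangle[of "blinfun_apply (S t) x" x "blinfun_apply (S t) x'"]
          dist_triangle[of "blinfun_apply (S t) x'" x x'] by (simp add: dist_norm)
      also have "\<dots> = (M + 2) * (e / (M + 2))"
        by (simp only: distrib_right mult_2 add.assoc)
      also have "\<dots> = e"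
        using M(2) by simp
      finally show ?case .
    qed
  qed
qed

text \<open>The semigroup \<open>P(t) \<otimes> Q(t)\<close>, as the product of \<open>P(t) \<otimes> I\<close> and \<open>I \<otimes> Q(t)\<close>.\<close>

definition tensor_semigroup ::
  "('x::chilbert_space \<Rightarrow> 'y::chilbert_space \<Rightarrow> 'z::chilbert_space)
    \<Rightarrow> (real \<Rightarrow> 'x \<Rightarrow>\<^sub>L 'x) \<Rightarrow> (real \<Rightarrow> 'y \<Rightarrow>\<^sub>L 'y) \<Rightarrow> real \<Rightarrow> 'z \<Rightarrow>\<^sub>L 'z"
  where "tensor_semigroup \<tau> P Q t = tensor_left \<tau> \<tau> (P t) o\<^sub>L tensor_right \<tau> \<tau> (Q t)"

context
  fixes \<tau> :: "'x::chilbert_space \<Rightarrow> 'y::chilbert_space \<Rightarrow> 'z::chilbert_space"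
    and P :: "real \<Rightarrow> 'x \<Rightarrow>\<^sub>L 'x" and Q :: "real \<Rightarrow> 'y \<Rightarrow>\<^sub>L 'y"
  assumes \<tau>: "hilbert_tensor \<tau>" and P: "c0_semigroup P" and Q: "c0_semigroup Q"
begin

lemma tensor_semigroup_tensor:
  "t \<ge> 0 \<Longrightarrow> blinfun_apply (tensor_semigroup \<tau> P Q t) (\<tau> x y) = \<tau> (blinfun_apply (P t) x) (blinfun_apply (Q t) y)"
  by (simp add: tensor_semigroup_def tensor_left(1)[OF \<tau> \<tau>] tensor_right(1)[OF \<tau> \<tau>]
      semigroup_scaleC[OF P] semigroup_scaleC[OF Q])

lemma norm_tensor_semigroup: "t \<ge> 0 \<Longrightarrow> norm (tensor_semigroup \<tau> P Q t) \<le> norm (P t) * norm (Q t)"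
  unfolding tensor_semigroup_def
  by (rule order_trans[OF norm_blinfun_compose])
    (intro mult_mono tensor_left(2)[OF \<tau> \<tau>] tensor_right(2)[OF \<tau> \<tau>], auto simp: semigroup_scaleC[OF P] semigroup_scaleC[OF Q])

lemma c0_tensor_semigroup: "c0_semigroup (tensor_semigroup \<tau> P Q)"
  unfolding c0_semigroup_def
proof (intro conjI allI impI)
  let ?S = "tensor_semigroup \<tau> P Q"
  note eqI = blinfun_eq_on_dense_span[OF tensor_total[OF \<tau>]]
  show "blinfun_apply (?S t) (c *\<^sub>C z) = c *\<^sub>C blinfun_apply (?S t) z" if t: "0 \<le> t" for t c z
  proof -
    have [simp]: "blinfun_apply (Blinfun ((*\<^sub>C) c)) u = c *\<^sub>C u" for u :: 'z
      by (simp add: bounded_linear_Blinfun_apply bounded_linear_scaleC)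
    have "?S t o\<^sub>L Blinfun ((*\<^sub>C) c) = Blinfun ((*\<^sub>C) c) o\<^sub>L ?S t"
    proof (rule eqI)
      fix u assume "u \<in> {\<tau> x y |x y. True}"
      then obtain x y where "u = \<tau> x y"
        by blast
      then show "blinfun_apply (?S t o\<^sub>L Blinfun ((*\<^sub>C) c)) u = blinfun_apply (Blinfun ((*\<^sub>C) c) o\<^sub>L ?S t) u"
        using t by (simp add: tensor_semigroup_tensor semigroup_scaleC[OF P] flip: tensor_scaleC(1)[OF \<tau>])
    qed
    from arg_cong[OF this, of "\<lambda>F. blinfun_apply F z"] show ?thesis
      by simp
  qed
  show "?S 0 = id_blinfun"
    by (rule eqI) (auto simp: tensor_semigroup_tensor semigroup_zero[OF P] semigroup_zero[OF Q])
  show "?S (s + t) = ?S s o\<^sub>L ?S t" if "0 \<le> s" "0 \<le> t" for s t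
    by (rule eqI) (use that in \<open>auto simp: tensor_semigroup_tensor semigroup_add[OF P] semigroup_add[OF Q]\<close>)
  obtain MP where MP: "MP \<ge> 1" "\<And>t. t \<in> {0..1} \<Longrightarrow> norm (P t) \<le> MP"
    using semigroup_bounded[OF P, of 1] by blast
  obtain MQ where MQ: "MQ \<ge> 1" "\<And>t. t \<in> {0..1} \<Longrightarrow> norm (Q t) \<le> MQ"
    using semigroup_bounded[OF Q, of 1] by blast
  have "norm (?S t) \<le> MP * MQ" if "0 < t" "t < 1" for t
  proof -
    have "norm (P t) * norm (Q t) \<le> MP * MQ"
      using that MP MQ by (intro mult_mono) auto
    then show ?thesis
      using norm_tensor_semigroup[of t] that by simp
  qed
  then have "eventually (\<lambda>t. norm (?S t) \<le> MP * MQ) (at_right 0)"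
    unfolding eventually_at_right_field by (intro exI[of _ 1]) auto
  then show "((\<lambda>t. blinfun_apply (?S t) z) \<longlongrightarrow> z) (at_right 0)" for z
  proof (rule tendsto_dense_bounded[OF _ _ tensor_total[OF \<tau>]])
    show "0 \<le> MP * MQ"
      using MP(1) MQ(1) by simp
    fix u assume "u \<in> {\<tau> x y |x y. True}"
    then obtain x y where u: "u = \<tau> x y"
      by blast
    have "((\<lambda>t. \<tau> (blinfun_apply (P t) x) (blinfun_apply (Q t) y)) \<longlongrightarrow> u) (at_right 0)"
      unfolding u
      by (intro bounded_bilinear.tendsto[OF bounded_bilinear_tensor[OF \<tau>]] semigroup_at_right P Q)
    moreover have "eventually (\<lambda>t. \<tau> (blinfun_apply (P t) x) (blinfun_apply (Q t) y) = blinfun_apply (?S t) u) (at_right 0)"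
      by (auto simp: eventually_at_filter u tensor_semigroup_tensor)
    ultimately show "((\<lambda>t. blinfun_apply (?S t) u) \<longlongrightarrow> u) (at_right 0)"
      by (rule Lim_transform_eventually)
  qed
qed

lemma tensor_sum_invariant:
  assumes "(z, z') \<in> tensor_sum \<tau> (generator P) (generator Q)" "t \<ge> 0"
  shows "(blinfun_apply (tensor_semigroup \<tau> P Q t) z, blinfun_apply (tensor_semigroup \<tau> P Q t) z')
    \<in> tensor_sum \<tau> (generator P) (generator Q)"
proof -
  let ?S = "blinfun_apply (tensor_semigroup \<tau> P Q t)"
  let ?X = "{(\<tau> x y, \<tau> x' y + \<tau> x y') |x x' y y'. (x, x') \<in> generator P \<and> (y, y') \<in> generator Q}"
  have "?X \<subseteq> (\<lambda>p. (?S (fst p), ?S (snd p))) -` span ?X"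
  proof clarify
    fix x x' y y' assume xy: "(x, x') \<in> generator P" "(y, y') \<in> generator Q"
    have "(blinfun_apply (P t) x, blinfun_apply (P t) x') \<in> generator P"
      "(blinfun_apply (Q t) y, blinfun_apply (Q t) y') \<in> generator Q"
      using xy assms(2) by (auto intro: generator_invariant P Q)
    then have "(\<tau> (blinfun_apply (P t) x) (blinfun_apply (Q t) y),
        \<tau> (blinfun_apply (P t) x') (blinfun_apply (Q t) y) + \<tau> (blinfun_apply (P t) x) (blinfun_apply (Q t) y')) \<in> span ?X"
      by (intro span_base) blast
    then show "(\<tau> x y, \<tau> x' y + \<tau> x y') \<in> (\<lambda>p. (?S (fst p), ?S (snd p))) -` span ?X"
      using assms(2) by (simp add: blinfun.add_right tensor_semigroup_tensor)
  qed
  moreover have "subspace ((\<lambda>p. (?S (fst p), ?S (snd p))) -` span ?X)"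
    by (rule linear_subspace_vimage) (auto intro!: linearI simp: blinfun.bilinear_simps)
  ultimately have "span ?X \<subseteq> (\<lambda>p. (?S (fst p), ?S (snd p))) -` span ?X"
    by (rule span_minimal)
  from subsetD[OF this assms(1)[unfolded tensor_sum_def]] show ?thesis
    unfolding tensor_sum_def by (simp only: vimage_eq fst_conv snd_conv)
qed

lemma Domain_tensor_sum_dense:
  "closure (Domain (tensor_sum \<tau> (generator P) (generator Q))) = UNIV"
proof -
  let ?R = "tensor_sum \<tau> (generator P) (generator Q)"
  have "subspace (Domain ?R)"
    using linear_subspace_image[OF bounded_linear.linear[OF bounded_linear_fst] subspace_span]
    by (simp add: Domain_fst tensor_sum_def)
  moreover have "{\<tau> x y |x y. x \<in> Domain (generator P) \<and> y \<in> Domain (generator Q)} \<subseteq> Domain ?R"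
    unfolding tensor_sum_def by (blast intro: span_base)
  ultimately have "span {\<tau> x y |x y. x \<in> Domain (generator P) \<and> y \<in> Domain (generator Q)} \<subseteq> Domain ?R"
    by (intro span_minimal)
  then show ?thesis
    using tensor_total_dense[OF \<tau> generator_dense[OF P] generator_dense[OF Q]] closure_mono by blast
qed

lemma generator_tensor_semigroup:
  "generator (tensor_semigroup \<tau> P Q) = closure (tensor_sum \<tau> (generator P) (generator Q))"
proof (rule closure_core_eq_generator[symmetric, OF c0_tensor_semigroup])
  let ?S = "tensor_semigroup \<tau> P Q"
  let ?X = "{(\<tau> x y, \<tau> x' y + \<tau> x y') |x x' y y'. (x, x') \<in> generator P \<and> (y, y') \<in> generator Q}"
  note bil = bounded_bilinear_tensor[OF \<tau>]
  have "?X \<subseteq> generator ?S"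
  proof clarify
    fix x x' y y' assume xy: "(x, x') \<in> generator P" "(y, y') \<in> generator Q"
    have "((\<lambda>t. \<tau> ((blinfun_apply (P t) x - x) /\<^sub>R t) (blinfun_apply (Q t) y)
        + \<tau> x ((blinfun_apply (Q t) y - y) /\<^sub>R t)) \<longlongrightarrow> \<tau> x' y + \<tau> x y') (at_right 0)"
      using xy unfolding generator_def
      by (intro tendsto_add bounded_bilinear.tendsto[OF bil] semigroup_at_right[OF Q] tendsto_const) auto
    moreover have "\<tau> ((blinfun_apply (P t) x - x) /\<^sub>R t) (blinfun_apply (Q t) y)
        + \<tau> x ((blinfun_apply (Q t) y - y) /\<^sub>R t) = (blinfun_apply (?S t) (\<tau> x y) - \<tau> x y) /\<^sub>R t"
      if "t > 0" for t
      using that by (simp add: tensor_semigroup_tensor bounded_bilinear.scaleR_left[OF bil]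
          bounded_bilinear.scaleR_right[OF bil] bounded_bilinear.diff_left[OF bil]
          bounded_bilinear.diff_right[OF bil] flip: scaleR_add_right)
    then have "eventually (\<lambda>t. \<tau> ((blinfun_apply (P t) x - x) /\<^sub>R t) (blinfun_apply (Q t) y)
        + \<tau> x ((blinfun_apply (Q t) y - y) /\<^sub>R t) = (blinfun_apply (?S t) (\<tau> x y) - \<tau> x y) /\<^sub>R t) (at_right 0)"
      by (auto simp: eventually_at_filter)
    ultimately have "((\<lambda>t. (blinfun_apply (?S t) (\<tau> x y) - \<tau> x y) /\<^sub>R t) \<longlongrightarrow> \<tau> x' y + \<tau> x y') (at_right 0)"
      by (rule Lim_transform_eventually)
    then show "(\<tau> x y, \<tau> x' y + \<tau> x y') \<in> generator ?S"
      by (simp add: generator_def)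
  qed
  then show "tensor_sum \<tau> (generator P) (generator Q) \<subseteq> generator ?S"
    unfolding tensor_sum_def by (intro span_minimal subspace_generator c0_tensor_semigroup)
  show "subspace (tensor_sum \<tau> (generator P) (generator Q))"
    by (simp add: tensor_sum_def)
qed (fact Domain_tensor_sum_dense | rule tensor_sum_invariant, assumption+)+

lemma exp_op_tensor_sum:
  assumes "t \<ge> 0"
  shows "exp_op (closure (tensor_sum \<tau> (generator P) (generator Q))) t = tensor_semigroup \<tau> P Q t"
proof -
  let ?A = "closure (tensor_sum \<tau> (generator P) (generator Q))"
  have "generates_semigroup ?A"
    unfolding generates_semigroup_def using c0_tensor_semigroup generator_tensor_semigroup by blast
  then show ?thesis
    using exp_op_semigroup[of ?A] assms generator_tensor_semigroup
    by (intro generator_determines_semigroup c0_tensor_semigroup) auto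
qed

end


section \<open>The observation operator on the tensor product\<close>

lemma op_apply_eq:
  assumes "\<And>y'. (x, y') \<in> R \<Longrightarrow> y' = y" "(x, y) \<in> R"
  shows "R \<bullet>\<^sub>o x = y"
  unfolding op_apply_def using assms by (rule the_equality[rotated])

lemma nn_integral_continuous_Icc:
  fixes f :: "real \<Rightarrow> real"
  assumes f: "continuous_on {a..b} f" "\<And>t. t \<in> {a..b} \<Longrightarrow> f t \<ge> 0"
  shows "(\<integral>\<^sup>+t\<in>{a..b}. ennreal (f t) \<partial>lborel) = ennreal (integral {a..b} f)"
proof -
  have int: "integrable lborel (\<lambda>t. indicator {a..b} t *\<^sub>R f t)"
    using borel_integrable_atLeastAtMost'[OF f(1)] by (simp add: set_integrable_def)
  have "(\<integral>\<^sup>+t\<in>{a..b}. ennreal (f t) \<partial>lborel) = (\<integral>\<^sup>+t. ennreal (indicator {a..b} t *\<^sub>R f t) \<partial>lborel)"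
    by (intro nn_integral_cong) (auto split: split_indicator)
  also have "\<dots> = ennreal (LINT t|lborel. indicator {a..b} t *\<^sub>R f t)"
    by (rule nn_integral_eq_integral[OF int]) (use f(2) in \<open>auto split: split_indicator\<close>)
  also have "(LINT t|lborel. indicator {a..b} t *\<^sub>R f t) = integral {a..b} f"
    using set_borel_integral_eq_integral(2)[OF borel_integrable_atLeastAtMost'[OF f(1)]]
    by (simp add: set_lebesgue_integral_def)
  finally show ?thesis .
qed

text \<open>The setting of the theorem: \<open>P\<close>, \<open>Q\<close> and \<open>S\<close> are the semigroups of \<open>A\<close>, \<open>B\<close> and \<open>A + B\<close>, the
  core is the algebraic tensor product of the domains with \<open>A \<otimes> I + I \<otimes> B\<close> acting on it, and \<open>AA\<close>
  and \<open>CC\<close> are the operators \<open>\<A>\<close> and \<open>\<C>\<close>.\<close>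

locale tensor_observation =
  fixes A :: "('x::{chilbert_space,second_countable_topology} \<times> 'x) set"
    and B :: "('y::{chilbert_space,second_countable_topology} \<times> 'y) set"
    and C :: "('x \<times> 'v::{chilbert_space,second_countable_topology}) set"
    and \<tau> :: "'x \<Rightarrow> 'y \<Rightarrow> 'z::{chilbert_space,second_countable_topology}"
    and \<tau>' :: "'v \<Rightarrow> 'y \<Rightarrow> 'w::{chilbert_space,second_countable_topology}"
    and \<beta> :: complex
  assumes \<tau>: "hilbert_tensor \<tau>" and \<tau>': "hilbert_tensor \<tau>'"
    and gen_A: "generates_semigroup A" and gen_B: "generates_semigroup B"
    and C_bounded: "bounded_on_Z1 \<beta> A C" and C_admissible: "admissible A C"
    and B_selfadjoint: "selfadjoint B" and B_nonpositive: "nonpositive B"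
begin

abbreviation "P \<equiv> exp_op A"
abbreviation "Q \<equiv> exp_op B"
abbreviation "S \<equiv> tensor_semigroup \<tau> P Q"
abbreviation "core \<equiv> tensor_sum \<tau> A B"
abbreviation "AA \<equiv> closure core"
abbreviation "CC \<equiv> Z1_extension AA (tensor_id \<tau> \<tau>' C)"

text \<open>The pairs \<open>((z, \<A> z), \<C> z)\<close>. The component \<open>\<A> z\<close> makes the closure in the product topology the
  closure for the graph norm of \<open>\<A>\<close>. That this set is the graph of a function of \<open>z\<close> is proved below.\<close>

definition observation_graph :: "(('z \<times> 'z) \<times> 'w) set"
  where "observation_graph = closure {((x, y'), v). (x, y') \<in> AA \<and> (x, v) \<in> tensor_id \<tau> \<tau>' C}"

lemma P: "c0_semigroup P" and genP: "generator P = A"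
  using exp_op_semigroup[OF gen_A] by auto

lemma Q: "c0_semigroup Q" and genQ: "generator Q = B"
  using exp_op_semigroup[OF gen_B] by auto

lemma S: "c0_semigroup S" and genS: "generator S = AA"
  using c0_tensor_semigroup[OF \<tau> P Q] generator_tensor_semigroup[OF \<tau> P Q] by (simp_all add: genP genQ)

lemma exp_op_AA: "t \<ge> 0 \<Longrightarrow> exp_op AA t = S t"
  using exp_op_tensor_sum[OF \<tau> P Q] by (simp add: genP genQ)

lemma S_tensor: "t \<ge> 0 \<Longrightarrow> blinfun_apply (S t) (\<tau> x y) = \<tau> (blinfun_apply (P t) x) (blinfun_apply (Q t) y)"
  by (rule tensor_semigroup_tensor[OF \<tau> P Q])

lemma Q_contraction: "t \<ge> 0 \<Longrightarrow> norm (Q t) \<le> 1"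
  using nonpositive_semigroup_contraction[OF Q] B_nonpositive by (simp add: genQ)

lemma A_unique: "(x, y) \<in> A \<Longrightarrow> (x, y') \<in> A \<Longrightarrow> y = y'"
  using generator_single_valued[OF P] by (simp add: genP)

lemma A_invariant: "(x, y) \<in> A \<Longrightarrow> t \<ge> 0 \<Longrightarrow> (blinfun_apply (P t) x, blinfun_apply (P t) y) \<in> A"
  using generator_invariant[OF P] by (simp add: genP)

lemma AA_invariant: "(x, y) \<in> AA \<Longrightarrow> t \<ge> 0 \<Longrightarrow> (blinfun_apply (S t) x, blinfun_apply (S t) y) \<in> AA"
  using generator_invariant[OF S] by (simp add: genS)

lemma core_subset: "core \<subseteq> AA"
  by (rule closure_subset)

lemma core_dense: "closure (Domain core) = UNIV"
  using Domain_tensor_sum_dense[OF \<tau> P Q] by (simp add: genP genQ)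

lemma B_dense: "closure (Domain B) = UNIV"
  using generator_dense[OF Q] by (simp add: genQ)

lemma subspace_AA: "subspace AA"
  using subspace_generator[OF S] by (simp add: genS)

lemma subspace_core: "subspace core"
  by (simp add: tensor_sum_def)

lemma linear_op_C: "linear_op C" and Domain_C: "Domain C = Domain A"
  using C_bounded by (auto simp: bounded_on_Z1_def)

lemma C_apply: "(x, v) \<in> C \<Longrightarrow> C \<bullet>\<^sub>o x = v"
  by (rule op_apply_eq) (auto intro: linear_opD(4)[OF linear_op_C])

lemma A_apply: "(x, y) \<in> A \<Longrightarrow> A \<bullet>\<^sub>o x = y"
  by (rule op_apply_eq) (auto intro: A_unique)

lemma C_graph: "x \<in> Domain A \<Longrightarrow> (x, C \<bullet>\<^sub>o x) \<in> C"
  unfolding Domain_C[symmetric] using C_apply by blast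

lemma C_bound: "\<exists>K\<ge>0. \<forall>x y v. (x, y) \<in> A \<longrightarrow> (x, v) \<in> C \<longrightarrow> norm v \<le> K * norm (y - \<beta> *\<^sub>C x)"
proof -
  obtain K where K: "\<forall>x\<in>Domain A. norm (C \<bullet>\<^sub>o x) \<le> K * norm (A \<bullet>\<^sub>o x - \<beta> *\<^sub>C x)"
    using C_bounded by (auto simp: bounded_on_Z1_def)
  have "norm v \<le> \<bar>K\<bar> * norm (y - \<beta> *\<^sub>C x)" if "(x, y) \<in> A" "(x, v) \<in> C" for x y v
  proof -
    have "norm v \<le> K * norm (y - \<beta> *\<^sub>C x)"
      using K that by (metis A_apply C_apply Domain.intros)
    also have "\<dots> \<le> \<bar>K\<bar> * norm (y - \<beta> *\<^sub>C x)"
      by (intro mult_right_mono) auto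
    finally show ?thesis .
  qed
  then show ?thesis
    by (intro exI[of _ "\<bar>K\<bar>"]) simp
qed

lemma A_diff: "(x, y) \<in> A \<Longrightarrow> (x', y') \<in> A \<Longrightarrow> (x - x', y - y') \<in> A"
  using subspace_diff[OF subspace_generator[OF P], of "(x, y)" "(x', y')"] by (simp add: genP)

lemma C_diff: "(x, v) \<in> C \<Longrightarrow> (x', v') \<in> C \<Longrightarrow> (x - x', v - v') \<in> C"
  using linear_opD(2)[OF linear_op_C, of x v "(-1) *\<^sub>C x'" "(-1) *\<^sub>C v'"] linear_opD(3)[OF linear_op_C, of x' v' "-1"]
    scaleC_of_real[of "-1" x'] scaleC_of_real[of "-1" v'] by simp

lemma C_tendsto:
  assumes lim: "(a \<longlongrightarrow> a0) F" "(b \<longlongrightarrow> b0) F"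
    and A: "eventually (\<lambda>n. (a n, b n) \<in> A) F" "(a0, b0) \<in> A"
  shows "((\<lambda>n. C \<bullet>\<^sub>o a n) \<longlongrightarrow> C \<bullet>\<^sub>o a0) F"
proof -
  obtain K where K: "K \<ge> 0" "\<And>x y v. (x, y) \<in> A \<Longrightarrow> (x, v) \<in> C \<Longrightarrow> norm v \<le> K * norm (y - \<beta> *\<^sub>C x)"
    using C_bound by blast
  have "((\<lambda>n. C \<bullet>\<^sub>o a n - C \<bullet>\<^sub>o a0) \<longlongrightarrow> 0) F"
  proof (rule Lim_null_comparison)
    show "eventually (\<lambda>n. norm (C \<bullet>\<^sub>o a n - C \<bullet>\<^sub>o a0) \<le> K * norm ((b n - b0) - \<beta> *\<^sub>C (a n - a0))) F"
      using A(1)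
    proof eventually_elim
      case (elim n)
      then show ?case
        using A(2) by (intro K(2) A_diff C_diff C_graph) auto
    qed
    show "((\<lambda>n. K * norm ((b n - b0) - \<beta> *\<^sub>C (a n - a0))) \<longlongrightarrow> 0) F"
      using lim
      by (auto intro!: tendsto_eq_intros bounded_linear.tendsto[OF bounded_linear_scaleC])
  qed
  then show ?thesis
    by (simp add: LIM_zero_iff)
qed

lemma C_orbit_continuous:
  assumes "x \<in> Domain A"
  shows "continuous_on {0..T} (\<lambda>t. C \<bullet>\<^sub>o blinfun_apply (P t) x)"
  unfolding continuous_on_def
proof
  fix t assume t: "t \<in> {0..T}"
  obtain y where y: "(x, y) \<in> A"
    using assms by blast
  have cont: "((\<lambda>t. blinfun_apply (P t) u) \<longlongrightarrow> blinfun_apply (P t) u) (at t within {0..T})" for u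
    using semigroup_orbit_continuous[OF P, of 0 T u] t by (simp add: continuous_on_def)
  show "((\<lambda>t. C \<bullet>\<^sub>o blinfun_apply (P t) x) \<longlongrightarrow> C \<bullet>\<^sub>o blinfun_apply (P t) x) (at t within {0..T})"
  proof (rule C_tendsto[OF cont cont])
    show "eventually (\<lambda>t. (blinfun_apply (P t) x, blinfun_apply (P t) y) \<in> A) (at t within {0..T})"
      using y by (auto simp: eventually_at_filter intro!: always_eventually A_invariant)
    show "(blinfun_apply (P t) x, blinfun_apply (P t) y) \<in> A"
      using t y by (auto intro: A_invariant)
  qed
qed

lemma C_orbit_bound:
  assumes "T > 0"
  obtains K where "K \<ge> 0" "\<And>x. x \<in> Domain A \<Longrightarrow>
    integral {0..T} (\<lambda>t. (norm (C \<bullet>\<^sub>o blinfun_apply (P t) x))\<^sup>2) \<le> K * (norm x)\<^sup>2"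
proof -
  obtain K where K: "K > 0" "\<And>x. x \<in> Domain A \<Longrightarrow>
      (\<integral>\<^sup>+t\<in>{0..T}. ennreal ((norm (C \<bullet>\<^sub>o blinfun_apply (P t) x))\<^sup>2) \<partial>lborel) \<le> ennreal (K * (norm x)\<^sup>2)"
    using C_admissible assms unfolding admissible_def by blast
  show ?thesis
  proof (rule that)
    fix x assume x: "x \<in> Domain A"
    have cont: "continuous_on {0..T} (\<lambda>t. (norm (C \<bullet>\<^sub>o blinfun_apply (P t) x))\<^sup>2)"
      by (intro continuous_intros C_orbit_continuous x)
    show "integral {0..T} (\<lambda>t. (norm (C \<bullet>\<^sub>o blinfun_apply (P t) x))\<^sup>2) \<le> K * (norm x)\<^sup>2"
      using K(2)[OF x] K(1) unfolding nn_integral_continuous_Icc[OF cont zero_le_power2] by simp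
  qed (use K in simp)
qed

subsection \<open>Uniqueness of the observed value\<close>

lemma linear_vimage_span:
  assumes "linear h" "\<And>u. u \<in> X \<Longrightarrow> h u \<in> V" "subspace V" "u \<in> span X"
  shows "h u \<in> V"
  using span_minimal[of X "h -` V"] linear_subspace_vimage[OF assms(1,3)] assms by blast

text \<open>Contracting the second factor with \<open>f \<in> D(B)\<close> intertwines \<open>\<A>\<close> with \<open>A\<close>, up to a term that
  self-adjointness of \<open>B\<close> turns into the contraction with \<open>B f\<close>.\<close>

lemma contract_AA:
  assumes f: "(f, f') \<in> B" and zy: "(z, y) \<in> AA"
  shows "(blinfun_apply (contract \<tau> f) z, blinfun_apply (contract \<tau> f) y - blinfun_apply (contract \<tau> f') z) \<in> A"
proof -
  let ?h = "\<lambda>p. (blinfun_apply (contract \<tau> f) (fst p),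
      blinfun_apply (contract \<tau> f) (snd p) - blinfun_apply (contract \<tau> f') (fst p))"
  have clA: "closed A" and subA: "subspace A"
    using closed_generator[OF P] subspace_generator[OF P] by (simp_all add: genP)
  have "core \<subseteq> ?h -` A"
  proof
    fix p assume p: "p \<in> core"
    have "?h p \<in> A"
    proof (rule linear_vimage_span[OF _ _ subA p[unfolded tensor_sum_def]])
      show "linear ?h"
        by (auto intro!: linearI simp: blinfun.bilinear_simps scaleR_diff_right)
      fix u assume "u \<in> {(\<tau> x y, \<tau> x' y + \<tau> x y') |x x' y y'. (x, x') \<in> A \<and> (y, y') \<in> B}"
      then obtain x x' y y' where u: "u = (\<tau> x y, \<tau> x' y + \<tau> x y')" "(x, x') \<in> A" "(y, y') \<in> B"
        by blast
      have "(cinner y f *\<^sub>C x, cinner y f *\<^sub>C x') \<in> A"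
        using generator_scaleC[OF P, of x x'] u(2) by (simp add: genP)
      moreover have "cinner y' f = cinner y f'"
        by (rule selfadjoint_symmetric[OF B_selfadjoint u(3) f])
      ultimately show "?h u \<in> A"
        by (simp add: u(1) contract_tensor[OF \<tau>] blinfun.add_right)
    qed
    then show "p \<in> ?h -` A"
      by simp
  qed
  then have "AA \<subseteq> ?h -` A"
    by (intro closure_minimal closed_vimage clA continuous_intros) auto
  from subsetD[OF this zy] show ?thesis
    by simp
qed

lemma contract_C:
  assumes "(z, w) \<in> tensor_id \<tau> \<tau>' C"
  shows "(blinfun_apply (contract \<tau> f) z, blinfun_apply (contract \<tau>' f) w) \<in> C"
proof -
  let ?h = "\<lambda>p. (blinfun_apply (contract \<tau> f) (fst p), blinfun_apply (contract \<tau>' f) (snd p))"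
  have "?h (z, w) \<in> C"
  proof (rule linear_vimage_span[OF _ _ _ assms[unfolded tensor_id_def]])
    show "linear ?h"
      by (auto intro!: linearI simp: blinfun.bilinear_simps)
    show "subspace C"
      unfolding subspace_def using linear_opD[OF linear_op_C]
      by (auto simp: zero_prod_def scaleR_eq_scaleC)
    fix u assume "u \<in> {(\<tau> x y, \<tau>' v y) |x v y. (x, v) \<in> C}"
    then obtain x v y where "u = (\<tau> x y, \<tau>' v y)" "(x, v) \<in> C"
      by blast
    then show "?h u \<in> C"
      using linear_opD(3)[OF linear_op_C] by (simp add: contract_tensor[OF \<tau>] contract_tensor[OF \<tau>'])
  qed
  then show ?thesis
    by simp
qed

lemma subspace_observation_graph: "subspace observation_graph"
proof -
  have tid: "subspace (tensor_id \<tau> \<tau>' C)"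
    by (simp add: tensor_id_def)
  show ?thesis
    unfolding observation_graph_def
  proof (rule subspace_closure)
    show "subspace {((x, y'), v). (x, y') \<in> AA \<and> (x, v) \<in> tensor_id \<tau> \<tau>' C}"
      using subspace_0[OF subspace_AA] subspace_0[OF tid] subspace_add[OF subspace_AA] subspace_add[OF tid]
        subspace_scale[OF subspace_AA] subspace_scale[OF tid]
      unfolding subspace_def by (auto simp: zero_prod_def)
  qed
qed

lemma closed_observation_graph: "closed observation_graph"
  by (simp add: observation_graph_def)

lemma observation_graphD:
  assumes "((z, y), w) \<in> observation_graph"
  shows "(z, y) \<in> AA" "f \<in> Domain B \<Longrightarrow> (blinfun_apply (contract \<tau> f) z, blinfun_apply (contract \<tau>' f) w) \<in> C"
proof -
  obtain s where s: "\<And>n. s n \<in> {((x, y'), v). (x, y') \<in> AA \<and> (x, v) \<in> tensor_id \<tau> \<tau>' C}"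
      "s \<longlonglongrightarrow> ((z, y), w)"
    using assms unfolding observation_graph_def closure_sequential by blast
  define zn yn wn where "zn n = fst (fst (s n))" and "yn n = snd (fst (s n))" and "wn n = snd (s n)" for n
  have mem: "(zn n, yn n) \<in> AA" "(zn n, wn n) \<in> tensor_id \<tau> \<tau>' C" for n
    using s(1)[of n] by (auto simp: zn_def yn_def wn_def)
  have lim: "zn \<longlonglongrightarrow> z" "yn \<longlonglongrightarrow> y" "wn \<longlonglongrightarrow> w"
    unfolding zn_def yn_def wn_def using tendsto_fst[OF s(2)] tendsto_snd[OF s(2)]
    by (auto dest: tendsto_fst tendsto_snd)
  have "(\<lambda>n. (zn n, yn n)) \<longlonglongrightarrow> (z, y)"
    by (intro tendsto_Pair lim)
  with mem(1) have "(z, y) \<in> closure AA"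
    by (rule in_closureI)
  then show zy: "(z, y) \<in> AA"
    by simp
  assume "f \<in> Domain B"
  then obtain f' where f: "(f, f') \<in> B"
    by blast
  let ?a = "blinfun_apply (contract \<tau> f)"
  let ?b = "\<lambda>z y. blinfun_apply (contract \<tau> f) y - blinfun_apply (contract \<tau> f') z"
  have "(\<lambda>n. C \<bullet>\<^sub>o ?a (zn n)) \<longlonglongrightarrow> C \<bullet>\<^sub>o ?a z"
  proof (rule C_tendsto)
    show "(\<lambda>n. ?a (zn n)) \<longlonglongrightarrow> ?a z" "(\<lambda>n. ?b (zn n) (yn n)) \<longlonglongrightarrow> ?b z y"
      using lim by (auto intro!: tendsto_intros)
  qed (use contract_AA[OF f] mem(1) zy in auto)
  moreover have "C \<bullet>\<^sub>o ?a (zn n) = blinfun_apply (contract \<tau>' f) (wn n)" for n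
    by (rule C_apply[OF contract_C[OF mem(2)]])
  moreover have "(\<lambda>n. blinfun_apply (contract \<tau>' f) (wn n)) \<longlonglongrightarrow> blinfun_apply (contract \<tau>' f) w"
    using lim by (auto intro!: tendsto_intros)
  ultimately have "C \<bullet>\<^sub>o ?a z = blinfun_apply (contract \<tau>' f) w"
    using LIMSEQ_unique by simp
  moreover have "?a z \<in> Domain A"
    using contract_AA[OF f zy] by blast
  ultimately show "(?a z, blinfun_apply (contract \<tau>' f) w) \<in> C"
    using C_graph by metis
qed

lemma observation_graph_unique:
  assumes "((z, y), w) \<in> observation_graph" "((z, y'), w') \<in> observation_graph"
  shows "w = w'"
proof -
  have "w - w' = 0"
  proof (rule contract_eq_zero[OF \<tau>' B_dense])
    fix f assume f: "f \<in> Domain B"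
    show "blinfun_apply (contract \<tau>' f) (w - w') = 0"
      using linear_opD(4)[OF linear_op_C observation_graphD(2)[OF assms(1) f] observation_graphD(2)[OF assms(2) f]]
      by (simp add: blinfun.diff_right)
  qed
  then show ?thesis
    by simp
qed

lemma CC_apply:
  assumes "((z, y), w) \<in> observation_graph"
  shows "CC \<bullet>\<^sub>o z = w"
  using assms observation_graph_unique
  by (intro op_apply_eq) (auto simp: Z1_extension_def simp flip: observation_graph_def)

subsection \<open>Observation of orbits in the core\<close>

lemma core_form:
  assumes "z \<in> Domain core"
  obtains F x where "finite F" "F \<subseteq> Domain B" "orthonormal F" "\<And>e. e \<in> F \<Longrightarrow> x e \<in> Domain A"
    "z = (\<Sum>e\<in>F. \<tau> (x e) e)"
proof -
  let ?X = "{(\<tau> x y, \<tau> x' y + \<tau> x y') |x x' y y'. (x, x') \<in> A \<and> (y, y') \<in> B}"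
  let ?Y = "{(\<tau> x y, \<tau>' v y) |x v y. (x, v) \<in> C \<and> y \<in> Domain B}"
  have "fst ` ?X \<subseteq> fst ` ?Y"
  proof clarify
    fix x x' y y' assume "(x, x') \<in> A" "(y, y') \<in> B"
    then have "(\<tau> x y, \<tau>' (C \<bullet>\<^sub>o x) y) \<in> ?Y"
      using C_graph by blast
    then show "fst (\<tau> x y, \<tau> x' y + \<tau> x y') \<in> fst ` ?Y"
      by (metis (no_types, lifting) fst_conv image_eqI)
  qed
  then have "span (fst ` ?X) \<subseteq> span (fst ` ?Y)"
    by (rule span_mono)
  moreover have "z \<in> span (fst ` ?X)"
    using assms unfolding tensor_sum_def Domain_fst linear_span_image[OF bounded_linear.linear[OF bounded_linear_fst]] .
  ultimately have "z \<in> fst ` span ?Y"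
    unfolding linear_span_image[OF bounded_linear.linear[OF bounded_linear_fst]] by blast
  then obtain w where zw: "(z, w) \<in> span ?Y"
    by auto
  have "complex_subspace (Domain B)"
    unfolding complex_subspace_def Domain_fst
    using linear_subspace_image[OF bounded_linear.linear[OF bounded_linear_fst] subspace_generator[OF Q]]
      generator_scaleC[OF Q] by (force simp: genQ)
  from tensor_orthonormal_form[OF \<tau> \<tau>' linear_op_C this zw]
  obtain F x v where F: "finite F" "F \<subseteq> Domain B" "orthonormal F" "\<forall>e\<in>F. (x e, v e) \<in> C"
      "z = (\<Sum>e\<in>F. \<tau> (x e) e)"
    by blast
  show ?thesis
  proof (rule that[OF F(1,2,3) _ F(5)])
    show "x e \<in> Domain A" if "e \<in> F" for e
      unfolding Domain_C[symmetric] using F(4) that by blast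
  qed
qed

lemma observation_orbit:
  assumes F: "finite F" "F \<subseteq> Domain B" "\<And>e. e \<in> F \<Longrightarrow> x e \<in> Domain A"
    and z: "z = (\<Sum>e\<in>F. \<tau> (x e) e)" "(z, z') \<in> AA" and t: "t \<ge> 0"
  shows "((blinfun_apply (S t) z, blinfun_apply (S t) z'),
    \<Sum>e\<in>F. \<tau>' (C \<bullet>\<^sub>o blinfun_apply (P t) (x e)) (blinfun_apply (Q t) e)) \<in> observation_graph"
proof -
  have "(\<Sum>e\<in>F. (\<tau> (blinfun_apply (P t) (x e)) (blinfun_apply (Q t) e),
      \<tau>' (C \<bullet>\<^sub>o blinfun_apply (P t) (x e)) (blinfun_apply (Q t) e))) \<in> tensor_id \<tau> \<tau>' C"
    unfolding tensor_id_def
  proof (intro span_sum span_base)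
    fix e assume "e \<in> F"
    then have "(blinfun_apply (P t) (x e), C \<bullet>\<^sub>o blinfun_apply (P t) (x e)) \<in> C"
      using A_invariant t F(3) by (intro C_graph) blast
    then show "(\<tau> (blinfun_apply (P t) (x e)) (blinfun_apply (Q t) e),
      \<tau>' (C \<bullet>\<^sub>o blinfun_apply (P t) (x e)) (blinfun_apply (Q t) e)) \<in> {(\<tau> x y, \<tau>' v y) |x v y. (x, v) \<in> C}"
      by blast
  qed
  moreover have "(\<Sum>e\<in>F. (\<tau> (blinfun_apply (P t) (x e)) (blinfun_apply (Q t) e),
      \<tau>' (C \<bullet>\<^sub>o blinfun_apply (P t) (x e)) (blinfun_apply (Q t) e)))
      = (blinfun_apply (S t) z, \<Sum>e\<in>F. \<tau>' (C \<bullet>\<^sub>o blinfun_apply (P t) (x e)) (blinfun_apply (Q t) e))"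
    by (simp add: prod_eq_iff fst_sum snd_sum z(1) blinfun.sum_right S_tensor t)
  moreover have "(blinfun_apply (S t) z, blinfun_apply (S t) z') \<in> AA"
    using z(2) t by (rule AA_invariant)
  ultimately show ?thesis
    unfolding observation_graph_def using closure_subset by fastforce
qed

lemma core_observation_graph:
  assumes "(z, z') \<in> core" "t \<ge> 0"
  shows "((blinfun_apply (S t) z, blinfun_apply (S t) z'), CC \<bullet>\<^sub>o blinfun_apply (S t) z) \<in> observation_graph"
proof -
  obtain F x where F: "finite F" "F \<subseteq> Domain B" "orthonormal F" "\<And>e. e \<in> F \<Longrightarrow> x e \<in> Domain A"
      "z = (\<Sum>e\<in>F. \<tau> (x e) e)"
    using core_form assms(1) by blast
  have "(z, z') \<in> AA"
    using assms(1) core_subset by blast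
  note orbit = observation_orbit[OF F(1,2,4,5) this assms(2)]
  show ?thesis
    using orbit by (simp only: CC_apply[OF orbit])
qed

text \<open>On the core the admissibility estimate for \<open>C\<close> carries over to \<open>C \<otimes> I\<close>: the contraction
  \<open>I \<otimes> e\<^bsup>tB\<^esup>\<close> is dropped, and what remains splits along an orthonormal system.\<close>

lemma core_observation_bound:
  assumes T: "T > 0"
  obtains K where "K \<ge> 0" "\<And>z. z \<in> Domain core \<Longrightarrow> continuous_on {0..T} (\<lambda>t. CC \<bullet>\<^sub>o blinfun_apply (S t) z)"
    "\<And>z. z \<in> Domain core \<Longrightarrow> integral {0..T} (\<lambda>t. (norm (CC \<bullet>\<^sub>o blinfun_apply (S t) z))\<^sup>2) \<le> K * (norm z)\<^sup>2"
proof -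
  obtain K where K: "K \<ge> 0" "\<And>x. x \<in> Domain A \<Longrightarrow>
      integral {0..T} (\<lambda>t. (norm (C \<bullet>\<^sub>o blinfun_apply (P t) x))\<^sup>2) \<le> K * (norm x)\<^sup>2"
    using C_orbit_bound[OF T] by blast
  have "continuous_on {0..T} (\<lambda>t. CC \<bullet>\<^sub>o blinfun_apply (S t) z) \<and>
      integral {0..T} (\<lambda>t. (norm (CC \<bullet>\<^sub>o blinfun_apply (S t) z))\<^sup>2) \<le> K * (norm z)\<^sup>2"
    if zD: "z \<in> Domain core" for z
  proof -
    obtain F x where F: "finite F" "F \<subseteq> Domain B" "orthonormal F" "\<And>e. e \<in> F \<Longrightarrow> x e \<in> Domain A"
        and z: "z = (\<Sum>e\<in>F. \<tau> (x e) e)"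
      using core_form[OF zD] by blast
    obtain z' where z': "(z, z') \<in> AA"
      using zD core_subset by blast
    have eq: "CC \<bullet>\<^sub>o blinfun_apply (S t) z
        = (\<Sum>e\<in>F. \<tau>' (C \<bullet>\<^sub>o blinfun_apply (P t) (x e)) (blinfun_apply (Q t) e))" if "t \<in> {0..T}" for t
      using that by (intro CC_apply[OF observation_orbit[OF F(1,2,4) z z']]) auto
    have cont: "continuous_on {0..T} (\<lambda>t. CC \<bullet>\<^sub>o blinfun_apply (S t) z)"
    proof (subst continuous_on_cong[OF refl eq])
      show "continuous_on {0..T} (\<lambda>t. \<Sum>e\<in>F. \<tau>' (C \<bullet>\<^sub>o blinfun_apply (P t) (x e)) (blinfun_apply (Q t) e))"
        by (intro continuous_on_sum bounded_bilinear.continuous_on[OF bounded_bilinear_tensor[OF \<tau>']]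
            C_orbit_continuous F(4) semigroup_orbit_continuous[OF Q]) auto
    qed
    have "(norm (CC \<bullet>\<^sub>o blinfun_apply (S t) z))\<^sup>2 \<le> (\<Sum>e\<in>F. (norm (C \<bullet>\<^sub>o blinfun_apply (P t) (x e)))\<^sup>2)"
      if t: "t \<in> {0..T}" for t
    proof -
      let ?U = "tensor_right \<tau>' \<tau>' (Q t)" and ?s = "\<Sum>e\<in>F. \<tau>' (C \<bullet>\<^sub>o blinfun_apply (P t) (x e)) e"
      have t0: "t \<ge> 0"
        using t by simp
      note U = tensor_right[OF \<tau>' \<tau>' semigroup_scaleC[OF Q t0]]
      have "CC \<bullet>\<^sub>o blinfun_apply (S t) z = blinfun_apply ?U ?s"
        by (simp add: eq[OF t] U(1) blinfun.sum_right)
      then have "norm (CC \<bullet>\<^sub>o blinfun_apply (S t) z) \<le> norm ?U * norm ?s"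
        by (simp only: norm_blinfun)
      also have "\<dots> \<le> 1 * norm ?s"
        using order_trans[OF U(2) Q_contraction[OF t0]] by (intro mult_right_mono) auto
      finally have "(norm (CC \<bullet>\<^sub>o blinfun_apply (S t) z))\<^sup>2 \<le> (norm ?s)\<^sup>2"
        by (intro power_mono) auto
      also have "\<dots> = (\<Sum>e\<in>F. (norm (C \<bullet>\<^sub>o blinfun_apply (P t) (x e)))\<^sup>2)"
        by (rule norm_sum_tensor_orthonormal[OF \<tau>' F(1,3)])
      finally show ?thesis .
    qed
    then have "integral {0..T} (\<lambda>t. (norm (CC \<bullet>\<^sub>o blinfun_apply (S t) z))\<^sup>2)
        \<le> integral {0..T} (\<lambda>t. \<Sum>e\<in>F. (norm (C \<bullet>\<^sub>o blinfun_apply (P t) (x e)))\<^sup>2)"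
      using F(4) by (intro integral_le integrable_continuous_real continuous_intros cont C_orbit_continuous)
    also have "\<dots> = (\<Sum>e\<in>F. integral {0..T} (\<lambda>t. (norm (C \<bullet>\<^sub>o blinfun_apply (P t) (x e)))\<^sup>2))"
      using F(4) by (intro integral_sum F(1) integrable_continuous_real continuous_intros C_orbit_continuous)
    also have "\<dots> \<le> (\<Sum>e\<in>F. K * (norm (x e))\<^sup>2)"
      by (intro sum_mono K(2) F(4))
    also have "\<dots> = K * (norm z)\<^sup>2"
      unfolding z norm_sum_tensor_orthonormal[OF \<tau> F(1,3)] by (simp add: sum_distrib_left)
    finally show ?thesis
      using cont by simp
  qed
  then show ?thesis
    using that K(1) by blast
qed

subsection \<open>Boundedness in the graph norm\<close>

text \<open>Averaging along an orbit, with a weight \<open>\<phi>(s) = a - b s\<close>, turns \<open>C \<otimes> I\<close> into an operator that is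
  bounded on the whole space. On the core this is admissibility, and the average stays in the graph
  because the graph is a closed subspace; the general case follows by density. The second component
  below is the value of \<open>\<A>\<close> on the average, integrated by parts.\<close>

lemma averaged_observation:
  fixes a b :: real
  assumes ab: "\<And>s. s \<in> {0..1} \<Longrightarrow> \<bar>a - b * s\<bar> \<le> 1"
  obtains c where "c \<ge> 0" "\<And>q. \<exists>w.
    ((integral {0..1} (\<lambda>s. (a - b * s) *\<^sub>R blinfun_apply (S s) q),
      (a - b) *\<^sub>R blinfun_apply (S 1) q - a *\<^sub>R q + b *\<^sub>R integral {0..1} (\<lambda>s. blinfun_apply (S s) q)), w)
      \<in> observation_graph \<and> norm w \<le> c * norm q"
proof -
  obtain K where K: "K \<ge> 0" "\<And>z. z \<in> Domain core \<Longrightarrow> continuous_on {0..1} (\<lambda>t. CC \<bullet>\<^sub>o blinfun_apply (S t) z)"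
    "\<And>z. z \<in> Domain core \<Longrightarrow> integral {0..1} (\<lambda>t. (norm (CC \<bullet>\<^sub>o blinfun_apply (S t) z))\<^sup>2) \<le> K * (norm z)\<^sup>2"
    using core_observation_bound[of 1] by (metis zero_less_one)
  define I where "I q = integral {0..1} (\<lambda>s. (a - b * s) *\<^sub>R blinfun_apply (S s) q)" for q
  define L where "L q = (a - b) *\<^sub>R blinfun_apply (S 1) q - a *\<^sub>R q + b *\<^sub>R integral {0..1} (\<lambda>s. blinfun_apply (S s) q)" for q
  have contw: "continuous_on {0..1} (\<lambda>s. a - b * s)"
    by (intro continuous_intros)
  have blI: "bounded_linear I"
    unfolding I_def by (rule bounded_linear_semigroup_weighted_integral[OF S contw])
  have blL: "bounded_linear L"
    unfolding L_def
    by (intro bounded_linear_add bounded_linear_sub bounded_linear_const_scaleR bounded_linear_ident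
        blinfun.bounded_linear_right bounded_linear_semigroup_integral[OF S])
  note linI = bounded_linear.linear[OF blI] and linL = bounded_linear.linear[OF blL]
  have graph: "((I p, L p), integral {0..1} (\<lambda>s. (a - b * s) *\<^sub>R (CC \<bullet>\<^sub>o blinfun_apply (S s) p))) \<in> observation_graph"
    if p: "(p, p') \<in> core" for p p'
  proof -
    let ?f = "\<lambda>s. (a - b * s) *\<^sub>R ((blinfun_apply (S s) p, blinfun_apply (S s) p'), CC \<bullet>\<^sub>o blinfun_apply (S s) p)"
    have cont: "continuous_on {0..1} ?f"
      using p by (intro continuous_on_scaleR contw continuous_on_Pair semigroup_orbit_continuous[OF S] K(2)) auto
    note int = integrable_continuous_real[OF cont]
    have "integral {0..1} ?f \<in> observation_graph"
      using core_observation_graph[OF p] subspace_scale[OF subspace_observation_graph]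
      by (intro integral_in_closed_subspace subspace_observation_graph closed_observation_graph cont) auto
    moreover have "integral {0..1} ?f = ((integral {0..1} (\<lambda>s. (a - b * s) *\<^sub>R blinfun_apply (S s) p),
        integral {0..1} (\<lambda>s. (a - b * s) *\<^sub>R blinfun_apply (S s) p')),
        integral {0..1} (\<lambda>s. (a - b * s) *\<^sub>R (CC \<bullet>\<^sub>o blinfun_apply (S s) p)))"
      using integral_linear[OF int bounded_linear_compose[OF bounded_linear_fst bounded_linear_fst]]
        integral_linear[OF int bounded_linear_compose[OF bounded_linear_snd bounded_linear_fst]]
        integral_linear[OF int bounded_linear_snd]
      by (simp add: o_def prod_eq_iff)
    moreover have "integral {0..1} (\<lambda>s. (a - b * s) *\<^sub>R blinfun_apply (S s) p') = L p"
      unfolding L_def using p core_subset by (intro generator_integral_by_parts[OF S]) (auto simp: genS)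
    ultimately show ?thesis
      by (simp add: I_def)
  qed
  define c where "c = (1 + K) / 2"
  have bd: "norm w \<le> c * norm p" if p: "p \<in> Domain core" and w: "((I p, L p), w) \<in> observation_graph" for p w
  proof (cases "p = 0")
    case True
    then have "((0, 0), w) \<in> observation_graph"
      using w by (simp add: linear_0[OF linI] linear_0[OF linL])
    moreover have "((0, 0), 0) \<in> observation_graph"
      using subspace_0[OF subspace_observation_graph] by (simp add: zero_prod_def)
    ultimately show ?thesis
      using True observation_graph_unique by force
  next
    case False
    let ?g = "\<lambda>s. CC \<bullet>\<^sub>o blinfun_apply (S s) p"
    have "w = integral {0..1} (\<lambda>s. (a - b * s) *\<^sub>R ?g s)"
      using observation_graph_unique[OF w] graph p by blast
    also have "norm \<dots> \<le> integral {0..1} (\<lambda>s. norm p / 2 + (norm (?g s))\<^sup>2 / (2 * norm p))"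
    proof (rule integral_norm_bound_integral)
      show "(\<lambda>s. (a - b * s) *\<^sub>R ?g s) integrable_on {0..1}"
        by (intro integrable_continuous_real continuous_on_scaleR contw K(2) p)
      show "(\<lambda>s. norm p / 2 + (norm (?g s))\<^sup>2 / (2 * norm p)) integrable_on {0..1}"
        using False by (intro integrable_continuous_real continuous_intros K(2) p) auto
      fix s :: real assume s: "s \<in> {0..1}"
      have "norm ((a - b * s) *\<^sub>R ?g s) \<le> 1 * norm (?g s)"
        unfolding norm_scaleR by (intro mult_right_mono ab s) auto
      \<comment> \<open>Admissibility bounds the integral of the squared norm by \<open>K \<parallel>p\<parallel>\<^sup>2\<close>; division by \<open>\<parallel>p\<parallel>\<close> turns this
        into a bound that is linear in \<open>\<parallel>p\<parallel>\<close>.\<close>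
      also have "2 * norm p * norm (?g s) \<le> (norm p)\<^sup>2 + (norm (?g s))\<^sup>2"
        by (rule sum_squares_bound)
      then have "1 * norm (?g s) \<le> norm p / 2 + (norm (?g s))\<^sup>2 / (2 * norm p)"
        using False by (simp add: field_simps power2_eq_square)
      finally show "norm ((a - b * s) *\<^sub>R ?g s) \<le> norm p / 2 + (norm (?g s))\<^sup>2 / (2 * norm p)" .
    qed
    also have "\<dots> = norm p / 2 + integral {0..1} (\<lambda>s. (norm (?g s))\<^sup>2) / (2 * norm p)"
      using False by (subst integral_add) (auto intro!: integrable_continuous_real continuous_intros K(2) p)
    also have "\<dots> \<le> norm p / 2 + K * (norm p)\<^sup>2 / (2 * norm p)"
      by (intro add_left_mono divide_right_mono K(3) p) auto
    also have "\<dots> = c * norm p"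
      using False by (simp add: c_def field_simps power2_eq_square)
    finally show ?thesis .
  qed
  let ?R = "{(p, w). p \<in> Domain core \<and> ((I p, L p), w) \<in> observation_graph}"
  have subD: "subspace (Domain core)"
    using linear_subspace_image[OF bounded_linear.linear[OF bounded_linear_fst] subspace_core]
    by (simp add: Domain_fst)
  have subR: "subspace ?R"
    unfolding subspace_def
  proof (intro conjI ballI allI)
    note G = subspace_observation_graph
    show "0 \<in> ?R"
      using subspace_0[OF subD] subspace_0[OF G] by (simp add: zero_prod_def linear_0[OF linI] linear_0[OF linL])
    show "u + u' \<in> ?R" if "u \<in> ?R" "u' \<in> ?R" for u u'
      using that subspace_add[OF subD, of "fst u" "fst u'"]
        subspace_add[OF G, of "((I (fst u), L (fst u)), snd u)" "((I (fst u'), L (fst u')), snd u')"]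
      by (cases u; cases u') (simp add: linear_add[OF linI] linear_add[OF linL])
    show "r *\<^sub>R u \<in> ?R" if "u \<in> ?R" for r u
      using that subspace_scale[OF subD, of "fst u" r]
        subspace_scale[OF G, of "((I (fst u), L (fst u)), snd u)" r]
      by (cases u) (simp add: linear_cmul[OF linI] linear_cmul[OF linL])
  qed
  have "Domain ?R = Domain core"
    using graph by auto
  then have denseR: "closure (Domain ?R) = UNIV"
    using core_dense by simp
  have c0: "c \<ge> 0"
    using K(1) by (simp add: c_def)
  obtain F where F: "\<And>p w. (p, w) \<in> ?R \<Longrightarrow> blinfun_apply F p = w" "norm F \<le> c"
    by (rule bounded_relation_extension[OF subR _ denseR c0]) (use bd in auto)
  have all: "((I q, L q), blinfun_apply F q) \<in> observation_graph" for q
  proof -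
    let ?V = "(\<lambda>q. ((I q, L q), blinfun_apply F q)) -` observation_graph"
    have "closed ?V"
      by (intro closed_vimage closed_observation_graph continuous_intros
          bounded_linear.continuous_on[OF blI] bounded_linear.continuous_on[OF blL])
    moreover have "Domain core \<subseteq> ?V"
      using graph F(1) by (force simp: Domain_iff)
    ultimately have "closure (Domain core) \<subseteq> ?V"
      by (simp add: closure_minimal)
    then show ?thesis
      using core_dense by blast
  qed
  have "norm (blinfun_apply F q) \<le> c * norm q" for q
    using norm_blinfun[of F q] mult_right_mono[OF F(2) norm_ge_zero] by (rule order_trans)
  with all show ?thesis
    using that[OF c0] unfolding I_def L_def by blast
qed

text \<open>In particular \<open>\<C>\<close> is defined on the whole domain of \<open>\<A>\<close>, so that the observation of an orbit
  in that domain makes sense at every time and not only almost everywhere.\<close>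

lemma CC_bounded:
  obtains c where "c \<ge> 0" "\<And>z z'. (z, z') \<in> AA \<Longrightarrow> ((z, z'), CC \<bullet>\<^sub>o z) \<in> observation_graph"
    "\<And>z z'. (z, z') \<in> AA \<Longrightarrow> norm (CC \<bullet>\<^sub>o z) \<le> c * (norm z + norm z')"
proof -
  let ?I = "\<lambda>q. integral {0..1} (\<lambda>s. blinfun_apply (S s) q)"
  let ?J = "\<lambda>q. integral {0..1} (\<lambda>s. (1 - s) *\<^sub>R blinfun_apply (S s) q)"
  obtain c1 where c1: "c1 \<ge> 0" "\<And>q. \<exists>w. ((?I q, blinfun_apply (S 1) q - q), w) \<in> observation_graph \<and> norm w \<le> c1 * norm q"
    using averaged_observation[of 1 0] by auto
  obtain c2 where c2: "c2 \<ge> 0" "\<And>q. \<exists>w. ((?J q, ?I q - q), w) \<in> observation_graph \<and> norm w \<le> c2 * norm q"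
    using averaged_observation[of 1 1] by (auto simp: algebra_simps)
  have "((z, z'), CC \<bullet>\<^sub>o z) \<in> observation_graph \<and> norm (CC \<bullet>\<^sub>o z) \<le> (c1 + c2) * (norm z + norm z')"
    if z: "(z, z') \<in> AA" for z z'
  proof -
    obtain w1 where w1: "((?I z, blinfun_apply (S 1) z - z), w1) \<in> observation_graph" "norm w1 \<le> c1 * norm z"
      using c1(2) by blast
    obtain w2 where w2: "((?J z', ?I z' - z'), w2) \<in> observation_graph" "norm w2 \<le> c2 * norm z'"
      using c2(2) by blast
    have zS: "(z, z') \<in> generator S"
      using z by (simp add: genS)
    have "?J z' = ?I z - z"
      using generator_integral_by_parts[OF S zS, of 1 1] by simp
    moreover have "?I z' = blinfun_apply (S 1) z - z"
      using zS unfolding generator_iff[OF S] by simp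
    ultimately have G: "((z, z'), w1 - w2) \<in> observation_graph"
      using subspace_diff[OF subspace_observation_graph w1(1) w2(1)] by simp
    have "norm (w1 - w2) \<le> c1 * norm z + c2 * norm z'"
      using w1(2) w2(2) norm_triangle_ineq4[of w1 w2] by simp
    also have "\<dots> \<le> (c1 + c2) * (norm z + norm z')"
      using c1(1) c2(1) by (simp add: algebra_simps)
    finally show ?thesis
      using G CC_apply[OF G] by simp
  qed
  then show ?thesis
    using that[of "c1 + c2"] c1(1) c2(1) by auto
qed

end


section \<open>Controls with values in a tensor product\<close>

lemma tensor_right_selfadjoint:
  assumes \<tau>: "hilbert_tensor \<tau>" and N: "\<And>c y. blinfun_apply N (c *\<^sub>C y) = c *\<^sub>C blinfun_apply N y"
    and sa: "\<And>y y'. cinner (blinfun_apply N y) y' = cinner y (blinfun_apply N y')"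
  shows "cinner (blinfun_apply (tensor_right \<tau> \<tau> N) a) b = cinner a (blinfun_apply (tensor_right \<tau> \<tau> N) b)"
proof -
  let ?U = "tensor_right \<tau> \<tau> N"
  note U = tensor_right(1)[OF \<tau> \<tau> N] and eqI = blinfun_eq_on_dense_span[OF tensor_total[OF \<tau>]]
  have 1: "cinner (blinfun_apply ?U a) (\<tau> x y) = cinner a (blinfun_apply ?U (\<tau> x y))" for a x y
  proof -
    have "cinner_dual (\<tau> x y) o\<^sub>L ?U = cinner_dual (blinfun_apply ?U (\<tau> x y))"
      by (rule eqI) (auto simp: U cinner_tensor[OF \<tau>] sa)
    from arg_cong[OF this, of "\<lambda>F. blinfun_apply F a"] show ?thesis
      by simp
  qed
  have "cinner_dual (blinfun_apply ?U b) = cinner_dual b o\<^sub>L ?U"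
  proof (rule eqI)
    fix u assume "u \<in> {\<tau> x y |x y. True}"
    then obtain x y where u: "u = \<tau> x y"
      by blast
    show "blinfun_apply (cinner_dual (blinfun_apply ?U b)) u = blinfun_apply (cinner_dual b o\<^sub>L ?U) u"
      using 1[of b x y] cinner_commute[of u "blinfun_apply ?U b"] cinner_commute[of "blinfun_apply ?U u" b]
      by (simp add: u)
  qed
  from arg_cong[OF this, of "\<lambda>F. blinfun_apply F a"] show ?thesis
    by simp
qed

text \<open>Square summable coefficients with respect to an orthonormal sequence define an element of the
  tensor product, from which they can be recovered.\<close>

lemma tensor_series:
  fixes \<tau> :: "'v::chilbert_space \<Rightarrow> 'y::chilbert_space \<Rightarrow> 'w::chilbert_space"
  assumes \<tau>: "hilbert_tensor \<tau>" and f: "orthonormal_seq f" and v: "summable (\<lambda>j. (norm (v j))\<^sup>2)"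
  shows "summable (\<lambda>j. \<tau> (v j) (f j))" "(norm (\<Sum>j. \<tau> (v j) (f j)))\<^sup>2 \<le> (\<Sum>j. (norm (v j))\<^sup>2)"
proof -
  have le: "(norm (\<tau> (v j) (f j)))\<^sup>2 \<le> (norm (v j))\<^sup>2" for j
  proof -
    have "norm (v j) * norm (f j) \<le> norm (v j)"
      using orthonormal_seqD(2)[OF f, of j] by (simp add: mult_left_le)
    then show ?thesis
      unfolding norm_tensor[OF \<tau>] by (intro power_mono) auto
  qed
  have sm: "summable (\<lambda>j. (norm (\<tau> (v j) (f j)))\<^sup>2)"
    by (rule summable_comparison_test'[OF v, of 0]) (use le in simp)
  have orth: "cinner (\<tau> (v i) (f i)) (\<tau> (v j) (f j)) = 0" if "i \<noteq> j" for i j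
    using orthonormal_seqD(1)[OF f that] by (simp add: cinner_tensor[OF \<tau>])
  show "summable (\<lambda>j. \<tau> (v j) (f j))"
    by (rule orthogonal_series(1)[of "\<lambda>j. \<tau> (v j) (f j)", OF orth sm])
  have "(norm (\<Sum>j. \<tau> (v j) (f j)))\<^sup>2 = (\<Sum>j. (norm (\<tau> (v j) (f j)))\<^sup>2)"
    by (rule orthogonal_series(2)[of "\<lambda>j. \<tau> (v j) (f j)", OF orth sm])
  also have "\<dots> \<le> (\<Sum>j. (norm (v j))\<^sup>2)"
    by (intro suminf_le le sm v)
  finally show "(norm (\<Sum>j. \<tau> (v j) (f j)))\<^sup>2 \<le> (\<Sum>j. (norm (v j))\<^sup>2)" .
qed

lemma tensor_series_coeff:
  fixes \<tau> :: "'v::chilbert_space \<Rightarrow> 'y::chilbert_space \<Rightarrow> 'w::chilbert_space"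
  assumes \<tau>: "hilbert_tensor \<tau>" and f: "orthonormal_seq f" and v: "summable (\<lambda>j. (norm (v j))\<^sup>2)"
    and j: "f j \<noteq> 0"
  shows "cinner (\<tau> a (f j)) (\<Sum>i. \<tau> (v i) (f i)) = cinner a (v j)"
proof -
  have "cinner (\<tau> a (f j)) (\<Sum>i. \<tau> (v i) (f i)) = (\<Sum>i. cinner (\<tau> a (f j)) (\<tau> (v i) (f i)))"
    by (rule bounded_linear.suminf[OF bounded_bilinear.bounded_linear_right[OF bounded_bilinear_cinner]
        tensor_series(1)[OF \<tau> f v]])
  also have "(\<lambda>i. cinner (\<tau> a (f j)) (\<tau> (v i) (f i))) = (\<lambda>i. if i = j then cinner a (v j) else 0)"
    using orthonormal_seqD(1)[OF f, of j] orthonormal_seqD(3)[OF f j] by (auto simp: cinner_tensor[OF \<tau>])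
  also have "(\<Sum>i. if i = j then cinner a (v j) else 0) = cinner a (v j)"
    using suminf_finite[of "{j}" "\<lambda>i. if i = j then cinner a (v j) else 0"] by simp
  finally show ?thesis .
qed

text \<open>The coefficients \<open>x \<mapsto> \<zeta> (x \<otimes> f\<^sub>j)\<close> of a functional on the tensor product are square summable.\<close>

lemma dual_coefficients_bound:
  fixes \<tau> :: "'x::{chilbert_space,second_countable_topology} \<Rightarrow> 'y::chilbert_space \<Rightarrow> 'z::chilbert_space"
  assumes \<tau>: "hilbert_tensor \<tau>" and f: "orthonormal_seq f" and \<xi>: "\<And>j. \<xi> j \<in> cdual"
    "\<And>j x. blinfun_apply (\<xi> j) x = blinfun_apply \<zeta> (\<tau> x (f j))"
  shows "(\<Sum>j<n. (norm (\<xi> j))\<^sup>2) \<le> (norm \<zeta>)\<^sup>2"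
proof (rule le_square_of_le_mult_sqrt)
  obtain b :: "nat \<Rightarrow> 'x" where b: "orthonormal_seq b" "closure (span {c *\<^sub>C b i |c i. True}) = UNIV"
    using orthonormal_basis_exists by blast
  define r where "r j = (\<Sum>i. cnj (blinfun_apply (\<xi> j) (b i)) *\<^sub>C b i)" for j
  have r: "\<xi> j = cinner_dual (r j)" for j
    unfolding r_def by (rule riesz_exists(2)[OF b \<xi>(1)])
  have "of_real (\<Sum>j<n. (norm (\<xi> j))\<^sup>2) = blinfun_apply \<zeta> (\<Sum>j<n. \<tau> (r j) (f j))"
    unfolding blinfun.sum_right \<xi>(2)[symmetric] of_real_sum by (simp add: r norm_cinner_dual cinner_self)
  from arg_cong[OF this, of norm] have "\<bar>\<Sum>j<n. (norm (\<xi> j))\<^sup>2\<bar> = norm (blinfun_apply \<zeta> (\<Sum>j<n. \<tau> (r j) (f j)))"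
    by (simp only: norm_of_real)
  then have "(\<Sum>j<n. (norm (\<xi> j))\<^sup>2) \<le> norm \<zeta> * norm (\<Sum>j<n. \<tau> (r j) (f j))"
    using norm_blinfun[of \<zeta> "\<Sum>j<n. \<tau> (r j) (f j)"] by (simp add: sum_nonneg)
  moreover have "norm (\<Sum>j<n. \<tau> (r j) (f j)) \<le> sqrt (\<Sum>j<n. (norm (\<xi> j))\<^sup>2)"
  proof (rule real_le_rsqrt)
    have "(norm (\<Sum>j<n. \<tau> (r j) (f j)))\<^sup>2 = (\<Sum>j<n. (norm (\<tau> (r j) (f j)))\<^sup>2)"
      using orthonormal_seqD(1)[OF f] by (intro norm_sum_orthogonal) (auto simp: cinner_tensor[OF \<tau>])
    also have "\<dots> \<le> (\<Sum>j<n. (norm (\<xi> j))\<^sup>2)"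
    proof (intro sum_mono power_mono)
      show "norm (\<tau> (r j) (f j)) \<le> norm (\<xi> j)" for j
        using orthonormal_seqD(2)[OF f, of j] by (simp add: norm_tensor[OF \<tau>] r norm_cinner_dual mult_left_le)
    qed auto
    finally show "(norm (\<Sum>j<n. \<tau> (r j) (f j)))\<^sup>2 \<le> (\<Sum>j<n. (norm (\<xi> j))\<^sup>2)" .
  qed
  ultimately show "(\<Sum>j<n. (norm (\<xi> j))\<^sup>2) \<le> norm \<zeta> * sqrt (\<Sum>j<n. (norm (\<xi> j))\<^sup>2)"
    by (meson mult_left_mono norm_ge_zero order_trans)
qed (simp_all add: sum_nonneg)

lemma borel_measurable_bounded_bilinear:
  fixes h :: "'a::{real_normed_vector,second_countable_topology} \<Rightarrow> 'b::{real_normed_vector,second_countable_topology}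
    \<Rightarrow> 'c::real_normed_vector"
  assumes "bounded_bilinear h" "f \<in> borel_measurable M" "g \<in> borel_measurable M"
  shows "(\<lambda>s. h (f s) (g s)) \<in> borel_measurable M"
  by (rule borel_measurable_continuous_Pair[OF assms(2,3)])
    (intro bounded_bilinear.continuous_on[OF assms(1)] continuous_intros)

lemma borel_measurable_riesz:
  fixes u :: "real \<Rightarrow> 'v::{chilbert_space,second_countable_topology} \<Rightarrow>\<^sub>L complex"
  assumes u: "u \<in> borel_measurable lborel" "\<And>s. u s \<in> cdual"
  obtains g where "g \<in> borel_measurable lborel" "\<And>s. u s = cinner_dual (g s)"
proof -
  obtain b :: "nat \<Rightarrow> 'v" where b: "orthonormal_seq b" "closure (span {c *\<^sub>C b i |c i. True}) = UNIV"
    using orthonormal_basis_exists by blast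
  define g where "g s = (\<Sum>i. cnj (blinfun_apply (u s) (b i)) *\<^sub>C b i)" for s
  have "g \<in> borel_measurable lborel"
    unfolding g_def
  proof (intro borel_measurable_suminf borel_measurable_continuous_on[OF _ u(1)])
    fix i
    have "continuous_on UNIV (\<lambda>c. c *\<^sub>C b i)"
      using linear_continuous_on[OF bounded_linear_intro[of "\<lambda>c. c *\<^sub>C b i" "norm (b i)"]]
      by (simp add: scaleC_add_left scaleR_eq_scaleC scaleC_scaleC scaleC_complex_def norm_scaleC)
    then show "continuous_on UNIV (\<lambda>F. cnj (blinfun_apply F (b i)) *\<^sub>C b i)"
      by (rule continuous_on_compose2) (auto intro!: continuous_intros)
  qed
  then show ?thesis
    using that riesz_exists(2)[OF b u(2)] unfolding g_def by blast
qed

lemma borel_measurable_tensor_series: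
  fixes \<tau> :: "'v::{chilbert_space,second_countable_topology} \<Rightarrow> 'y::{chilbert_space,second_countable_topology}
    \<Rightarrow> 'w::{chilbert_space,second_countable_topology}"
  assumes \<tau>: "hilbert_tensor \<tau>" and N: "N \<in> sets lborel"
    and g: "\<And>j. g j \<in> borel_measurable lborel" and h: "\<And>j. h j \<in> borel_measurable lborel"
  shows "(\<lambda>s. if s \<in> N then \<Sum>j. \<tau> (g j s) (h j s) else 0) \<in> borel_measurable lborel"
  using N by (intro measurable_If_set borel_measurable_suminf
      borel_measurable_bounded_bilinear[OF bounded_bilinear_tensor[OF \<tau>]] g h) auto

lemma integrable_norm_of_square:
  fixes k :: "real \<Rightarrow> 'w::{real_normed_vector,second_countable_topology}"
  assumes k: "k \<in> borel_measurable lborel" "\<And>s. s \<notin> {0..T} \<Longrightarrow> k s = 0"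
    and fin: "(\<integral>\<^sup>+s. ennreal ((norm (k s))\<^sup>2) \<partial>lborel) < \<infinity>"
  shows "integrable lborel (\<lambda>s. norm (k s))"
proof (rule integrableI_bounded)
  show "(\<lambda>s. norm (k s)) \<in> borel_measurable lborel"
    using k(1) by measurable
  have "(\<integral>\<^sup>+s. ennreal (norm (norm (k s))) \<partial>lborel)
      \<le> (\<integral>\<^sup>+s. indicator {0..T} s + ennreal ((norm (k s))\<^sup>2) \<partial>lborel)"
  proof (intro nn_integral_mono)
    fix s
    have "norm (k s) \<le> 1 + (norm (k s))\<^sup>2"
      using sum_squares_bound[of 1 "norm (k s)"] norm_ge_zero[of "k s"] unfolding one_power2 by linarith
    then have "ennreal (norm (k s)) \<le> 1 + ennreal ((norm (k s))\<^sup>2)"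
      by (metis ennreal_1 ennreal_leI ennreal_plus zero_le_one zero_le_power2)
    then show "ennreal (norm (norm (k s))) \<le> indicator {0..T} s + ennreal ((norm (k s))\<^sup>2)"
      using k(2)[of s] by (auto split: split_indicator)
  qed
  also have "\<dots> = (\<integral>\<^sup>+s. indicator {0..T} s \<partial>lborel) + (\<integral>\<^sup>+s. ennreal ((norm (k s))\<^sup>2) \<partial>lborel)"
    using k(1) by (intro nn_integral_add) auto
  also have "\<dots> < \<infinity>"
    using fin by (simp add: emeasure_lborel_Icc_eq)
  finally show "(\<integral>\<^sup>+s. ennreal (norm (norm (k s))) \<partial>lborel) < \<infinity>" .
qed

text \<open>If the squared \<open>L\<^sup>2\<close> norms of the functions \<open>g\<^sub>j\<close> on \<open>[0, T]\<close> are summable, then the values \<open>g\<^sub>j(s)\<close> are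
  square summable for almost every \<open>s\<close>.\<close>

lemma AE_summable_squares:
  fixes g :: "nat \<Rightarrow> real \<Rightarrow> 'v::{real_normed_vector,second_countable_topology}"
  assumes g: "\<And>j. g j \<in> borel_measurable lborel"
    and bd: "\<And>n. (\<Sum>j<n. \<integral>\<^sup>+s\<in>{0..T}. ennreal ((norm (g j s))\<^sup>2) \<partial>lborel) \<le> ennreal K"
  defines "N \<equiv> {s\<in>{0..T}. summable (\<lambda>j. (norm (g j s))\<^sup>2)}"
  shows "N \<in> sets lborel" "AE s in lborel. s \<in> {0..T} \<longrightarrow> s \<in> N"
    "(\<integral>\<^sup>+s. (if s \<in> N then ennreal (\<Sum>j. (norm (g j s))\<^sup>2) else 0) \<partial>lborel) \<le> ennreal K"
proof -
  let ?\<Sigma> = "\<lambda>s. \<Sum>j. ennreal ((norm (g j s))\<^sup>2) * indicator {0..T} s"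
  have meas: "(\<lambda>s. ennreal ((norm (g j s))\<^sup>2) * indicator {0..T} s) \<in> borel_measurable lborel" for j
    using g[of j] by measurable
  have N: "s \<in> N \<longleftrightarrow> s \<in> {0..T} \<and> ?\<Sigma> s \<noteq> top" for s
  proof (cases "s \<in> {0..T}")
    case True
    then have "?\<Sigma> s = (\<Sum>j. ennreal ((norm (g j s))\<^sup>2))"
      by simp
    moreover have "summable (\<lambda>j. (norm (g j s))\<^sup>2) \<longleftrightarrow> (\<Sum>j. ennreal ((norm (g j s))\<^sup>2)) \<noteq> top"
      using summable_iff_suminf_neq_top[of "\<lambda>j. (norm (g j s))\<^sup>2"] suminf_ennreal2[of "\<lambda>j. (norm (g j s))\<^sup>2"]
      by (metis ennreal_neq_top zero_le_power2)
    ultimately show ?thesis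
      using True by (simp only: N_def mem_Collect_eq)
  next
    case False
    then show ?thesis
      by (simp only: N_def mem_Collect_eq simp_thms)
  qed
  have "N = {s\<in>space lborel. s \<in> {0..T} \<and> ?\<Sigma> s \<noteq> top}"
    using N by auto
  moreover have "{s\<in>space lborel. s \<in> {0..T} \<and> ?\<Sigma> s \<noteq> top} \<in> sets lborel"
    using meas by measurable
  ultimately show "N \<in> sets lborel"
    by simp
  have "(\<integral>\<^sup>+s. ?\<Sigma> s \<partial>lborel) = (\<Sum>j. \<integral>\<^sup>+s\<in>{0..T}. ennreal ((norm (g j s))\<^sup>2) \<partial>lborel)"
    by (rule nn_integral_suminf[OF meas])
  also have "\<dots> \<le> ennreal K"
    by (rule suminf_le_const[OF _ bd]) simp
  finally have le: "(\<integral>\<^sup>+s. ?\<Sigma> s \<partial>lborel) \<le> ennreal K" .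
  have "?\<Sigma> \<in> borel_measurable lborel"
    by (rule borel_measurable_suminf_order) (rule meas)
  moreover have "(\<integral>\<^sup>+s. ?\<Sigma> s \<partial>lborel) \<noteq> \<infinity>"
    using neq_top_trans[OF ennreal_neq_top le] by simp
  ultimately have "AE s in lborel. ?\<Sigma> s \<noteq> \<infinity>"
    by (rule nn_integral_noteq_infinite)
  then show "AE s in lborel. s \<in> {0..T} \<longrightarrow> s \<in> N"
    unfolding infinity_ennreal_def by eventually_elim (blast intro: iffD2[OF N])
  have "(\<integral>\<^sup>+s. (if s \<in> N then ennreal (\<Sum>j. (norm (g j s))\<^sup>2) else 0) \<partial>lborel) \<le> (\<integral>\<^sup>+s. ?\<Sigma> s \<partial>lborel)"
  proof (intro nn_integral_mono)
    fix s
    show "(if s \<in> N then ennreal (\<Sum>j. (norm (g j s))\<^sup>2) else 0) \<le> ?\<Sigma> s"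
    proof (cases "s \<in> N")
      case True
      then have "s \<in> {0..T}" and sm: "summable (\<lambda>j. (norm (g j s))\<^sup>2)"
        unfolding N_def by blast+
      then have "?\<Sigma> s = (\<Sum>j. ennreal ((norm (g j s))\<^sup>2))"
        by simp
      also have "\<dots> = ennreal (\<Sum>j. (norm (g j s))\<^sup>2)"
        by (rule suminf_ennreal2[OF zero_le_power2 sm])
      finally show ?thesis
        using True by (simp only: if_True order_refl)
    next
      case False
      then show ?thesis
        by (simp only: if_False zero_le)
    qed
  qed
  with le show "(\<integral>\<^sup>+s. (if s \<in> N then ennreal (\<Sum>j. (norm (g j s))\<^sup>2) else 0) \<partial>lborel) \<le> ennreal K"
    by (rule order_trans[rotated])
qed


section \<open>Transfer of null-controllability\<close>

context tensor_observation
begin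

lemma control_state_AA:
  assumes "T > 0"
  shows "control_state AA CC u \<zeta> T z = blinfun_apply \<zeta> (blinfun_apply (S T) z)
    + (LBINT s:{0..T}. blinfun_apply (u s) (CC \<bullet>\<^sub>o (blinfun_apply (S (T - s)) z)))"
proof -
  have "(LBINT s:{0..T}. blinfun_apply (u s) (CC \<bullet>\<^sub>o (blinfun_apply (exp_op AA (T - s)) z)))
      = (LBINT s:{0..T}. blinfun_apply (u s) (CC \<bullet>\<^sub>o (blinfun_apply (S (T - s)) z)))"
    by (rule set_lebesgue_integral_cong) (simp_all add: exp_op_AA)
  then show ?thesis
    using assms by (simp add: control_state_def exp_op_AA)
qed

text \<open>Since \<open>\<C>\<close> is bounded in the graph norm of \<open>\<A>\<close>, it suffices to steer to zero on the core.\<close>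

lemma control_state_extend:
  assumes T: "T > 0" and k: "k \<in> borel_measurable lborel" "\<And>s. s \<notin> {0..T} \<Longrightarrow> k s = 0"
    and fin: "(\<integral>\<^sup>+s. ennreal ((norm (k s))\<^sup>2) \<partial>lborel) < \<infinity>"
    and core: "\<And>z. z \<in> Domain core \<Longrightarrow> control_state AA CC (\<lambda>s. cinner_dual (k s)) \<zeta> T z = 0"
    and z: "z \<in> Domain AA"
  shows "control_state AA CC (\<lambda>s. cinner_dual (k s)) \<zeta> T z = 0"
proof -
  obtain z' where zz': "(z, z') \<in> AA"
    using z by blast
  then obtain p where p: "\<And>n. p n \<in> core" "p \<longlonglongrightarrow> (z, z')"
    unfolding closure_sequential by blast
  define a a' where "a n = fst (p n)" and "a' n = snd (p n)" for n
  have aa': "(a n, a' n) \<in> core" for n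
    using p(1) by (simp add: a_def a'_def)
  have aAA: "(a n, a' n) \<in> AA" for n
    using aa' core_subset by blast
  have lim: "a \<longlonglongrightarrow> z" "a' \<longlonglongrightarrow> z'"
    using tendsto_fst[OF p(2)] tendsto_snd[OF p(2)] by (simp_all add: a_def[abs_def] a'_def[abs_def])
  obtain c where c: "c \<ge> 0" "\<And>z z'. (z, z') \<in> AA \<Longrightarrow> ((z, z'), CC \<bullet>\<^sub>o z) \<in> observation_graph"
      "\<And>z z'. (z, z') \<in> AA \<Longrightarrow> norm (CC \<bullet>\<^sub>o z) \<le> c * (norm z + norm z')"
    using CC_bounded by metis
  obtain M where M: "M \<ge> 1" "\<And>t. t \<in> {0..T} \<Longrightarrow> norm (S t) \<le> M"
    using semigroup_bounded[OF S, of T] by blast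
  have CC_diff: "CC \<bullet>\<^sub>o (x - x') = CC \<bullet>\<^sub>o x - CC \<bullet>\<^sub>o x'" if "(x, y) \<in> AA" "(x', y') \<in> AA" for x y x' y'
    using subspace_diff[OF subspace_observation_graph c(2)[OF that(1)] c(2)[OF that(2)]]
    by (intro CC_apply[of _ "y - y'"]) simp
  have est: "norm (CC \<bullet>\<^sub>o (blinfun_apply (S t) x)) \<le> c * M * (norm x + norm y)"
    if "(x, y) \<in> AA" "t \<in> {0..T}" for x y t
  proof -
    have S_le: "norm (blinfun_apply (S t) u) \<le> M * norm u" for u
      using norm_blinfun[of "S t" u] mult_right_mono[OF M(2)[OF that(2)] norm_ge_zero] by (rule order_trans)
    have "norm (CC \<bullet>\<^sub>o (blinfun_apply (S t) x)) \<le> c * (norm (blinfun_apply (S t) x) + norm (blinfun_apply (S t) y))"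
      using that by (intro c(3) AA_invariant) auto
    also have "\<dots> \<le> c * (M * norm x + M * norm y)"
      using c(1) by (intro mult_left_mono add_mono S_le)
    finally show ?thesis
      by (simp add: algebra_simps)
  qed
  define D where "D x s = indicator {0..T} s *\<^sub>R (CC \<bullet>\<^sub>o (blinfun_apply (S (T - s)) x))" for x s
  have D_lim: "(\<lambda>n. D (a n) s) \<longlonglongrightarrow> D z s" for s
  proof (cases "s \<in> {0..T}")
    case True
    then have t: "T - s \<in> {0..T}" "T - s \<ge> 0"
      by auto
    have "(\<lambda>n. D (a n) s - D z s) \<longlonglongrightarrow> 0"
    proof (rule Lim_null_comparison[OF always_eventually])
      show "\<forall>n. norm (D (a n) s - D z s) \<le> c * M * (norm (a n - z) + norm (a' n - z'))"
      proof
        fix n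
        have "(a n - z, a' n - z') \<in> AA"
          using subspace_diff[OF subspace_AA aAA zz', of n] by simp
        from est[OF this t(1)] show "norm (D (a n) s - D z s) \<le> c * M * (norm (a n - z) + norm (a' n - z'))"
          using True CC_diff[OF AA_invariant[OF aAA t(2)] AA_invariant[OF zz' t(2)], of n]
          by (simp add: D_def blinfun.diff_right)
      qed
      show "(\<lambda>n. c * M * (norm (a n - z) + norm (a' n - z'))) \<longlonglongrightarrow> 0"
        using lim by (auto intro!: tendsto_eq_intros)
    qed
    then show ?thesis
      by (simp add: LIM_zero_iff)
  qed (simp add: D_def)
  have D_meas: "D (a n) \<in> borel_measurable lborel" for n
  proof -
    have "a n \<in> Domain core"
      using aa' by blast
    then have "continuous_on {0..T} (\<lambda>t. CC \<bullet>\<^sub>o blinfun_apply (S t) (a n))"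
      using core_observation_bound[OF T] by metis
    then have "continuous_on {0..T} (\<lambda>s. CC \<bullet>\<^sub>o blinfun_apply (S (T - s)) (a n))"
      by (rule continuous_on_compose2) (auto intro!: continuous_intros)
    then have "(\<lambda>s. indicator {0..T} s *\<^sub>R (CC \<bullet>\<^sub>o blinfun_apply (S (T - s)) (a n))) \<in> borel_measurable borel"
      by (intro borel_measurable_continuous_on_indicator) auto
    then show ?thesis
      unfolding D_def by simp
  qed
  have Dz_meas: "D z \<in> borel_measurable lborel"
    by (rule borel_measurable_LIMSEQ_metric[OF D_meas D_lim])
  obtain L where L: "\<And>n. norm (a n) + norm (a' n) \<le> L"
  proof -
    have "bounded (range p)"
      using p(2) convergent_imp_bounded by blast
    then obtain L where L: "\<And>n. norm (p n) \<le> L"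
      unfolding bounded_iff by auto
    have "norm (a n) + norm (a' n) \<le> 2 * L" for n
      using L[of n] norm_fst_le[of "a n" "a' n"] norm_snd_le[of "a' n" "a n"] by (simp add: a_def a'_def)
    then show ?thesis
      by (rule that)
  qed
  have L0: "L \<ge> 0"
    using L[of 0] norm_ge_zero[of "a 0"] norm_ge_zero[of "a' 0"] by linarith
  have D_le: "norm (D (a n) s) \<le> c * M * L" for n s
  proof (cases "s \<in> {0..T}")
    case True
    then have "norm (D (a n) s) \<le> c * M * (norm (a n) + norm (a' n))"
      using est[OF aAA[of n], of "T - s"] by (simp add: D_def)
    also have "\<dots> \<le> c * M * L"
      using c(1) M(1) L by (intro mult_left_mono) auto
    finally show ?thesis .
  qed (use c(1) M(1) L0 in \<open>simp add: D_def\<close>)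
  have state: "control_state AA CC (\<lambda>s. cinner_dual (k s)) \<zeta> T x
      = blinfun_apply \<zeta> (blinfun_apply (S T) x) + (LINT s|lborel. cinner (D x s) (k s))" for x
    unfolding control_state_AA[OF T] set_lebesgue_integral_def D_def
    by (simp add: bounded_bilinear.scaleR_left[OF bounded_bilinear_cinner])
  have "(\<lambda>n. LINT s|lborel. cinner (D (a n) s) (k s)) \<longlonglongrightarrow> (LINT s|lborel. cinner (D z s) (k s))"
  proof (rule integral_dominated_convergence[where w = "\<lambda>s. c * M * L * norm (k s)"])
    show "(\<lambda>s. cinner (D z s) (k s)) \<in> borel_measurable lborel"
      "(\<lambda>s. cinner (D (a n) s) (k s)) \<in> borel_measurable lborel" for n
      by (rule borel_measurable_bounded_bilinear[OF bounded_bilinear_cinner Dz_meas k(1)]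
          borel_measurable_bounded_bilinear[OF bounded_bilinear_cinner D_meas k(1)])+
    show "integrable lborel (\<lambda>s. c * M * L * norm (k s))"
      by (intro integrable_mult_right integrable_norm_of_square[OF k fin])
    show "AE s in lborel. (\<lambda>n. cinner (D (a n) s) (k s)) \<longlonglongrightarrow> cinner (D z s) (k s)"
      by (intro always_eventually allI bounded_bilinear.tendsto[OF bounded_bilinear_cinner] D_lim tendsto_const)
    show "AE s in lborel. norm (cinner (D (a n) s) (k s)) \<le> c * M * L * norm (k s)" for n
      by (intro always_eventually allI order_trans[OF norm_cinner_le] mult_right_mono D_le) auto
  qed
  then have "(\<lambda>n. control_state AA CC (\<lambda>s. cinner_dual (k s)) \<zeta> T (a n))
      \<longlonglongrightarrow> control_state AA CC (\<lambda>s. cinner_dual (k s)) \<zeta> T z"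
    unfolding state using lim(1) by (intro tendsto_add blinfun.tendsto tendsto_const)
  moreover have "control_state AA CC (\<lambda>s. cinner_dual (k s)) \<zeta> T (a n) = 0" for n
    using aa' by (intro core) blast
  ultimately show ?thesis
    by (simp add: LIMSEQ_const_iff)
qed

text \<open>The output at time \<open>T - s\<close> of the orbit of \<open>x\<close>, cut off outside \<open>[0, T]\<close>.\<close>

abbreviation orbit_output :: "real \<Rightarrow> 'x \<Rightarrow> real \<Rightarrow> 'v"
  where "orbit_output T x s \<equiv> indicator {0..T} s *\<^sub>R (C \<bullet>\<^sub>o (blinfun_apply (P (T - s)) x))"

lemma C_orbit_measurable:
  assumes "x \<in> Domain A"
  shows "(\<lambda>s. orbit_output T x s) \<in> borel_measurable lborel"
    and "\<exists>M\<ge>0. \<forall>s. norm (orbit_output T x s) \<le> M"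
proof -
  have cont: "continuous_on {0..T} (\<lambda>s. C \<bullet>\<^sub>o (blinfun_apply (P (T - s)) x))"
    by (rule continuous_on_compose2[OF C_orbit_continuous[OF assms]]) (auto intro!: continuous_intros)
  have "(\<lambda>s. orbit_output T x s) \<in> borel_measurable borel"
    by (rule borel_measurable_continuous_on_indicator[OF _ cont]) simp
  then show "(\<lambda>s. orbit_output T x s) \<in> borel_measurable lborel"
    by simp
  obtain M where "M > 0" "\<And>s. s \<in> {0..T} \<Longrightarrow> norm (C \<bullet>\<^sub>o (blinfun_apply (P (T - s)) x)) \<le> M"
    using compact_imp_bounded[OF compact_continuous_image[OF cont compact_Icc]]
    unfolding bounded_pos by auto
  then show "\<exists>M\<ge>0. \<forall>s. norm (orbit_output T x s) \<le> M"
    by (intro exI[of _ M]) (auto split: split_indicator)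
qed

lemma pairing_integrable:
  assumes x: "x \<in> Domain A" and G: "G \<in> borel_measurable lborel" "integrable lborel (\<lambda>s. norm (G s))"
  shows "integrable lborel (\<lambda>s. cinner (\<tau>' (orbit_output T x s) y) (G s))"
    and "\<exists>K. \<forall>y. norm (LINT s|lborel. cinner (\<tau>' (orbit_output T x s) y) (G s))
      \<le> norm y * K"
proof -
  obtain M where M: "M \<ge> 0" "\<And>s. norm (orbit_output T x s) \<le> M"
    using C_orbit_measurable(2)[OF x] by blast
  have le: "norm (cinner (\<tau>' (orbit_output T x s) y) (G s)) \<le> (norm y * M) * norm (G s)" for s y
  proof -
    have "norm (cinner (\<tau>' (orbit_output T x s) y) (G s)) \<le> norm (\<tau>' (orbit_output T x s) y) * norm (G s)"
      by (rule norm_cinner_le)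
    also have "\<dots> \<le> (M * norm y) * norm (G s)"
      unfolding norm_tensor[OF \<tau>'] by (intro mult_right_mono M) auto
    finally show ?thesis
      by (simp only: mult.commute[of M])
  qed
  have meas: "(\<lambda>s. cinner (\<tau>' (orbit_output T x s) y) (G s)) \<in> borel_measurable lborel" for y
    by (intro borel_measurable_bounded_bilinear[OF bounded_bilinear_cinner]
        borel_measurable_bounded_bilinear[OF bounded_bilinear_tensor[OF \<tau>']] C_orbit_measurable(1)[OF x] G(1)) simp
  have int: "integrable lborel (\<lambda>s. cinner (\<tau>' (orbit_output T x s) y) (G s))" for y
    by (rule Bochner_Integration.integrable_bound[OF integrable_mult_right[OF G(2), of "norm y * M"] meas])
      (use le[of _ y] M(1) in \<open>auto intro!: always_eventually simp: abs_mult\<close>)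
  show "integrable lborel (\<lambda>s. cinner (\<tau>' (orbit_output T x s) y) (G s))"
    by (rule int)
  have "norm (LINT s|lborel. cinner (\<tau>' (orbit_output T x s) y) (G s)) \<le> norm y * (M * (LINT s|lborel. norm (G s)))" for y
  proof -
    have "norm (LINT s|lborel. cinner (\<tau>' (orbit_output T x s) y) (G s)) \<le> (LINT s|lborel. (norm y * M) * norm (G s))"
      by (rule Bochner_Integration.integral_norm_bound_integral[OF int integrable_mult_right[OF G(2)] le])
    also have "\<dots> = norm y * (M * (LINT s|lborel. norm (G s)))"
      by (simp add: mult.assoc)
    finally show ?thesis .
  qed
  then show "\<exists>K. \<forall>y. norm (LINT s|lborel. cinner (\<tau>' (orbit_output T x s) y) (G s)) \<le> norm y * K"
    by blast
qed

text \<open>A control that acts correctly on \<open>x \<otimes> f\<^sub>j\<close> for all members \<open>f\<^sub>j\<close> of a basis acts correctly on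
  every \<open>x \<otimes> y\<close>.\<close>

lemma pairing_zero:
  assumes x: "x \<in> Domain A" and G: "G \<in> borel_measurable lborel" "integrable lborel (\<lambda>s. norm (G s))"
    and \<zeta>: "\<zeta> \<in> cdual" and f: "closure (span {c *\<^sub>C f i |c i. True}) = UNIV"
    and zero: "\<And>j. blinfun_apply \<zeta> (\<tau> x' (f j)) + (LINT s|lborel.
        cinner (\<tau>' (orbit_output T x s) (f j)) (G s)) = 0"
  shows "blinfun_apply \<zeta> (\<tau> x' y) + (LINT s|lborel.
        cinner (\<tau>' (orbit_output T x s) y) (G s)) = 0"
proof -
  define \<Psi> where "\<Psi> y = blinfun_apply \<zeta> (\<tau> x' y) + (LINT s|lborel. cinner (\<tau>' (orbit_output T x s) y) (G s))" for y
  note int = pairing_integrable(1)[OF x G]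
  note bil = bounded_bilinear_tensor[OF \<tau>'] and bil\<^sub>c = bounded_bilinear_cinner
  obtain K where K: "\<And>y. norm (LINT s|lborel. cinner (\<tau>' (orbit_output T x s) y) (G s)) \<le> norm y * K"
    using pairing_integrable(2)[OF x G] by blast
  have "bounded_linear (\<lambda>y. LINT s|lborel. cinner (\<tau>' (orbit_output T x s) y) (G s))"
  proof (rule bounded_linear_intro[OF _ _ K])
    show "(LINT s|lborel. cinner (\<tau>' (orbit_output T x s) (y + y')) (G s)) =
        (LINT s|lborel. cinner (\<tau>' (orbit_output T x s) y) (G s)) + (LINT s|lborel. cinner (\<tau>' (orbit_output T x s) y') (G s))" for y y'
      by (simp only: bounded_bilinear.add_right[OF bil] cinner_add_left Bochner_Integration.integral_add[OF int int])
    show "(LINT s|lborel. cinner (\<tau>' (orbit_output T x s) (r *\<^sub>R y)) (G s)) = r *\<^sub>R (LINT s|lborel. cinner (\<tau>' (orbit_output T x s) y) (G s))" for r y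
      by (simp only: bounded_bilinear.scaleR_right[OF bil] bounded_bilinear.scaleR_left[OF bil\<^sub>c] integral_scaleR_right)
  qed
  then have bl: "bounded_linear \<Psi>"
    unfolding \<Psi>_def
    by (intro bounded_linear_add bounded_linear_compose[OF blinfun.bounded_linear_right]
        bounded_bilinear.bounded_linear_right[OF bounded_bilinear_tensor[OF \<tau>]])
  have "\<Psi> (c *\<^sub>C y) = c * \<Psi> y" for c y
    using \<zeta> by (simp add: \<Psi>_def tensor_scaleC(2)[OF \<tau>] tensor_scaleC(2)[OF \<tau>'] cinner_scaleC_left cdual_def
        distrib_left)
  then have "Blinfun \<Psi> = 0"
    using zero by (intro blinfun_eq_on_dense_span[OF f]) (auto simp: bounded_linear_Blinfun_apply[OF bl] \<Psi>_def)
  then have "\<Psi> y = 0"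
    by (metis bounded_linear_Blinfun_apply[OF bl] zero_blinfun.rep_eq)
  then show ?thesis
    by (simp add: \<Psi>_def)
qed

text \<open>The control of the tensor product has the Riesz vectors \<open>k(s) = (I \<otimes> e\<^bsup>sB\<^esup>) G(s)\<close> with
  \<open>G(s) = \<Sum> g\<^sub>j(s) \<otimes> f\<^sub>j\<close>. The series converges for almost every \<open>s \<in> [0, T]\<close>, those in the set \<open>N\<close>;
  elsewhere \<open>G\<close> is zero.\<close>

lemma null_controllable_tensor:
  assumes T: "T > 0" and nc: "null_controllable A C T \<kappa>"
  shows "null_controllable AA CC T \<kappa>"
  unfolding null_controllable_def
proof
  fix \<zeta> :: "'z \<Rightarrow>\<^sub>L complex" assume \<zeta>: "\<zeta> \<in> cdual"
  obtain f :: "nat \<Rightarrow> 'y" where f: "orthonormal_seq f" "closure (span {c *\<^sub>C f i |c i. True}) = UNIV"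
    using orthonormal_basis_exists by blast
  define \<xi> where "\<xi> j = \<zeta> o\<^sub>L Blinfun (\<lambda>x. \<tau> x (f j))" for j
  have \<xi>: "blinfun_apply (\<xi> j) x = blinfun_apply \<zeta> (\<tau> x (f j))" for j x
    by (simp add: \<xi>_def bounded_linear_Blinfun_apply bounded_bilinear.bounded_linear_left[OF bounded_bilinear_tensor[OF \<tau>]])
  have \<xi>_dual: "\<xi> j \<in> cdual" for j
    using \<zeta> by (simp add: cdual_def \<xi> tensor_scaleC(1)[OF \<tau>])
  have "\<exists>g. g \<in> borel_measurable lborel \<and>
      (\<forall>x\<in>Domain A. control_state A C (\<lambda>s. cinner_dual (g s)) (\<xi> j) T x = 0) \<and>
      (\<integral>\<^sup>+s\<in>{0..T}. ennreal ((norm (g s))\<^sup>2) \<partial>lborel) \<le> ennreal (\<kappa>\<^sup>2 * (norm (\<xi> j))\<^sup>2)" for j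
  proof -
    obtain u where u: "L2_control u" "\<forall>x\<in>Domain A. control_state A C u (\<xi> j) T x = 0"
        "(\<integral>\<^sup>+s\<in>{0..T}. ennreal ((norm (u s))\<^sup>2) \<partial>lborel) \<le> ennreal (\<kappa>\<^sup>2 * (norm (\<xi> j))\<^sup>2)"
      using nc \<xi>_dual[of j] unfolding null_controllable_def by blast
    have "u \<in> borel_measurable lborel" "\<And>s. u s \<in> cdual"
      using u(1) by (auto simp: L2_control_def)
    then obtain g where g: "g \<in> borel_measurable lborel" "\<And>s. u s = cinner_dual (g s)"
      using borel_measurable_riesz by blast
    then have "u = (\<lambda>s. cinner_dual (g s))"
      by blast
    then show ?thesis
      using u(2,3) g(1) by (intro exI[of _ g]) (simp add: norm_cinner_dual)
  qed
  then have "\<exists>g. \<forall>j. g j \<in> borel_measurable lborel \<and>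
      (\<forall>x\<in>Domain A. control_state A C (\<lambda>s. cinner_dual (g j s)) (\<xi> j) T x = 0) \<and>
      (\<integral>\<^sup>+s\<in>{0..T}. ennreal ((norm (g j s))\<^sup>2) \<partial>lborel) \<le> ennreal (\<kappa>\<^sup>2 * (norm (\<xi> j))\<^sup>2)"
    by (intro choice allI)
  then obtain g where g_all: "\<forall>j. g j \<in> borel_measurable lborel \<and>
      (\<forall>x\<in>Domain A. control_state A C (\<lambda>s. cinner_dual (g j s)) (\<xi> j) T x = 0) \<and>
      (\<integral>\<^sup>+s\<in>{0..T}. ennreal ((norm (g j s))\<^sup>2) \<partial>lborel) \<le> ennreal (\<kappa>\<^sup>2 * (norm (\<xi> j))\<^sup>2)" ..
  have g: "g j \<in> borel_measurable lborel"
      "x \<in> Domain A \<Longrightarrow> control_state A C (\<lambda>s. cinner_dual (g j s)) (\<xi> j) T x = 0"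
      "(\<integral>\<^sup>+s\<in>{0..T}. ennreal ((norm (g j s))\<^sup>2) \<partial>lborel) \<le> ennreal (\<kappa>\<^sup>2 * (norm (\<xi> j))\<^sup>2)" for j x
    using spec[OF g_all, of j] by blast+
  have cost: "(\<Sum>j<n. \<integral>\<^sup>+s\<in>{0..T}. ennreal ((norm (g j s))\<^sup>2) \<partial>lborel) \<le> ennreal (\<kappa>\<^sup>2 * (norm \<zeta>)\<^sup>2)" for n
  proof -
    have "(\<Sum>j<n. \<integral>\<^sup>+s\<in>{0..T}. ennreal ((norm (g j s))\<^sup>2) \<partial>lborel) \<le> (\<Sum>j<n. ennreal (\<kappa>\<^sup>2 * (norm (\<xi> j))\<^sup>2))"
      by (intro sum_mono g(3))
    also have "\<dots> = ennreal (\<kappa>\<^sup>2 * (\<Sum>j<n. (norm (\<xi> j))\<^sup>2))"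
      by (simp add: sum_distrib_left)
    also have "\<dots> \<le> ennreal (\<kappa>\<^sup>2 * (norm \<zeta>)\<^sup>2)"
      by (intro ennreal_leI mult_left_mono dual_coefficients_bound[OF \<tau> f(1) \<xi>_dual \<xi>]) simp
    finally show ?thesis .
  qed
  define N where "N = {s\<in>{0..T}. summable (\<lambda>j. (norm (g j s))\<^sup>2)}"
  note N = AE_summable_squares[OF g(1) cost, folded N_def]
  have NT: "s \<in> {0..T}" "summable (\<lambda>j. (norm (g j s))\<^sup>2)" if "s \<in> N" for s
    using that unfolding N_def by blast+
  define G where "G s = (if s \<in> N then \<Sum>j. \<tau>' (g j s) (f j) else 0)" for s
  define U where "U s = tensor_right \<tau>' \<tau>' (Q s)" for s
  define k where "k s = blinfun_apply (U s) (G s)" for s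
  have U_tensor: "blinfun_apply (U s) (\<tau>' v y) = \<tau>' v (blinfun_apply (Q s) y)" if "s \<ge> 0" for s v y
    unfolding U_def by (rule tensor_right(1)[OF \<tau>' \<tau>' semigroup_scaleC[OF Q that]])
  have U_le: "norm (U s) \<le> 1" if "s \<ge> 0" for s
    unfolding U_def using tensor_right(2)[OF \<tau>' \<tau>' semigroup_scaleC[OF Q that]] Q_contraction[OF that]
    by (rule order_trans)
  have U_sa: "cinner a (blinfun_apply (U s) b) = cinner (blinfun_apply (U s) a) b" if s: "s \<ge> 0" for s a b
    unfolding U_def using B_selfadjoint
    by (intro tensor_right_selfadjoint[symmetric, OF \<tau>' semigroup_scaleC[OF Q s]] selfadjoint_semigroup[OF Q _ s])
      (simp add: genQ)
  have G_meas: "G \<in> borel_measurable lborel"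
    unfolding G_def by (rule borel_measurable_tensor_series[OF \<tau>' N(1) g(1)]) simp
  have k_eq: "k s = (if s \<in> N then \<Sum>j. \<tau>' (g j s) (blinfun_apply (Q (max 0 s)) (f j)) else 0)" for s
  proof (cases "s \<in> N")
    case True
    then have s: "s \<ge> 0" "max 0 s = s"
      using NT(1)[OF True] by auto
    have "blinfun_apply (U s) (\<Sum>j. \<tau>' (g j s) (f j)) = (\<Sum>j. blinfun_apply (U s) (\<tau>' (g j s) (f j)))"
      by (rule bounded_linear.suminf[OF blinfun.bounded_linear_right tensor_series(1)[OF \<tau>' f(1) NT(2)[OF True]]])
    then show ?thesis
      using True s by (simp add: k_def G_def U_tensor)
  qed (simp add: k_def G_def)
  have k_meas: "k \<in> borel_measurable lborel"
    unfolding k_eq[abs_def]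
  proof (rule borel_measurable_tensor_series[OF \<tau>' N(1) g(1)])
    fix j
    have "(\<lambda>s. blinfun_apply (Q (max 0 s)) (f j)) \<in> borel_measurable borel"
      by (intro borel_measurable_continuous_onI semigroup_continuous_on_compose[OF Q] continuous_intros) auto
    then show "(\<lambda>s. blinfun_apply (Q (max 0 s)) (f j)) \<in> borel_measurable lborel"
      by simp
  qed
  have k_le: "norm (k s) \<le> norm (G s)" for s
  proof (cases "s \<in> N")
    case True
    then have "s \<ge> 0"
      using NT(1)[OF True] by auto
    have "norm (k s) \<le> norm (U s) * norm (G s)"
      unfolding k_def by (rule norm_blinfun)
    also have "\<dots> \<le> 1 * norm (G s)"
      using U_le[OF \<open>s \<ge> 0\<close>] by (intro mult_right_mono) auto
    finally show ?thesis
      by simp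
  qed (simp add: k_def G_def)
  have outside: "G s = 0" "k s = 0" if "s \<notin> {0..T}" for s
    using NT(1) that by (auto simp: k_def G_def)
  have G_fin: "(\<integral>\<^sup>+s. ennreal ((norm (G s))\<^sup>2) \<partial>lborel) \<le> ennreal (\<kappa>\<^sup>2 * (norm \<zeta>)\<^sup>2)"
  proof (rule order_trans[OF nn_integral_mono N(3)])
    show "ennreal ((norm (G s))\<^sup>2) \<le> (if s \<in> N then ennreal (\<Sum>j. (norm (g j s))\<^sup>2) else 0)" for s
      using tensor_series(2)[OF \<tau>' f(1) NT(2)] by (auto simp: G_def intro: ennreal_leI)
  qed
  have k_fin: "(\<integral>\<^sup>+s. ennreal ((norm (k s))\<^sup>2) \<partial>lborel) \<le> ennreal (\<kappa>\<^sup>2 * (norm \<zeta>)\<^sup>2)"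
    using k_le by (intro order_trans[OF nn_integral_mono G_fin] ennreal_leI power_mono) auto
  have lt_inf: "ennreal (\<kappa>\<^sup>2 * (norm \<zeta>)\<^sup>2) < \<infinity>"
    by simp
  have G_int: "integrable lborel (\<lambda>s. norm (G s))"
    by (rule integrable_norm_of_square[OF G_meas outside(1) order_le_less_trans[OF G_fin lt_inf]])
  \<comment> \<open>The control acts on \<open>x \<otimes> y\<close> through \<open>x \<otimes> e\<^bsup>TB\<^esup> y\<close>, because \<open>e\<^bsup>sB\<^esup> e\<^bsup>(T - s)B\<^esup> = e\<^bsup>TB\<^esup>\<close> for all \<open>s\<close>.\<close>
  have zero: "blinfun_apply \<zeta> (\<tau> (blinfun_apply (P T) x) y) + (LINT s|lborel. cinner (\<tau>' (orbit_output T x s) y) (G s)) = 0"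
    if x: "x \<in> Domain A" for x y
  proof (rule pairing_zero[OF x G_meas G_int \<zeta> f(2)])
    fix j
    show "blinfun_apply \<zeta> (\<tau> (blinfun_apply (P T) x) (f j)) + (LINT s|lborel. cinner (\<tau>' (orbit_output T x s) (f j)) (G s)) = 0"
    proof (cases "f j = 0")
      case True
      then show ?thesis
        by (simp add: bounded_bilinear.zero_right[OF bounded_bilinear_tensor[OF \<tau>]]
            bounded_bilinear.zero_right[OF bounded_bilinear_tensor[OF \<tau>']])
    next
      case False
      have "(LINT s|lborel. cinner (\<tau>' (orbit_output T x s) (f j)) (G s)) = (LINT s|lborel. cinner (orbit_output T x s) (g j s))"
      proof (rule integral_cong_AE)
        show "(\<lambda>s. cinner (\<tau>' (orbit_output T x s) (f j)) (G s)) \<in> borel_measurable lborel"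
          by (rule borel_measurable_integrable[OF pairing_integrable(1)[OF x G_meas G_int]])
        show "(\<lambda>s. cinner (orbit_output T x s) (g j s)) \<in> borel_measurable lborel"
          by (rule borel_measurable_bounded_bilinear[OF bounded_bilinear_cinner C_orbit_measurable(1)[OF x] g(1)])
        show "AE s in lborel. cinner (\<tau>' (orbit_output T x s) (f j)) (G s) = cinner (orbit_output T x s) (g j s)"
          using N(2)
        proof eventually_elim
          case (elim s)
          show ?case
          proof (cases "s \<in> {0..T}")
            case True
            with elim have s: "s \<in> N"
              by blast
            show ?thesis
              unfolding G_def if_P[OF s] by (rule tensor_series_coeff[OF \<tau>' f(1) NT(2)[OF s] False])
          qed (simp add: outside bounded_bilinear.zero_left[OF bounded_bilinear_tensor[OF \<tau>']])
        qed
      qed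
      moreover have "(LINT s|lborel. cinner (orbit_output T x s) (g j s)) =
          (LBINT s:{0..T}. cinner (C \<bullet>\<^sub>o (blinfun_apply (P (T - s)) x)) (g j s))"
        by (simp add: set_lebesgue_integral_def bounded_bilinear.scaleR_left[OF bounded_bilinear_cinner])
      ultimately show ?thesis
        using g(2)[OF x, of j] by (simp add: control_state_def \<xi>)
    qed
  qed
  have core: "control_state AA CC (\<lambda>s. cinner_dual (k s)) \<zeta> T z = 0" if z: "z \<in> Domain core" for z
  proof -
    obtain F x where F: "finite F" "F \<subseteq> Domain B" "\<And>e. e \<in> F \<Longrightarrow> x e \<in> Domain A"
        and z_eq: "z = (\<Sum>e\<in>F. \<tau> (x e) e)"
      using core_form[OF z] by metis
    obtain z' where z': "(z, z') \<in> AA"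
      using z core_subset by blast
    have "cinner (CC \<bullet>\<^sub>o blinfun_apply (S (T - s)) z) (k s)
        = (\<Sum>e\<in>F. cinner (\<tau>' (C \<bullet>\<^sub>o (blinfun_apply (P (T - s)) (x e))) (blinfun_apply (Q T) e)) (G s))"
      if s: "s \<in> {0..T}" for s
    proof -
      have s0: "s \<ge> 0" "T - s \<ge> 0"
        using s by auto
      have QQ: "blinfun_apply (Q s) (blinfun_apply (Q (T - s)) e) = blinfun_apply (Q T) e" for e
        using semigroup_add[OF Q s0, of e] by simp
      have "CC \<bullet>\<^sub>o blinfun_apply (S (T - s)) z =
          (\<Sum>e\<in>F. \<tau>' (C \<bullet>\<^sub>o blinfun_apply (P (T - s)) (x e)) (blinfun_apply (Q (T - s)) e))"
        by (rule CC_apply[OF observation_orbit[OF F z_eq z' s0(2)]])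
      then show ?thesis
        by (simp add: k_def U_sa[OF s0(1)] blinfun.sum_right U_tensor[OF s0(1)] QQ cinner_sum_left)
    qed
    then have "(LBINT s:{0..T}. cinner (CC \<bullet>\<^sub>o blinfun_apply (S (T - s)) z) (k s))
        = (LBINT s:{0..T}. \<Sum>e\<in>F. cinner (\<tau>' (C \<bullet>\<^sub>o (blinfun_apply (P (T - s)) (x e))) (blinfun_apply (Q T) e)) (G s))"
      by (intro set_lebesgue_integral_cong) auto
    also have "\<dots> = (LINT s|lborel. (\<Sum>e\<in>F. cinner (\<tau>' (orbit_output T (x e) s) (blinfun_apply (Q T) e)) (G s)))"
      by (simp add: set_lebesgue_integral_def scaleR_sum_right
          bounded_bilinear.scaleR_left[OF bounded_bilinear_cinner]
          bounded_bilinear.scaleR_left[OF bounded_bilinear_tensor[OF \<tau>']])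
    also have "\<dots> = (\<Sum>e\<in>F. (LINT s|lborel. cinner (\<tau>' (orbit_output T (x e) s) (blinfun_apply (Q T) e)) (G s)))"
      by (intro Bochner_Integration.integral_sum pairing_integrable(1) F(3) G_meas G_int)
    finally have "control_state AA CC (\<lambda>s. cinner_dual (k s)) \<zeta> T z =
        blinfun_apply \<zeta> (blinfun_apply (S T) z) + (\<Sum>e\<in>F. (LINT s|lborel. cinner (\<tau>' (orbit_output T (x e) s) (blinfun_apply (Q T) e)) (G s)))"
      by (simp add: control_state_AA[OF T])
    also have "\<dots> = (\<Sum>e\<in>F. blinfun_apply \<zeta> (\<tau> (blinfun_apply (P T) (x e)) (blinfun_apply (Q T) e))
        + (LINT s|lborel. cinner (\<tau>' (orbit_output T (x e) s) (blinfun_apply (Q T) e)) (G s)))"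
      using T by (simp add: z_eq blinfun.sum_right S_tensor sum.distrib)
    also have "\<dots> = 0"
      by (intro sum.neutral ballI zero F(3))
    finally show ?thesis .
  qed
  show "\<exists>u. L2_control u \<and> (\<forall>z\<in>Domain AA. control_state AA CC u \<zeta> T z = 0) \<and>
      (\<integral>\<^sup>+s\<in>{0..T}. ennreal ((norm (u s))\<^sup>2) \<partial>lborel) \<le> ennreal (\<kappa>\<^sup>2 * (norm \<zeta>)\<^sup>2)"
  proof (intro exI conjI ballI)
    show "L2_control (\<lambda>s. cinner_dual (k s))"
      unfolding L2_control_def
    proof (intro conjI allI)
      show "(\<lambda>s. cinner_dual (k s)) \<in> borel_measurable lborel"
        by (rule borel_measurable_continuous_on[OF linear_continuous_on[OF bounded_linear_cinner_dual] k_meas])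
      show "(\<integral>\<^sup>+s. ennreal ((norm (cinner_dual (k s)))\<^sup>2) \<partial>lborel) < \<infinity>"
        using order_le_less_trans[OF k_fin lt_inf] by (simp add: norm_cinner_dual)
    qed (rule cinner_dual_in_cdual)
    show "control_state AA CC (\<lambda>s. cinner_dual (k s)) \<zeta> T z = 0" if "z \<in> Domain AA" for z
      by (rule control_state_extend[OF T k_meas outside(2) order_le_less_trans[OF k_fin lt_inf] core that])
    have "(\<integral>\<^sup>+s\<in>{0..T}. ennreal ((norm (cinner_dual (k s)))\<^sup>2) \<partial>lborel) \<le> (\<integral>\<^sup>+s. ennreal ((norm (k s))\<^sup>2) \<partial>lborel)"
      by (intro nn_integral_mono) (auto simp: norm_cinner_dual split: split_indicator)
    then show "(\<integral>\<^sup>+s\<in>{0..T}. ennreal ((norm (cinner_dual (k s)))\<^sup>2) \<partial>lborel) \<le> ennreal (\<kappa>\<^sup>2 * (norm \<zeta>)\<^sup>2)"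
      using k_fin by (rule order_trans)
  qed
qed

end

theorem lemma2p2:
  fixes A :: "('x::{chilbert_space,second_countable_topology} \<times> 'x) set"
    and B :: "('y::{chilbert_space,second_countable_topology} \<times> 'y) set"
    and C :: "('x \<times> 'v::{chilbert_space,second_countable_topology}) set"
    and tXY :: "'x \<Rightarrow> 'y \<Rightarrow> 'z::{chilbert_space,second_countable_topology}"
    and tVY :: "'v \<Rightarrow> 'y \<Rightarrow> 'w::{chilbert_space,second_countable_topology}"
    and \<A> :: "('z \<times> 'z) set"
    and \<C> :: "('z \<times> 'w) set"
    and \<beta> :: complex
    and T :: real
  assumes "hilbert_tensor tXY"
    and "hilbert_tensor tVY"
    and "generates_semigroup A"
    and "generates_semigroup B"
    and "\<beta> \<notin> spectrum A"
    and "bounded_on_Z1 \<beta> A C"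
    and "admissible A C"
    and "\<A> = closure (tensor_sum tXY A B)"
    and "\<C> = Z1_extension \<A> (tensor_id tXY tVY C)"
    and "selfadjoint B"
    and "nonpositive B"
    and "T > 0"
  shows "null_control_cost \<A> \<C> T \<le> null_control_cost A C T"
proof -
  interpret tensor_observation A B C tXY tVY \<beta>
    using assms by unfold_locales
  have "null_controllable \<A> \<C> T \<kappa>" if "null_controllable A C T \<kappa>" for \<kappa>
    unfolding assms(8,9) by (rule null_controllable_tensor[OF assms(12) that])
  then show ?thesis
    unfolding null_control_cost_def by (intro Inf_superset_mono image_mono) auto
qed

end
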